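(* The linear functions $T_0$, $T_p$, and $T_s^{+}$, $T_s^{-}$, $G_s$ for $1\le s\le p-1$ are symmetric linear functions on $\overline{U}_q(sl_2)$, and together they form a basis of the space $\mathrm{SLF}(\overline{U}_q(sl_2))$ of symmetric linear functions.
   Context: Let $p\ge 2$ be an integer and $q=\exp(\pi\sqrt{-1}/p)$. $\overline{U}_q(sl_2)$ is the associative unital $\mathbb{C}$-algebra generated by $E,F,K,K^{-1}$ with relations $KK^{-1}=K^{-1}K=1$, $KEK^{-1}=q^2E$, $KFK^{-1}=q^{-2}F$, $EF-FE=\frac{K-K^{-1}}{q-q^{-1}}$, $E^p=F^p=0$, $K^{2p}=1$. For a finite-dimensional algebra $A$, $\mathrm{SLF}(A)$ is the space of linear maps $\varphi:A\to\mathbb{C}$ with $\varphi(ab)=\varphi(ba)$ for all $a,b\in A$. Write $[n]=\frac{q^n-q^{-n}}{q-q^{-1}}$. Empty products are $1$ and empty sums are $0$. A sign $\alpha\in\{+,-\}$ is identified with $\pm1$. The Casimir element $C=EF+\frac{q^{-1}K+qK^{-1}}{(q-q^{-1})^2}$ is central, and $\overline{U}_q(sl_2)=\bigoplus_{s=0}^pQ_s$ as algebras, where $Q_s$ is the generalized eigenspace of (multiplication by) $C$ with eigenvalue $\frac{q^s+q^{-s}}{(q-q^{-1})^2}$. For $1\le s,t\le p$ put $v^\alpha(s,t)=\sum_{\ell=0}^{2p-1}(\alpha q^{-(s-2t+1)})^\ell K^\ell$ and $a_n^\alpha(s,t)=F^nE^{p-1}F^{p-t}v^\alpha(s,t)$.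 For $1\le s\le p-1$, $1\le t\le s$, $0\le n\le s-1$, $0\le k\le p-s-1$ put $\mu_m^\alpha(s)=\prod_{j=p-s-(m-1)}^{p-s-1}(-\alpha[j][p-s-j])$, $b_n^\alpha(s,t)=F^n\sum_{m=1}^{p-s}\mu_m^\alpha(s)E^{p-m-1}F^{p-t-m}v^\alpha(s,t)$, $y_k^\alpha(s,t)=F^{s+k}b_0^\alpha(s,t)$, $x_k^\alpha(s,t)=\frac{E^{p-s-k-1}}{\prod_{i=k+1}^{p-s-1}(-\alpha[i][p-s-i])}\sum_{m=1}^{p-s}\mu_m^\alpha(s)E^{p-m}F^{p-t-m}v^\alpha(s,t)$. For $1\le s\le p-1$ put $\gamma_s=2p\prod_{m=1}^{p-s-1}(-[m][p-s-m])\prod_{i=1}^{s-1}([i][s-i])$ and $\delta_s=2p\prod_{m=1}^{p-s-1}(-[m][p-s-m])\sum_{j=1}^{s-1}\prod_{1\le k\le s-1,\,k\ne j}([k][s-k])+2p\prod_{i=1}^{s-1}([i][s-i])\sum_{n=1}^{p-s-1}\prod_{1\le k\le p-s-1,\,k\ne n}(-[k][p-s-k])$. Bases. $Q_p$ (sign $+$) and $Q_0$ (sign $-$) have bases $A_n^{\pm}(p,t)=\frac{1}{2p\prod_{i=1}^{p-1}(\pm[i][p-i])}a_n^{\pm}(p,t)$, $0\le n\le p-1$, $1\le t\le p$. For $1\le s\le p-1$, $Q_s$ has the basis consisting of the following elements ($1\le t\le s$, $1\le u\le p-s$, $0\le n\le s-1$, $0\le k\le p-s-1$): $B_n^+(s,t)=\frac1{\gamma_s}\big(b_n^+(s,t)-\frac{\delta_s}{\gamma_s}a_n^+(s,t)\big)$,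 $X_k^+(s,t)=\frac1{\gamma_s}x_k^+(s,t)$, $Y_k^+(s,t)=\frac1{\gamma_s}y_k^+(s,t)$, $A_n^+(s,t)=\frac1{\gamma_s}a_n^+(s,t)$, $B_k^-(p-s,u)=\frac1{\gamma_s}\big(b_k^-(p-s,u)-\frac{\delta_s}{\gamma_s}a_k^-(p-s,u)\big)$, $X_n^-(p-s,u)=\frac1{\gamma_s}x_n^-(p-s,u)$, $Y_n^-(p-s,u)=\frac1{\gamma_s}y_n^-(p-s,u)$, $A_k^-(p-s,u)=\frac1{\gamma_s}a_k^-(p-s,u)$. Linear functions (each defined on the indicated $Q_s$ and extended by $0$ to the other summands): for $x\in Q_p$ (resp. $Q_0$), $T_p(x)$ (resp. $T_0(x)$) is $\sum_{t=1}^p$ of the coefficient of $A_{t-1}^+(p,t)$ (resp. $A_{t-1}^-(p,t)$) in $x$. For $1\le s\le p-1$ and $x\in Q_s$, let $\varphi^+_{n,t}(x),\psi^+_{n,t}(x),\varphi^-_{k,u}(x),\psi^-_{k,u}(x)$ be the coefficients of $B_n^+(s,t)$, $A_n^+(s,t)$, $B_k^-(p-s,u)$, $A_k^-(p-s,u)$ in the expansion of $x$ in the basis of $Q_s$ formed by the elements $B_n^+(s,t)$, $X_k^+(s,t)$, $Y_k^+(s,t)$, $A_n^+(s,t)$, $B_k^-(p-s,u)$, $X_n^-(p-s,u)$, $Y_n^-(p-s,u)$, $A_k^-(p-s,u)$ ($1\le t\le s$, $1\le u\le p-s$, $0\le n\le s-1$, $0\le k\le p-s-1$); then $T_s^+(x)=\sum_{t=1}^s\varphi^+_{t-1,t}(x)$,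 $T_s^-(x)=\sum_{u=1}^{p-s}\varphi^-_{u-1,u}(x)$, $G_s(x)=\sum_{t=1}^s\psi^+_{t-1,t}(x)+\sum_{u=1}^{p-s}\psi^-_{u-1,u}(x)$. *)

theory Defs
  imports
    "HOL-Analysis.Analysis"
    "HOL-Library.Poly_Mapping"
    "HOL-Library.Function_Algebras"
begin

section \<open>Unital associative complex algebras\<close>

class scaleC =
  fixes scaleC :: "complex \<Rightarrow> 'a \<Rightarrow> 'a"  (infixr \<open>*\<^sub>C\<close> 75)

class complex_algebra_1 = ring_1 + scaleC +
  assumes scaleC_add_right: "c *\<^sub>C (x + y) = c *\<^sub>C x + c *\<^sub>C y"
    and scaleC_add_left: "(c + d) *\<^sub>C x = c *\<^sub>C x + d *\<^sub>C x"
    and scaleC_scaleC: "c *\<^sub>C d *\<^sub>C x = (c * d) *\<^sub>C x"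
    and scaleC_one: "1 *\<^sub>C x = x"
    and mult_scaleC_left: "(c *\<^sub>C x) * y = c *\<^sub>C (x * y)"
    and mult_scaleC_right: "x * (c *\<^sub>C y) = c *\<^sub>C (x * y)"

global_interpretation complex_vec: vector_space "scaleC :: complex \<Rightarrow> 'a \<Rightarrow> 'a::complex_algebra_1"
  by unfold_locales (simp_all add: scaleC_add_right scaleC_add_left scaleC_scaleC scaleC_one)

text \<open>Linear functions on an algebra form a subspace of the space of all complex-valued functions
  with pointwise operations.\<close>

definition scale_fun :: "complex \<Rightarrow> ('a \<Rightarrow> complex) \<Rightarrow> 'a \<Rightarrow> complex"
  where "scale_fun c \<phi> = (\<lambda>x. c * \<phi> x)"

global_interpretation complex_fun: vector_space "scale_fun :: complex \<Rightarrow> ('a \<Rightarrow> complex) \<Rightarrow> _"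
  by unfold_locales (auto simp: scale_fun_def fun_eq_iff algebra_simps)

definition SLF :: "('a::complex_algebra_1 \<Rightarrow> complex) set"
  where "SLF = {\<phi>. Vector_Spaces.linear scaleC (*) \<phi> \<and> (\<forall>a b. \<phi> (a * b) = \<phi> (b * a))}"


section \<open>Algebras presented by generators and relations\<close>

text \<open>Words over an alphabet form a monoid under concatenation, written additively, so that
  \<open>'g list \<Rightarrow>\<^sub>0 complex\<close> with its convolution product is the free unital associative algebra on \<open>'g\<close>.\<close>

instantiation list :: (type) monoid_add
begin

definition zero_list :: "'a list" where "zero_list = []"

definition plus_list :: "'a list \<Rightarrow> 'a list \<Rightarrow> 'a list" where "plus_list u v = u @ v"

instance
  by standard (simp_all add: zero_list_def plus_list_def)

end

type_synonym 'g free_algebra = "'g list \<Rightarrow>\<^sub>0 complex"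

definition free_var :: "'g \<Rightarrow> 'g free_algebra"
  where "free_var g = Poly_Mapping.single [g] 1"

definition free_const :: "complex \<Rightarrow> 'g free_algebra"
  where "free_const c = Poly_Mapping.single [] c"

definition free_eval :: "('g \<Rightarrow> 'a::complex_algebra_1) \<Rightarrow> 'g free_algebra \<Rightarrow> 'a"
  where "free_eval h f =
    (\<Sum>w\<in>Poly_Mapping.keys f. Poly_Mapping.lookup f w *\<^sub>C prod_list (map h w))"

inductive_set two_sided_ideal :: "'r::ring_1 set \<Rightarrow> 'r set" for R :: "'r set"
  where
    zero: "0 \<in> two_sided_ideal R"
  | gen: "r \<in> R \<Longrightarrow> r \<in> two_sided_ideal R"
  | add: "x \<in> two_sided_ideal R \<Longrightarrow> y \<in> two_sided_ideal R \<Longrightarrow> x + y \<in> two_sided_ideal R"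
  | mult_left: "x \<in> two_sided_ideal R \<Longrightarrow> a * x \<in> two_sided_ideal R"
  | mult_right: "x \<in> two_sided_ideal R \<Longrightarrow> x * a \<in> two_sided_ideal R"

text \<open>The type \<open>'a\<close>, with the elements \<open>h g\<close>, is the algebra with generators \<open>'g\<close> and
  relations \<open>r = 0\<close> for \<open>r \<in> R\<close>: the canonical map from the free algebra is onto, and its kernel
  is the ideal generated by \<open>R\<close>.\<close>

definition presented_by :: "'g free_algebra set \<Rightarrow> ('g \<Rightarrow> 'a::complex_algebra_1) \<Rightarrow> bool"
  where "presented_by R h \<longleftrightarrow>
    surj (free_eval h) \<and> {f. free_eval h f = 0} = two_sided_ideal R"


section \<open>The restricted quantum group\<close>

definition qroot :: "nat \<Rightarrow> complex"
  where "qroot p = exp (of_real pi * \<i> / of_nat p)"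

definition qint :: "nat \<Rightarrow> nat \<Rightarrow> complex"
  where "qint p n = (qroot p powi int n - qroot p powi (- int n)) / (qroot p - inverse (qroot p))"

datatype uq_gen = gen_E | gen_F | gen_K | gen_Kinv

definition uq_relators :: "nat \<Rightarrow> uq_gen free_algebra set"
  where "uq_relators p =
   (let q = qroot p; e = free_var gen_E; f = free_var gen_F;
        k = free_var gen_K; k' = free_var gen_Kinv
    in {k * k' - 1, k' * k - 1,
        k * e * k' - free_const (q powi 2) * e,
        k * f * k' - free_const (q powi (- 2)) * f,
        e * f - f * e - free_const (1 / (q - inverse q)) * (k - k'),
        e ^ p, f ^ p, k ^ (2 * p) - 1})"

fun uq_assign :: "'a \<Rightarrow> 'a \<Rightarrow> 'a \<Rightarrow> 'a \<Rightarrow> uq_gen \<Rightarrow> 'a"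
  where
    "uq_assign E F K Ki gen_E = E"
  | "uq_assign E F K Ki gen_F = F"
  | "uq_assign E F K Ki gen_K = K"
  | "uq_assign E F K Ki gen_Kinv = Ki"

definition is_restricted_uq_sl2 ::
    "nat \<Rightarrow> 'a::complex_algebra_1 \<Rightarrow> 'a \<Rightarrow> 'a \<Rightarrow> 'a \<Rightarrow> bool"
  where "is_restricted_uq_sl2 p E F K Ki \<longleftrightarrow>
    presented_by (uq_relators p) (uq_assign E F K Ki)"


section \<open>Bases of the blocks\<close>

text \<open>Signs \<open>\<alpha>\<close> are the complex numbers \<open>1\<close> and \<open>-1\<close>. Within the ranges of the indices no
  subtraction of natural numbers below is truncated, except in empty products and sums.\<close>

definition mu :: "nat \<Rightarrow> complex \<Rightarrow> nat \<Rightarrow> nat \<Rightarrow> complex"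
  where "mu p \<alpha> m s = (\<Prod>j\<in>{p - s - (m - 1)..p - s - 1}. - \<alpha> * qint p j * qint p (p - s - j))"

definition gamma_s :: "nat \<Rightarrow> nat \<Rightarrow> complex"
  where "gamma_s p s =
    2 * of_nat p * (\<Prod>m\<in>{1..p - s - 1}. - qint p m * qint p (p - s - m))
      * (\<Prod>i\<in>{1..s - 1}. qint p i * qint p (s - i))"

definition delta_s :: "nat \<Rightarrow> nat \<Rightarrow> complex"
  where "delta_s p s =
    2 * of_nat p * (\<Prod>m\<in>{1..p - s - 1}. - qint p m * qint p (p - s - m))
      * (\<Sum>j\<in>{1..s - 1}. \<Prod>k\<in>{1..s - 1} - {j}. qint p k * qint p (s - k))
    + 2 * of_nat p * (\<Prod>i\<in>{1..s - 1}. qint p i * qint p (s - i))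
      * (\<Sum>n\<in>{1..p - s - 1}. \<Prod>k\<in>{1..p - s - 1} - {n}. - qint p k * qint p (p - s - k))"

context
  fixes p :: nat and E F K Ki :: "'a::complex_algebra_1"
begin

definition vv :: "complex \<Rightarrow> nat \<Rightarrow> nat \<Rightarrow> 'a"
  where "vv \<alpha> s t =
    (\<Sum>l<2 * p. (\<alpha> * qroot p powi (- (int s - 2 * int t + 1))) ^ l *\<^sub>C K ^ l)"

definition elt_a :: "complex \<Rightarrow> nat \<Rightarrow> nat \<Rightarrow> nat \<Rightarrow> 'a"
  where "elt_a \<alpha> n s t = F ^ n * E ^ (p - 1) * F ^ (p - t) * vv \<alpha> s t"

definition elt_b :: "complex \<Rightarrow> nat \<Rightarrow> nat \<Rightarrow> nat \<Rightarrow> 'a"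
  where "elt_b \<alpha> n s t = F ^ n *
    (\<Sum>m\<in>{1..p - s}. mu p \<alpha> m s *\<^sub>C (E ^ (p - m - 1) * F ^ (p - t - m) * vv \<alpha> s t))"

definition elt_y :: "complex \<Rightarrow> nat \<Rightarrow> nat \<Rightarrow> nat \<Rightarrow> 'a"
  where "elt_y \<alpha> k s t = F ^ (s + k) * elt_b \<alpha> 0 s t"

definition elt_x :: "complex \<Rightarrow> nat \<Rightarrow> nat \<Rightarrow> nat \<Rightarrow> 'a"
  where "elt_x \<alpha> k s t =
    (1 / (\<Prod>i\<in>{k + 1..p - s - 1}. - \<alpha> * qint p i * qint p (p - s - i))) *\<^sub>C
    (E ^ (p - s - k - 1) *
      (\<Sum>m\<in>{1..p - s}. mu p \<alpha> m s *\<^sub>C (E ^ (p - m) * F ^ (p - t - m) * vv \<alpha> s t)))"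

text \<open>The basis elements \<open>A\<^sub>n\<^sup>\<plusminus>(p,t)\<close> of \<open>Q\<^sub>p\<close> (for \<open>\<alpha> = 1\<close>) and \<open>Q\<^sub>0\<close> (for \<open>\<alpha> = -1\<close>).\<close>

definition simple_A :: "complex \<Rightarrow> nat \<Rightarrow> nat \<Rightarrow> 'a"
  where "simple_A \<alpha> n t =
    (1 / (2 * of_nat p * (\<Prod>i\<in>{1..p - 1}. \<alpha> * qint p i * qint p (p - i)))) *\<^sub>C elt_a \<alpha> n p t"

text \<open>The normalised elements of \<open>Q\<^sub>s\<close> for \<open>1 \<le> s \<le> p - 1\<close>. The sign \<open>-\<close> elements of \<open>Q\<^sub>s\<close> carry the
  parameter \<open>p - s\<close>, but are normalised with the same \<open>\<gamma>\<^sub>s\<close>, \<open>\<delta>\<^sub>s\<close>.\<close>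

definition Bplus :: "nat \<Rightarrow> nat \<Rightarrow> nat \<Rightarrow> 'a"
  where "Bplus s n t =
    (1 / gamma_s p s) *\<^sub>C (elt_b 1 n s t - (delta_s p s / gamma_s p s) *\<^sub>C elt_a 1 n s t)"

definition Xplus :: "nat \<Rightarrow> nat \<Rightarrow> nat \<Rightarrow> 'a"
  where "Xplus s k t = (1 / gamma_s p s) *\<^sub>C elt_x 1 k s t"

definition Yplus :: "nat \<Rightarrow> nat \<Rightarrow> nat \<Rightarrow> 'a"
  where "Yplus s k t = (1 / gamma_s p s) *\<^sub>C elt_y 1 k s t"

definition Aplus :: "nat \<Rightarrow> nat \<Rightarrow> nat \<Rightarrow> 'a"
  where "Aplus s n t = (1 / gamma_s p s) *\<^sub>C elt_a 1 n s t"

definition Bminus :: "nat \<Rightarrow> nat \<Rightarrow> nat \<Rightarrow> 'a"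
  where "Bminus s k u =
    (1 / gamma_s p s) *\<^sub>C
      (elt_b (- 1) k (p - s) u - (delta_s p s / gamma_s p s) *\<^sub>C elt_a (- 1) k (p - s) u)"

definition Xminus :: "nat \<Rightarrow> nat \<Rightarrow> nat \<Rightarrow> 'a"
  where "Xminus s n u = (1 / gamma_s p s) *\<^sub>C elt_x (- 1) n (p - s) u"

definition Yminus :: "nat \<Rightarrow> nat \<Rightarrow> nat \<Rightarrow> 'a"
  where "Yminus s n u = (1 / gamma_s p s) *\<^sub>C elt_y (- 1) n (p - s) u"

definition Aminus :: "nat \<Rightarrow> nat \<Rightarrow> nat \<Rightarrow> 'a"
  where "Aminus s k u = (1 / gamma_s p s) *\<^sub>C elt_a (- 1) k (p - s) u"

definition block_basis :: "nat \<Rightarrow> 'a set"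
  where "block_basis s =
   (if s = p then {simple_A 1 n t | n t. n \<in> {0..p - 1} \<and> t \<in> {1..p}}
    else if s = 0 then {simple_A (- 1) n t | n t. n \<in> {0..p - 1} \<and> t \<in> {1..p}}
    else
      {Bplus s n t | n t. n \<in> {0..s - 1} \<and> t \<in> {1..s}} \<union>
      {Xplus s k t | k t. k \<in> {0..p - s - 1} \<and> t \<in> {1..s}} \<union>
      {Yplus s k t | k t. k \<in> {0..p - s - 1} \<and> t \<in> {1..s}} \<union>
      {Aplus s n t | n t. n \<in> {0..s - 1} \<and> t \<in> {1..s}} \<union>
      {Bminus s k u | k u. k \<in> {0..p - s - 1} \<and> u \<in> {1..p - s}} \<union>
      {Xminus s n u | n u. n \<in> {0..s - 1} \<and> u \<in> {1..p - s}} \<union>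
      {Yminus s n u | n u. n \<in> {0..s - 1} \<and> u \<in> {1..p - s}} \<union>
      {Aminus s k u | k u. k \<in> {0..p - s - 1} \<and> u \<in> {1..p - s}})"


section \<open>The block decomposition and the linear functions\<close>

definition casimir :: 'a
  where "casimir = E * F +
    (1 / (qroot p - inverse (qroot p))\<^sup>2) *\<^sub>C (inverse (qroot p) *\<^sub>C K + qroot p *\<^sub>C Ki)"

definition casimir_eigenvalue :: "nat \<Rightarrow> complex"
  where "casimir_eigenvalue s =
    (qroot p powi int s + qroot p powi (- int s)) / (qroot p - inverse (qroot p))\<^sup>2"

definition block :: "nat \<Rightarrow> 'a set"
  where "block s =
    {x. \<exists>n. ((\<lambda>y. casimir * y - casimir_eigenvalue s *\<^sub>C y) ^^ n) x = 0}"

text \<open>The component in \<open>block s\<close> with respect to the direct sum of all blocks.\<close>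

definition block_component :: "nat \<Rightarrow> 'a \<Rightarrow> 'a"
  where "block_component s x =
    (THE y. \<exists>g. (\<forall>j\<le>p. g j \<in> block j) \<and> x = (\<Sum>j\<le>p. g j) \<and> y = g s)"

text \<open>Coefficient of the basis element \<open>b\<close> of \<open>block s\<close>, extended by \<open>0\<close> to the other blocks.\<close>

definition block_coeff :: "nat \<Rightarrow> 'a \<Rightarrow> 'a \<Rightarrow> complex"
  where "block_coeff s b x = complex_vec.representation (block_basis s) (block_component s x) b"

definition T_zero :: "'a \<Rightarrow> complex"
  where "T_zero x = (\<Sum>t\<in>{1..p}. block_coeff 0 (simple_A (- 1) (t - 1) t) x)"

definition T_top :: "'a \<Rightarrow> complex"
  where "T_top x = (\<Sum>t\<in>{1..p}. block_coeff p (simple_A 1 (t - 1) t) x)"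

definition T_plus :: "nat \<Rightarrow> 'a \<Rightarrow> complex"
  where "T_plus s x = (\<Sum>t\<in>{1..s}. block_coeff s (Bplus s (t - 1) t) x)"

definition T_minus :: "nat \<Rightarrow> 'a \<Rightarrow> complex"
  where "T_minus s x = (\<Sum>u\<in>{1..p - s}. block_coeff s (Bminus s (u - 1) u) x)"

definition G_fun :: "nat \<Rightarrow> 'a \<Rightarrow> complex"
  where "G_fun s x =
    (\<Sum>t\<in>{1..s}. block_coeff s (Aplus s (t - 1) t) x)
    + (\<Sum>u\<in>{1..p - s}. block_coeff s (Aminus s (u - 1) u) x)"

end

end

theory Submission
  imports Defs
begin

text \<open>The elements \<open>v\<^sup>\<alpha>(s,t)\<close> are multiples of idempotents, and right multiplication by them cuts the
  algebra into columns. A column of a block consists of the elements \<open>g b\<^sub>0(s,t)\<close> with \<open>g\<close> independent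
  of \<open>t\<close>, and \<open>b\<^sub>0(s,t)\<close> sends \<open>F\<^sup>t\<^sup>-\<^sup>1 w\<close>, for \<open>w\<close> of the highest weight, to \<open>\<gamma>\<^sub>s w + d N w\<close>, because
  \<open>E\<^sup>j F\<^sup>j\<close> acts on \<open>w\<close> as a polynomial in the Casimir element, with nilpotent part \<open>N\<close>. Hence the
  normalised elements multiply like matrix units \<open>B\<close>, \<open>A\<close> over the dual numbers, linked by \<open>X\<close> and
  \<open>Y\<close> with \<open>X Y = A = Y X\<close>, up to multiples of \<open>A\<close> in \<open>B B\<close> that are the same along a diagonal; the value
  of \<open>\<delta>\<^sub>s\<close> is therefore immaterial. On such a basis, symmetry of a linear function means that it vanishes
  off the diagonal and is constant on the diagonal elements \<open>B\<close> of each sign and on all diagonal elements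
  \<open>A\<close> of the block.

  The basis elements are separated by the Casimir element and by left and right multiplication by \<open>K\<close>;
  with the products this reduces their independence to \<open>a\<^sub>0 \<noteq> 0\<close>, which is visible in Verma-type
  modules. There are \<open>2p\<^sup>3\<close> of them, as many as monomials \<open>F\<^sup>j E\<^sup>i K\<^sup>l\<close>, which span.\<close>

section \<open>Evaluation of noncommutative polynomials\<close>

text \<open>The elements b_0 are built so that N b_0 = a_0. Their summands W_m satisfy (N + e_(p-m))
  W_m = W_(m-1) with W_0 = a_0, and the coefficients mu_m are the running products of these
  constants e, so the sum telescopes and stops at e_s = 0. The multiplication table rests on this
  identity and on its consequence F E b_0 = a_0. Since q^p = -1, the chain with parameters
  (\<alpha>, s) is continued by the one with (-\<alpha>, p - s): the Casimir eigenvalue is the same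
  and the positions fill up the p weights. A column is therefore treated once for a general sign and
  interpreted for both, and products between the signs come from applying the left factors g of one
  column to x_0 and y_0 of the other. The algebra is given only by its presentation, so the
  nonvanishing of an element has to be read off from a representation: a noncommutative polynomial
  acting nontrivially lies outside the ideal of relations. The elements a_0 are the ones treated in
  this way.\<close>

lemma free_eval_superset:
  assumes "finite S" "Poly_Mapping.keys f \<subseteq> S"
  shows "free_eval h f = (\<Sum>w\<in>S. Poly_Mapping.lookup f w *\<^sub>C prod_list (map h w))"
  unfolding free_eval_def
  by (rule sum.mono_neutral_left) (use assms in \<open>auto simp: in_keys_iff\<close>)

lemma free_eval_zero [simp]: "free_eval h 0 = 0"
  by (simp add: free_eval_def)

lemma free_eval_add: "free_eval h (f + g) = free_eval h f + free_eval h g"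
proof -
  let ?S = "Poly_Mapping.keys f \<union> Poly_Mapping.keys g"
  have "Poly_Mapping.keys (f + g) \<subseteq> ?S"
    by (rule Poly_Mapping.keys_add)
  then show ?thesis
    by (simp add: free_eval_superset[of ?S] lookup_add scaleC_add_left sum.distrib)
qed

lemma free_eval_uminus: "free_eval h (- f) = - free_eval h f"
  using free_eval_add[of h f "- f"] by (simp add: eq_neg_iff_add_eq_0 add.commute)

lemma free_eval_diff: "free_eval h (f - g) = free_eval h f - free_eval h g"
  using free_eval_add[of h f "- g"] by (simp add: free_eval_uminus)

lemma free_eval_sum: "free_eval h (sum f A) = (\<Sum>x\<in>A. free_eval h (f x))"
  by (induction A rule: infinite_finite_induct) (simp_all add: free_eval_add)

lemma free_eval_single: "free_eval h (Poly_Mapping.single w c) = c *\<^sub>C prod_list (map h w)"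
  by (simp add: free_eval_superset[of "{w}"])

lemma free_eval_var [simp]: "free_eval h (free_var g) = h g"
  by (simp add: free_var_def free_eval_single)

lemma free_eval_const [simp]: "free_eval h (free_const c) = c *\<^sub>C 1"
  by (simp add: free_const_def free_eval_single)

lemma free_eval_one [simp]:
  fixes h :: "'g \<Rightarrow> 'a::complex_algebra_1"
  shows "free_eval h 1 = 1"
proof -
  have eq: "(1 :: 'g free_algebra) = Poly_Mapping.single [] 1"
    by (metis single_one zero_list_def)
  show ?thesis unfolding eq by (simp add: free_eval_single)
qed

lemma poly_mapping_sum_single:
  "f = (\<Sum>w\<in>Poly_Mapping.keys f. Poly_Mapping.single w (Poly_Mapping.lookup f w))"
  by (rule poly_mapping_eqI)
    (auto simp: lookup_sum lookup_single when_def sum.delta' in_keys_iff)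

lemma free_eval_mult: "free_eval h (f * g) = free_eval h f * free_eval h g"
proof -
  let ?s = "\<lambda>f w. Poly_Mapping.single w (Poly_Mapping.lookup f w)"
  have "f * g = (\<Sum>u\<in>Poly_Mapping.keys f. ?s f u) * (\<Sum>v\<in>Poly_Mapping.keys g. ?s g v)"
    by (simp flip: poly_mapping_sum_single)
  also have "\<dots> = (\<Sum>u\<in>Poly_Mapping.keys f. \<Sum>v\<in>Poly_Mapping.keys g. ?s f u * ?s g v)"
    by (rule sum_product)
  finally have "free_eval h (f * g) =
      (\<Sum>u\<in>Poly_Mapping.keys f. \<Sum>v\<in>Poly_Mapping.keys g. free_eval h (?s f u * ?s g v))"
    by (simp add: free_eval_sum)
  also have "\<dots> = (\<Sum>u\<in>Poly_Mapping.keys f. \<Sum>v\<in>Poly_Mapping.keys g.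
      free_eval h (?s f u) * free_eval h (?s g v))"
    by (simp add: mult_single free_eval_single plus_list_def mult_scaleC_left mult_scaleC_right
        scaleC_scaleC mult.commute)
  also have "\<dots> = (\<Sum>u\<in>Poly_Mapping.keys f. free_eval h (?s f u)) *
      (\<Sum>v\<in>Poly_Mapping.keys g. free_eval h (?s g v))"
    by (rule sum_product[symmetric])
  also have "\<dots> = free_eval h f * free_eval h g"
    by (simp only: flip: free_eval_sum poly_mapping_sum_single)
  finally show ?thesis .
qed

lemma free_eval_power: "free_eval h (f ^ n) = free_eval h f ^ n"
  by (induction n) (simp_all add: free_eval_mult)

lemmas free_eval_hom =
  free_eval_add free_eval_diff free_eval_sum free_eval_mult free_eval_power

text \<open>Each generator of the ideal dies and the kernel is an ideal. The contrapositive is the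
  tool for nonvanishing: a polynomial acting nontrivially in some model of the relations is not in
  the ideal.\<close>

lemma free_eval_ideal:
  assumes "f \<in> two_sided_ideal R" "\<And>r. r \<in> R \<Longrightarrow> free_eval h r = 0"
  shows "free_eval h f = 0"
  using assms by (induction rule: two_sided_ideal.induct) (simp_all add: free_eval_hom)


section \<open>The algebra of linear endomorphisms of a function space\<close>

text \<open>A ready supply of algebras in which relations can be tested. All functions on a type are
  allowed, so that the space is itself a type and no carrier set appears.\<close>

typedef 'b endo = "{f :: ('b \<Rightarrow> complex) \<Rightarrow> 'b \<Rightarrow> complex.
    (\<forall>x y. f (x + y) = f x + f y) \<and> (\<forall>c x. f (scale_fun c x) = scale_fun c (f x))}"
  morphisms app Endo
  by (rule exI[of _ id]) simp

lemma app_add: "app f (x + y) = app f x + app f y"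
  and app_scale: "app f (scale_fun c x) = scale_fun c (app f x)"
  using app[of f] by auto

lemma app_zero: "app f 0 = 0"
  using app_add[of f 0 0] by simp

lemma endo_eqI: "(\<And>x. app f x = app g x) \<Longrightarrow> f = g"
  by (metis app_inject ext)

instantiation endo :: (type) complex_algebra_1
begin

definition "0 = Endo (\<lambda>x. 0)"
definition "1 = Endo (\<lambda>x. x)"
definition "f + g = Endo (\<lambda>x. app f x + app g x)"
definition "- f = Endo (\<lambda>x. - app f x)"
definition "f - g = Endo (\<lambda>x. app f x - app g x)"
definition "f * g = Endo (\<lambda>x. app f (app g x))"
definition "c *\<^sub>C f = Endo (\<lambda>x. scale_fun c (app f x))"

lemma app_simps:
  fixes f g :: "'a endo"
  shows "app 0 x = (0 :: 'a \<Rightarrow> complex)" "app 1 x = x" "app (f + g) x = app f x + app g x"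
    "app (- f) x = - app f x" "app (f - g) x = app f x - app g x"
    "app (f * g) x = app f (app g x)" "app (c *\<^sub>C f) x = scale_fun c (app f x)"
  unfolding zero_endo_def one_endo_def plus_endo_def uminus_endo_def minus_endo_def times_endo_def
    scaleC_endo_def
  by (subst Endo_inverse; simp add: app_add app_scale; simp add: scale_fun_def fun_eq_iff
      algebra_simps)+

instance
proof
  show "(0 :: 'a endo) \<noteq> 1"
  proof
    assume "(0 :: 'a endo) = 1"
    then have "app (0 :: 'a endo) (\<lambda>_. 1) undefined = app (1 :: 'a endo) (\<lambda>_. 1) undefined"
      by simp
    then show False by (simp add: app_simps)
  qed
qed (rule endo_eqI; simp add: app_simps app_add app_scale;
    simp add: scale_fun_def fun_eq_iff algebra_simps
      flip: app_add app_scale)+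

end

section \<open>Quantum integers at a root of unity\<close>

text \<open>Integer arguments are needed for the symmetries n -> -n and n -> n + p, which lead out
  of the natural numbers.\<close>

definition qnum :: "nat \<Rightarrow> int \<Rightarrow> complex"
  where "qnum p n = (qroot p powi n - qroot p powi (- n)) / (qroot p - inverse (qroot p))"

lemma qint_eq_qnum: "qint p n = qnum p (int n)"
  by (simp add: qint_def qnum_def)

lemma qroot_nz [simp]: "qroot p \<noteq> 0"
  by (simp add: qroot_def)

lemma qroot_powi: "qroot p powi n = exp (\<i> * of_real (pi * of_int n / of_nat p))"
  by (simp add: qroot_def exp_power_int field_simps)

lemma qroot_powi_eq_1_iff:
  assumes "p > 0"
  shows "qroot p powi n = 1 \<longleftrightarrow> 2 * int p dvd n"
proof -
  have "qroot p powi n = 1 \<longleftrightarrow> (\<exists>m. pi * of_int n / of_nat p = of_int (2 * m) * pi)"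
    by (simp add: qroot_powi exp_eq_1)
  also have "\<dots> \<longleftrightarrow> (\<exists>m. real_of_int n = real_of_int (2 * int p * m))"
    using assms by (intro ex_cong1) (simp add: field_simps)
  also have "\<dots> \<longleftrightarrow> 2 * int p dvd n"
    unfolding of_int_eq_iff dvd_def by blast
  finally show ?thesis .
qed

lemma qroot_powi_p: "p > 0 \<Longrightarrow> qroot p powi (int p) = - 1"
  by (subst qroot_powi) simp

lemma qroot_powi_cong:
  assumes "p > 0" "2 * int p dvd m - n"
  shows "qroot p powi m = qroot p powi n"
proof -
  have "qroot p powi m = qroot p powi (m - n) * qroot p powi n"
    by (simp flip: power_int_add)
  then show ?thesis
    using assms by (simp add: qroot_powi_eq_1_iff)
qed

lemma qroot_diff_nz:
  assumes "p \<ge> 2"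
  shows "qroot p - inverse (qroot p) \<noteq> 0"
proof
  assume "qroot p - inverse (qroot p) = 0"
  then have "qroot p powi 2 = 1"
    by (simp add: power2_eq_square field_simps)
  then have "2 * int p dvd 2"
    by (subst (asm) qroot_powi_eq_1_iff) (use assms in auto)
  then show False
    using assms zdvd_imp_le[of "2 * int p" 2] by simp
qed

lemma qnum_0 [simp]: "qnum p 0 = 0"
  by (simp add: qnum_def)

lemma qnum_1: "p \<ge> 2 \<Longrightarrow> qnum p 1 = 1"
  using qroot_diff_nz[of p] by (simp add: qnum_def)

lemma qnum_minus: "qnum p (- n) = - qnum p n"
  by (simp add: qnum_def minus_divide_left)

lemma qnum_add_p: "p > 0 \<Longrightarrow> qnum p (n + int p) = - qnum p n"
  using qroot_powi_p[of p]
  by (simp add: qnum_def power_int_add power_int_diff minus_divide_left)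

lemma qnum_diff_p: "p > 0 \<Longrightarrow> qnum p (n - int p) = - qnum p n"
  using qnum_add_p[of p "n - int p"] by simp

lemma qnum_p_diff: "p > 0 \<Longrightarrow> qnum p (int p - n) = qnum p n"
  using qnum_add_p[of p "- n"] by (simp add: qnum_minus)

lemma qnum_eq_0_iff:
  assumes "p \<ge> 2"
  shows "qnum p n = 0 \<longleftrightarrow> int p dvd n"
proof -
  have "qnum p n = 0 \<longleftrightarrow> qroot p powi n = qroot p powi (- n)"
    using qroot_diff_nz[OF assms] by (simp add: qnum_def)
  also have "\<dots> \<longleftrightarrow> qroot p powi (2 * n) = 1"
    by (simp add: power_int_minus field_simps flip: power_int_add)
  also have "\<dots> \<longleftrightarrow> int p dvd n"
    using assms by (simp add: qroot_powi_eq_1_iff)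
  finally show ?thesis .
qed

lemma qnum_nz: "p \<ge> 2 \<Longrightarrow> 0 < n \<Longrightarrow> n < int p \<Longrightarrow> qnum p n \<noteq> 0"
  using zdvd_imp_le[of "int p" n] by (auto simp: qnum_eq_0_iff)

text \<open>A product [i][s-i] is, up to D^2, the difference of two values q^n + q^(-n), at n = s
  and n = s - 2i. This ties the structure constants of E and F to the Casimir eigenvalue.\<close>

lemma qnum_mult:
  "qnum p i * qnum p (s - i) = (qroot p powi s + qroot p powi (- s)
     - (qroot p powi (s - 2 * i) + qroot p powi (2 * i - s))) / (qroot p - inverse (qroot p))\<^sup>2"
proof -
  have "(qroot p powi i - qroot p powi (- i)) * (qroot p powi (s - i) - qroot p powi (- (s - i))) =
      qroot p powi s + qroot p powi (- s) - (qroot p powi (s - 2 * i) + qroot p powi (2 * i - s))"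
    by (simp add: left_diff_distrib right_diff_distrib flip: power_int_add)
  then show ?thesis
    by (simp add: qnum_def power2_eq_square)
qed

text \<open>These recursions absorb one further commutator of E and F in the induction for
  \<open>EF_power\<close>: the first for the coefficient of K, the second for that of Ki.\<close>

lemma qnum_mult_powi_Suc:
  assumes "p \<ge> 2"
  shows "qnum p (n + 1) * qroot p powi (- n) = 1 + qnum p n * qroot p powi (- n - 1)"
    and "qnum p (n + 1) * qroot p powi n = 1 + qnum p n * qroot p powi (n + 1)"
proof -
  let ?q = "qroot p"
  have D: "?q - inverse ?q \<noteq> 0" by (rule qroot_diff_nz[OF assms])
  have 1: "?q powi m * ?q powi n = ?q powi (m + n)" for m n
    by (simp add: power_int_add)
  have 2: "?q = ?q powi 1" "inverse ?q = ?q powi (- 1)"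
    by (simp_all add: power_int_minus)
  have "(?q powi (n + 1) - ?q powi (- (n + 1))) * ?q powi (- n) =
      (?q - inverse ?q) + (?q powi n - ?q powi (- n)) * ?q powi (- n - 1)"
    by (subst 2(2), subst (3) 2(1)) (simp add: left_diff_distrib right_diff_distrib 1)
  then show "qnum p (n + 1) * qroot p powi (- n) = 1 + qnum p n * qroot p powi (- n - 1)"
    using D by (simp add: qnum_def divide_simps mult_ac)
  have "(?q powi (n + 1) - ?q powi (- (n + 1))) * ?q powi n =
      (?q - inverse ?q) + (?q powi n - ?q powi (- n)) * ?q powi (n + 1)"
    by (subst 2(2), subst (3) 2(1)) (simp add: left_diff_distrib right_diff_distrib 1)
  then show "qnum p (n + 1) * qroot p powi n = 1 + qnum p n * qroot p powi (n + 1)"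
    using D by (simp add: qnum_def divide_simps mult_ac)
qed


section \<open>Consequences of the relations\<close>

lemmas scaleC_simps =
  mult_scaleC_left mult_scaleC_right scaleC_scaleC scaleC_add_right complex_vec.scale_right_diff_distrib

text \<open>The relations E^p = F^p = 0 and K^(2p) = 1 are left out, so that the locale can be
  interpreted for the Verma-type operators before these are established for them.\<close>

locale uq_relations =
  fixes p :: nat and E F K Ki :: "'a::complex_algebra_1"
  assumes p2: "p \<ge> 2"
    and KKi: "K * Ki = 1" and KiK: "Ki * K = 1"
    and KE: "K * E = qroot p powi 2 *\<^sub>C E * K"
    and KF: "K * F = qroot p powi (- 2) *\<^sub>C F * K"
    and EF: "E * F = F * E + (1 / (qroot p - inverse (qroot p))) *\<^sub>C (K - Ki)"
begin

abbreviation "q \<equiv> qroot p"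
abbreviation "D \<equiv> q - inverse q"

lemma p_pos [simp]: "p > 0" using p2 by simp

lemma D_nz: "D \<noteq> 0" by (rule qroot_diff_nz[OF p2])

lemma KiE: "Ki * E = q powi (- 2) *\<^sub>C E * Ki"
proof -
  have "Ki * (K * E) * Ki = q powi 2 *\<^sub>C Ki * E"
    by (simp add: KE mult.assoc mult_scaleC_left mult_scaleC_right KKi)
  then have "q powi (- 2) *\<^sub>C (E * Ki) = q powi (- 2) *\<^sub>C q powi 2 *\<^sub>C (Ki * E)"
    by (simp add: KiK mult_scaleC_left flip: mult.assoc)
  then show ?thesis by (simp add: power_int_minus mult_scaleC_left)
qed

lemma KiF: "Ki * F = q powi 2 *\<^sub>C F * Ki"
proof -
  have "Ki * (K * F) * Ki = q powi (- 2) *\<^sub>C Ki * F"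
    by (simp add: KF mult.assoc mult_scaleC_left mult_scaleC_right KKi)
  then have "q powi 2 *\<^sub>C (F * Ki) = q powi 2 *\<^sub>C q powi (- 2) *\<^sub>C (Ki * F)"
    by (simp add: KiK mult_scaleC_left flip: mult.assoc)
  then show ?thesis by (simp add: power_int_minus mult_scaleC_left)
qed

lemma EF_power:
  "E * F ^ Suc n = F ^ Suc n * E + (qnum p (int n + 1) / D) *\<^sub>C
     (F ^ n * (q powi (- int n) *\<^sub>C K - q powi int n *\<^sub>C Ki))"
proof (induction n)
  case 0
  show ?case using EF by (simp add: qnum_1[OF p2])
next
  case (Suc n)
  let ?c = "qnum p (int n + 1)"
  have e1: "q powi (- int n) * q powi (- 2) = q powi (- int n - 2)"
    "q powi int n * q powi 2 = q powi (int n + 2)"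
    by (simp_all only: power_int_add power_int_diff qroot_nz simp_thms power_int_minus
        divide_inverse)
  have c: "qnum p (int n + 2) * q powi (- (int n + 1)) = 1 + ?c * q powi (- int n - 2)"
    "qnum p (int n + 2) * q powi (int n + 1) = 1 + ?c * q powi (int n + 2)"
    using qnum_mult_powi_Suc[OF p2, of "int n + 1"] by (simp_all add: algebra_simps)
  have "E * F ^ Suc (Suc n) = E * F ^ Suc n * F"
    by (simp only: power_Suc2 mult.assoc)
  also have "\<dots> = F ^ Suc n * (E * F) + (?c / D) *\<^sub>C
     (F ^ n * (q powi (- int n) *\<^sub>C (K * F) - q powi int n *\<^sub>C (Ki * F)))"
    unfolding Suc.IH by (simp add: distrib_right left_diff_distrib mult.assoc scaleC_simps)
  also have "\<dots> = F ^ Suc n * (F * E) + (1 / D) *\<^sub>C (F ^ Suc n * (K - Ki)) + (?c / D) *\<^sub>C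
     (F ^ Suc n * (q powi (- int n - 2) *\<^sub>C K - q powi (int n + 2) *\<^sub>C Ki))"
    unfolding EF KF KiF power_Suc2
    by (simp add: distrib_left right_diff_distrib mult.assoc scaleC_simps mult.commute
        mult.left_commute e1[symmetric] del: power_Suc)
  also have "\<dots> = F ^ Suc (Suc n) * E + (1 / D) *\<^sub>C (F ^ Suc n *
      ((1 + ?c * q powi (- int n - 2)) *\<^sub>C K - (1 + ?c * q powi (int n + 2)) *\<^sub>C Ki))"
    unfolding power_Suc2[of _ "Suc n"]
    by (simp add: distrib_left right_diff_distrib mult.assoc scaleC_simps scaleC_add_left algebra_simps
         del: power_Suc)
  also have "\<dots> = F ^ Suc (Suc n) * E + (qnum p (int n + 2) / D) *\<^sub>C (F ^ Suc n *
      (q powi (- (int n + 1)) *\<^sub>C K - q powi (int n + 1) *\<^sub>C Ki))"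
    unfolding c[symmetric]
    by (simp add: distrib_left right_diff_distrib mult.assoc scaleC_simps del: power_Suc)
  finally show ?case by (simp add: add.commute)
qed

lemma EF_p: "E * F ^ p = F ^ p * E"
proof -
  obtain n where n: "p = Suc n" using p_pos gr0_implies_Suc by blast
  have "qnum p (int n + 1) = 0"
    using qnum_eq_0_iff[OF p2] n by (metis add.commute dvd_refl of_nat_Suc)
  with EF_power[of n] n show ?thesis by simp
qed

end

section \<open>Nonvanishing of the socle elements\<close>

lemma mod_pred:
  fixes n p :: nat
  assumes "p > 0" "n mod p \<noteq> 0"
  shows "(n - 1) mod p = n mod p - 1" "n > 0"
  using assms by (cases n; auto simp: mod_Suc split: if_splits)+

text \<open>Verma-type modules: the value at \<open>(i, j)\<close> is the coefficient of \<open>E\<^sup>i F\<^sup>j v\<close> for a vector \<open>v\<close>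
  of weight \<open>\<nu>\<close>; cutting the chains at the multiples of \<open>p\<close> makes \<open>E\<^sup>p\<close> and \<open>F\<^sup>p\<close> vanish on all
  functions, without any restriction on their support.\<close>

context
  fixes p :: nat and \<nu> :: complex
begin

definition verma_wt :: "nat \<Rightarrow> nat \<Rightarrow> complex"
  where "verma_wt i j = \<nu> * qroot p powi (2 * (int i - int j))"

text \<open>The coefficient of E^(i-1) F^j v that appears when F is moved past E^i in F E^i F^j v.
  Its factor [i] vanishes for i divisible by p, which makes the cuts compatible with the
  relations.\<close>

definition verma_coeff :: "nat \<Rightarrow> nat \<Rightarrow> complex"
  where "verma_coeff i j = - qnum p (int i) *
    (qroot p powi (int i - 1 - 2 * int j) * \<nu> - inverse (qroot p powi (int i - 1 - 2 * int j) * \<nu>))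
      / (qroot p - inverse (qroot p))"

definition verma_E :: "(nat \<times> nat) endo"
  where "verma_E = Endo (\<lambda>f (i, j). if i mod p = 0 then 0 else f (i - 1, j))"

definition verma_F :: "(nat \<times> nat) endo"
  where "verma_F = Endo (\<lambda>f (i, j). (if j mod p = 0 then 0 else f (i, j - 1))
    + verma_coeff (Suc i) j * f (Suc i, j))"

definition verma_K :: "(nat \<times> nat) endo"
  where "verma_K = Endo (\<lambda>f (i, j). verma_wt i j * f (i, j))"

definition verma_Ki :: "(nat \<times> nat) endo"
  where "verma_Ki = Endo (\<lambda>f (i, j). inverse (verma_wt i j) * f (i, j))"

lemma app_verma_E: "app verma_E f (i, j) = (if i mod p = 0 then 0 else f (i - 1, j))"
  unfolding verma_E_def
  by (subst Endo_inverse) (auto simp: fun_eq_iff scale_fun_def algebra_simps)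

lemma app_verma_F: "app verma_F f (i, j) = (if j mod p = 0 then 0 else f (i, j - 1))
    + verma_coeff (Suc i) j * f (Suc i, j)"
  unfolding verma_F_def
  by (subst Endo_inverse) (auto simp: fun_eq_iff scale_fun_def algebra_simps)

lemma app_verma_K: "app verma_K f (i, j) = verma_wt i j * f (i, j)"
  unfolding verma_K_def
  by (subst Endo_inverse) (auto simp: fun_eq_iff scale_fun_def algebra_simps)

lemma app_verma_Ki: "app verma_Ki f (i, j) = inverse (verma_wt i j) * f (i, j)"
  unfolding verma_Ki_def
  by (subst Endo_inverse) (auto simp: fun_eq_iff scale_fun_def algebra_simps)

lemmas app_verma = app_verma_E app_verma_F app_verma_K app_verma_Ki

context
  assumes p2: "p \<ge> 2" and \<nu>: "\<nu> ^ (2 * p) = 1"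
begin

lemma nu_nz: "\<nu> \<noteq> 0"
  using \<nu> p2 by (auto simp: power_0_left)

lemma verma_wt_nz: "verma_wt i j \<noteq> 0"
  by (simp add: verma_wt_def nu_nz)

lemma verma_wt_Suc: "verma_wt (Suc i) j = qroot p powi 2 * verma_wt i j"
  "verma_wt i (Suc j) = qroot p powi (- 2) * verma_wt i j"
proof -
  have "qroot p powi (2 * (int (Suc i) - int j)) = qroot p powi 2 * qroot p powi (2 * (int i - int j))"
    "qroot p powi (2 * (int i - int (Suc j))) = qroot p powi (- 2) * qroot p powi (2 * (int i - int j))"
    by (subst power_int_add[symmetric]; simp add: algebra_simps)+
  then show "verma_wt (Suc i) j = qroot p powi 2 * verma_wt i j"
    "verma_wt i (Suc j) = qroot p powi (- 2) * verma_wt i j"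
    unfolding verma_wt_def by (simp_all only: mult.left_commute)
qed

lemma verma_coeff_0: "i mod p = 0 \<Longrightarrow> verma_coeff i j = 0"
  using qnum_eq_0_iff[OF p2, of "int i"] by (auto simp: verma_coeff_def mod_eq_0_iff_dvd)

text \<open>The commutator relation read at (i, j): the shift terms of E F and F E agree, and their
  diagonal terms are \<open>verma_coeff i j\<close> and
  \<open>verma_coeff (Suc i) j\<close>.\<close>

lemma verma_coeff_diff: "verma_coeff i j - verma_coeff (Suc i) j =
    (verma_wt i j - inverse (verma_wt i j)) / (qroot p - inverse (qroot p))"
proof -
  define D where "D = qroot p - inverse (qroot p)"
  have D: "D \<noteq> 0" unfolding D_def by (rule qroot_diff_nz[OF p2])
  define M where "M = \<nu> * qroot p powi (- 2 * int j)"
  have M: "M \<noteq> 0" by (simp add: M_def nu_nz)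
  define Q where "Q = (\<lambda>n. qroot p powi n)"
  have Q_add: "Q m * Q n = Q (m + n)" for m n
    by (simp add: Q_def power_int_add)
  have Q_inv: "inverse (Q m) = Q (- m)" for m
    by (simp add: Q_def power_int_minus)
  have w: "verma_wt i j = Q (2 * int i) * M"
    by (simp add: verma_wt_def M_def Q_def algebra_simps flip: power_int_add)
  have g: "verma_coeff i j = - ((Q (int i) - Q (- int i)) *
     (Q (int i - 1) * M - Q (1 - int i) * inverse M) / D\<^sup>2)" for i
  proof -
    have "qroot p powi (int i - 1 - 2 * int j) * \<nu> = Q (int i - 1) * M"
      by (simp add: M_def Q_def algebra_simps flip: power_int_add)
    then show ?thesis
      unfolding verma_coeff_def qnum_def D_def[symmetric] Q_def[symmetric]
      by (simp add: Q_inv power2_eq_square flip: D_def)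
  qed
  have D_Q: "D = Q 1 - Q (- 1)"
    by (simp add: D_def Q_def power_int_minus)
  define X where "X i = (Q (int i) - Q (- int i)) * (Q (int i - 1) * M - Q (1 - int i) * inverse M)"
    for i
  have "X (Suc i) - X i = D * (Q (2 * int i) * M - Q (- 2 * int i) * inverse M)"
    unfolding D_Q X_def
    by (simp add: left_diff_distrib right_diff_distrib Q_add flip: mult.assoc)
      (simp add: algebra_simps, rule disjI2, rule arg_cong[where f = Q], simp)
  also have "\<dots> = D * (verma_wt i j - inverse (verma_wt i j))"
    by (simp add: w Q_inv)
  finally have "(X (Suc i) - X i) / D\<^sup>2 = (verma_wt i j - inverse (verma_wt i j)) / D"
    using D by (simp add: power2_eq_square)
  then show ?thesis
    unfolding g X_def[symmetric] D_def[symmetric] by (simp add: diff_divide_distrib)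
qed

lemma verma_relations: "uq_relations p verma_E verma_F verma_K verma_Ki"
proof
  show "p \<ge> 2" by (rule p2)
  show "verma_K * verma_Ki = 1" "verma_Ki * verma_K = 1"
    by (rule endo_eqI; rule ext; auto simp: app_simps app_verma verma_wt_nz)+
  show "verma_K * verma_E = qroot p powi 2 *\<^sub>C verma_E * verma_K"
  proof (intro endo_eqI ext, clarify)
    fix f i j
    show "app (verma_K * verma_E) f (i, j) = app (qroot p powi 2 *\<^sub>C verma_E * verma_K) f (i, j)"
      using verma_wt_Suc(1)[of "i - 1" j]
      by (cases i) (auto simp: app_simps app_verma scale_fun_def)
  qed
  show "verma_K * verma_F = qroot p powi (- 2) *\<^sub>C verma_F * verma_K"
  proof (intro endo_eqI ext, clarify)
    fix f i j
    have "verma_wt i j = qroot p powi (- 2) * verma_wt (Suc i) j"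
      unfolding verma_wt_Suc by (simp add: power_int_minus)
    then show "app (verma_K * verma_F) f (i, j) =
        app (qroot p powi (- 2) *\<^sub>C verma_F * verma_K) f (i, j)"
      using verma_wt_Suc(2)[of i "j - 1"]
      by (cases j) (auto simp: app_simps app_verma scale_fun_def algebra_simps)
  qed
  show "verma_E * verma_F = verma_F * verma_E +
      (1 / (qroot p - inverse (qroot p))) *\<^sub>C (verma_K - verma_Ki)"
  proof (intro endo_eqI ext, clarify)
    fix f i j
    have "(1 / (qroot p - inverse (qroot p))) * (verma_wt i j * f (i, j)
        - inverse (verma_wt i j) * f (i, j)) = (verma_coeff i j - verma_coeff (Suc i) j) * f (i, j)"
      unfolding verma_coeff_diff by (simp add: algebra_simps diff_divide_distrib)
    then show "app (verma_E * verma_F) f (i, j) = app (verma_F * verma_E +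
      (1 / (qroot p - inverse (qroot p))) *\<^sub>C (verma_K - verma_Ki)) f (i, j)"
      using verma_coeff_0[of i j] verma_coeff_0[of "Suc i" j]
      by (cases i) (auto simp: app_simps app_verma scale_fun_def algebra_simps)
  qed
qed

lemma verma_K_2p: "verma_K ^ (2 * p) = 1"
proof -
  have pow: "app (verma_K ^ n) f (i, j) = verma_wt i j ^ n * f (i, j)" for n f i j
    by (induction n) (simp_all add: app_simps app_verma)
  have "verma_wt i j ^ (2 * p) = 1" for i j
  proof -
    have "(qroot p powi (2 * (int i - int j))) ^ (2 * p) =
        qroot p powi (2 * (int i - int j) * int (2 * p))"
      by (simp only: power_int_mult power_int_of_nat)
    also have "\<dots> = 1"
      using p2 by (subst qroot_powi_eq_1_iff) auto
    finally show ?thesis by (simp add: verma_wt_def power_mult_distrib \<nu>)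
  qed
  then show ?thesis
    by (intro endo_eqI ext) (auto simp: app_simps pow)
qed

lemma verma_E_power: "app (verma_E ^ n) f (i, j) = (if i mod p < n then 0 else f (i - n, j))"
proof (induction n arbitrary: i)
  case (Suc n)
  show ?case
  proof (cases "i mod p = 0")
    case False
    then have "(i - 1) mod p = i mod p - 1" "i > 0"
      using mod_pred[of p i] p2 by simp_all
    then show ?thesis
      using False by (auto simp: app_simps app_verma Suc)
  qed (simp add: app_simps app_verma)
qed (simp add: app_simps)

lemma verma_E_p: "verma_E ^ p = 0"
  using p2 by (intro endo_eqI ext) (auto simp: app_simps verma_E_power)

text \<open>On the top row \<open>F\<close> is a mere shift, so \<open>F\<^sup>p\<close> vanishes there, and the other rows are carried to
  the top row by powers of \<open>E\<close>, which commute with \<open>F\<^sup>p\<close>.\<close>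

lemma verma_F_p: "verma_F ^ p = 0"
proof -
  interpret uq_relations p verma_E verma_F verma_K verma_Ki
    by (rule verma_relations)
  have top: "app (verma_F ^ n) f (i, j) = (if j mod p < n then 0 else f (i, j - n))"
    if "Suc i mod p = 0" for n f i j
  proof (induction n arbitrary: j)
    case (Suc n)
    show ?case
    proof (cases "j mod p = 0")
      case False
      then have "(j - 1) mod p = j mod p - 1" "j > 0"
        using mod_pred[of p j] p2 by simp_all
      then show ?thesis
        using False by (auto simp: app_simps app_verma Suc verma_coeff_0[OF that])
    qed (simp add: app_simps app_verma verma_coeff_0[OF that])
  qed (simp add: app_simps)
  have comm: "verma_E ^ m * verma_F ^ p = verma_F ^ p * verma_E ^ m" for m
    by (metis EF_p power_commuting_commutes)
  show ?thesis
  proof (intro endo_eqI ext, clarify)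
    fix f i j
    define m where "m = p - 1 - i mod p"
    have *: "i mod p < p" using p2 by simp
    have "i + m = p - 1 + p * (i div p)"
      using * mult_div_mod_eq[of p i] unfolding m_def by linarith
    then have im: "(i + m) mod p = p - 1"
      by (metis mod_mult_self2 mod_less diff_less p2 zero_less_one less_le_trans pos2)
    then have im': "Suc (i + m) mod p = 0"
      using p2 by (simp add: mod_Suc)
    have "\<not> p - 1 < m"
      by (simp add: m_def)
    then have "app (verma_F ^ p) f (i, j) = app (verma_E ^ m * verma_F ^ p) f (i + m, j)"
      unfolding app_simps verma_E_power im by simp
    also have "\<dots> = 0"
      unfolding comm app_simps using p2 by (simp add: top[OF im'])
    finally show "app (verma_F ^ p) f (i, j) = app 0 f (i, j)"
      by (simp add: app_simps)
  qed
qed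

text \<open>The test vector is the delta function at (0, 0), which has weight \<nu>: the sum over
  the powers of K multiplies it by 2p, F^j shifts it along row 0 to (0, j), and E^(p-1) lifts it to
  (p-1, j).\<close>

lemma verma_socle:
  assumes "j < p"
  shows "verma_E ^ (p - 1) * verma_F ^ j * (\<Sum>l<2 * p. inverse \<nu> ^ l *\<^sub>C verma_K ^ l) \<noteq> 0"
proof -
  define e :: "nat \<Rightarrow> nat \<times> nat \<Rightarrow> complex" where "e j = (\<lambda>x. if x = (0, j) then 1 else 0)" for j
  have "app (verma_K ^ l) (e 0) = scale_fun (\<nu> ^ l) (e 0)" for l
    by (induction l)
      (auto simp: app_simps app_scale fun_eq_iff app_verma scale_fun_def e_def verma_wt_def)
  then have v: "app (\<Sum>l<2 * p. inverse \<nu> ^ l *\<^sub>C verma_K ^ l) (e 0) = scale_fun (of_nat (2 * p)) (e 0)"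
  proof -
    assume *: "\<And>l. app (verma_K ^ l) (e 0) = scale_fun (\<nu> ^ l) (e 0)"
    have "app (\<Sum>l<n. inverse \<nu> ^ l *\<^sub>C verma_K ^ l) (e 0) = scale_fun (of_nat n) (e 0)" for n
      by (induction n)
        (auto simp: app_simps * fun_eq_iff scale_fun_def nu_nz algebra_simps power_inverse
           simp flip: power_mult_distrib)
    then show ?thesis by blast
  qed
  have f: "app (verma_F ^ j) (e 0) = e j" if "j < p" for j
    using that
  proof (induction j)
    case (Suc j)
    then have IH: "app (verma_F ^ j) (e 0) = e j" by simp
    show ?case
    proof (rule ext, clarify)
      fix i k
      show "app (verma_F ^ Suc j) (e 0) (i, k) = e (Suc j) (i, k)"
        unfolding power_Suc app_simps IH app_verma using Suc.prems by (auto simp: e_def)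
    qed
  qed (simp add: app_simps)
  let ?x = "verma_E ^ (p - 1) * verma_F ^ j * (\<Sum>l<2 * p. inverse \<nu> ^ l *\<^sub>C verma_K ^ l)"
  have "app ?x (e 0) = scale_fun (of_nat (2 * p)) (app (verma_E ^ (p - 1)) (e j))"
    by (simp only: app_simps v app_scale f[OF assms])
  then have "app ?x (e 0) (p - 1, j) = of_nat (2 * p)"
    using p2 by (simp add: scale_fun_def verma_E_power) (simp add: e_def)
  moreover have "app 0 (e 0) (p - 1, j) = 0"
    by (simp add: app_simps)
  ultimately show ?thesis
    using p2 by (metis mult_eq_0_iff not_numeral_le_zero of_nat_eq_0_iff zero_neq_numeral)
qed

end

end

section \<open>Weight vectors and the Casimir element\<close>

text \<open>The interface to the presentation. \<open>socle_nz\<close> encodes that the relations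
  imply no more than they should, and \<open>generated\<close> that the evaluation map is onto, in
  the form of an induction principle.\<close>

locale uq = uq_relations +
  assumes E_p: "E ^ p = 0" and F_p: "F ^ p = 0" and K_2p: "K ^ (2 * p) = 1"
    and socle_nz: "\<nu> ^ (2 * p) = 1 \<Longrightarrow> j < p \<Longrightarrow>
      E ^ (p - 1) * F ^ j * (\<Sum>l<2 * p. inverse \<nu> ^ l *\<^sub>C K ^ l) \<noteq> 0"
    and generated: "1 \<in> S \<Longrightarrow> complex_vec.subspace S \<Longrightarrow>
      (\<And>x. x \<in> S \<Longrightarrow> E * x \<in> S \<and> F * x \<in> S \<and> K * x \<in> S \<and> Ki * x \<in> S) \<Longrightarrow> S = UNIV"

context uq_relations
begin

abbreviation "cas \<equiv> casimir p E F K Ki"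

definition wt :: "complex \<Rightarrow> 'a \<Rightarrow> bool"
  where "wt \<nu> z \<longleftrightarrow> K * z = \<nu> *\<^sub>C z"

lemma cas_EF: "cas = E * F + (inverse q / D\<^sup>2) *\<^sub>C K + (q / D\<^sup>2) *\<^sub>C Ki"
  by (simp add: casimir_def scaleC_simps add.assoc)

lemma cas_FE: "cas = F * E + (q / D\<^sup>2) *\<^sub>C K + (inverse q / D\<^sup>2) *\<^sub>C Ki"
proof -
  have 1: "1 / D + inverse q / D\<^sup>2 = q / D\<^sup>2" "q / D\<^sup>2 - 1 / D = inverse q / D\<^sup>2"
  proof -
    have d: "1 / D = D / D\<^sup>2"
      using D_nz by (simp add: power2_eq_square)
    show "1 / D + inverse q / D\<^sup>2 = q / D\<^sup>2" "q / D\<^sup>2 - 1 / D = inverse q / D\<^sup>2"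
      unfolding d add_divide_distrib[symmetric] diff_divide_distrib[symmetric] by simp_all
  qed
  have "cas = F * E + (1 / D + inverse q / D\<^sup>2) *\<^sub>C K + (q / D\<^sup>2 - 1 / D) *\<^sub>C Ki"
    unfolding cas_EF EF
    by (simp add: scaleC_add_left complex_vec.scale_left_diff_distrib
        complex_vec.scale_right_diff_distrib)
  then show ?thesis unfolding 1 .
qed

text \<open>With the form \<open>cas_EF\<close> on the left and \<open>cas_FE\<close> on the right
  both sides contain E F E, and moving K and Ki past E turns the scalars of one form into those of
  the other.\<close>

lemma cas_E: "cas * E = E * cas"
proof -
  have 1: "inverse q / D\<^sup>2 * q powi 2 = q / D\<^sup>2" "q / D\<^sup>2 * q powi - 2 = inverse q / D\<^sup>2"
    by (simp_all add: power_int_minus power2_eq_square)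
  have "cas * E = E * F * E + (inverse q / D\<^sup>2) *\<^sub>C (K * E) + (q / D\<^sup>2) *\<^sub>C (Ki * E)"
    unfolding cas_EF by (simp add: distrib_right mult_scaleC_left)
  also have "\<dots> = E * F * E + (inverse q / D\<^sup>2 * q powi 2) *\<^sub>C (E * K)
      + (q / D\<^sup>2 * q powi - 2) *\<^sub>C (E * Ki)"
    unfolding KE KiE by (simp only: mult_scaleC_left scaleC_scaleC)
  also have "\<dots> = E * cas"
    unfolding cas_FE 1 by (simp add: distrib_left mult_scaleC_right mult.assoc)
  finally show ?thesis .
qed

lemma cas_F: "cas * F = F * cas"
proof -
  have 1: "q / D\<^sup>2 * q powi - 2 = inverse q / D\<^sup>2" "inverse q / D\<^sup>2 * q powi 2 = q / D\<^sup>2"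
    by (simp_all add: power_int_minus power2_eq_square)
  have "cas * F = F * E * F + (q / D\<^sup>2) *\<^sub>C (K * F) + (inverse q / D\<^sup>2) *\<^sub>C (Ki * F)"
    unfolding cas_FE by (simp add: distrib_right mult_scaleC_left)
  also have "\<dots> = F * E * F + (q / D\<^sup>2 * q powi - 2) *\<^sub>C (F * K)
      + (inverse q / D\<^sup>2 * q powi 2) *\<^sub>C (F * Ki)"
    unfolding KF KiF by (simp only: mult_scaleC_left scaleC_scaleC)
  also have "\<dots> = F * cas"
    unfolding cas_EF 1 by (simp add: distrib_left mult_scaleC_right mult.assoc)
  finally show ?thesis .
qed

lemma cas_K: "cas * K = K * cas"
proof -
  have "K * (E * F) = E * F * K"
    using KE KF by (simp add: mult_scaleC_left mult_scaleC_right power_int_minus scaleC_scaleC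
        flip: mult.assoc) (simp add: mult.assoc mult_scaleC_left mult_scaleC_right scaleC_scaleC)
  then show ?thesis
    by (simp add: cas_EF distrib_left distrib_right mult_scaleC_left mult_scaleC_right KKi KiK)
qed

lemma cas_Ki: "cas * Ki = Ki * cas"
proof -
  have "Ki * (cas * K) * Ki = cas * Ki"
    unfolding cas_K by (simp add: KiK flip: mult.assoc)
  then show ?thesis by (simp add: KKi mult.assoc)
qed

lemma cas_E_power: "cas * E ^ n = E ^ n * cas"
  using cas_E by (metis power_commuting_commutes)

lemma cas_F_power: "cas * F ^ n = F ^ n * cas"
  using cas_F by (metis power_commuting_commutes)

lemma wt_0: "wt \<nu> 0"
  by (simp add: wt_def)

lemma wt_scale: "wt \<nu> z \<Longrightarrow> wt \<nu> (c *\<^sub>C z)"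
  by (simp add: wt_def mult_scaleC_right scaleC_scaleC mult.commute)

lemma wt_add: "wt \<nu> z \<Longrightarrow> wt \<nu> w \<Longrightarrow> wt \<nu> (z + w)"
  by (simp add: wt_def distrib_left scaleC_add_right)

lemma wt_diff: "wt \<nu> z \<Longrightarrow> wt \<nu> w \<Longrightarrow> wt \<nu> (z - w)"
  by (simp add: wt_def right_diff_distrib complex_vec.scale_right_diff_distrib)

lemma wt_sum: "(\<And>x. x \<in> A \<Longrightarrow> wt \<nu> (f x)) \<Longrightarrow> wt \<nu> (sum f A)"
  by (induction A rule: infinite_finite_induct) (simp_all add: wt_0 wt_add)

lemma wt_cas: "wt \<nu> z \<Longrightarrow> wt \<nu> (cas * z)"
  unfolding wt_def by (metis cas_K mult.assoc mult_scaleC_right)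

lemma wt_Ki: "wt \<nu> z \<Longrightarrow> \<nu> \<noteq> 0 \<Longrightarrow> Ki * z = inverse \<nu> *\<^sub>C z"
proof -
  assume z: "wt \<nu> z" "\<nu> \<noteq> 0"
  have "\<nu> *\<^sub>C (Ki * z) = Ki * (K * z)"
    using z by (simp add: wt_def mult_scaleC_right)
  also have "\<dots> = z"
    by (simp add: KiK flip: mult.assoc)
  finally have "inverse \<nu> *\<^sub>C \<nu> *\<^sub>C (Ki * z) = inverse \<nu> *\<^sub>C z" by simp
  then show ?thesis using z by simp
qed

text \<open>The weight, and the structure constant of \<open>E\<close> and \<open>F\<close>, in position \<open>i\<close> of a highest weight
  chain of highest weight \<open>\<alpha> q\<^bsup>s-1\<^esup>\<close>.\<close>

definition rw :: "complex \<Rightarrow> int \<Rightarrow> int \<Rightarrow> complex"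
  where "rw \<alpha> s i = \<alpha> * q powi (s - 1 - 2 * i)"

definition ee :: "complex \<Rightarrow> int \<Rightarrow> int \<Rightarrow> complex"
  where "ee \<alpha> s i = \<alpha> * qnum p i * qnum p (s - i)"

definition zeta :: "complex \<Rightarrow> int \<Rightarrow> complex"
  where "zeta \<alpha> s = \<alpha> * (q powi s + q powi (- s)) / D\<^sup>2"

definition nil :: "complex \<Rightarrow> int \<Rightarrow> 'a \<Rightarrow> 'a"
  where "nil \<alpha> s z = cas * z - zeta \<alpha> s *\<^sub>C z"

lemma ee_0 [simp]: "ee \<alpha> s 0 = 0" "ee \<alpha> s s = 0"
  by (simp_all add: ee_def)

lemma wt_E: "wt (rw \<alpha> s i) z \<Longrightarrow> wt (rw \<alpha> s (i - 1)) (E * z)"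
proof -
  assume z: "wt (rw \<alpha> s i) z"
  have "rw \<alpha> s (i - 1) = q powi 2 * rw \<alpha> s i"
    unfolding rw_def
    by (subst mult.left_commute, subst power_int_add[symmetric]) (simp_all add: algebra_simps)
  moreover have "K * (E * z) = q powi 2 *\<^sub>C (E * (K * z))"
    by (simp only: KE mult_scaleC_left flip: mult.assoc)
  ultimately show ?thesis
    using z by (simp add: wt_def mult_scaleC_right scaleC_scaleC)
qed

lemma wt_F: "wt (rw \<alpha> s i) z \<Longrightarrow> wt (rw \<alpha> s (i + 1)) (F * z)"
proof -
  assume z: "wt (rw \<alpha> s i) z"
  have "rw \<alpha> s (i + 1) = q powi - 2 * rw \<alpha> s i"
    unfolding rw_def
    by (subst mult.left_commute, subst power_int_add[symmetric]) (simp_all add: algebra_simps)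
  moreover have "K * (F * z) = q powi - 2 *\<^sub>C (F * (K * z))"
    by (simp only: KF mult_scaleC_left flip: mult.assoc)
  ultimately show ?thesis
    using z by (simp add: wt_def mult_scaleC_right scaleC_scaleC)
qed

lemma wt_E_power: "wt (rw \<alpha> s i) z \<Longrightarrow> wt (rw \<alpha> s (i - int n)) (E ^ n * z)"
proof (induction n)
  case (Suc n)
  then show ?case using wt_E[of \<alpha> s "i - int n" "E ^ n * z"] by (simp add: mult.assoc algebra_simps)
qed simp

lemma wt_F_power: "wt (rw \<alpha> s i) z \<Longrightarrow> wt (rw \<alpha> s (i + int n)) (F ^ n * z)"
proof (induction n)
  case (Suc n)
  then show ?case using wt_F[of \<alpha> s "i + int n" "F ^ n * z"] by (simp add: mult.assoc algebra_simps)
qed simp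

lemma nil_0 [simp]: "nil \<alpha> s 0 = 0"
  by (simp add: nil_def)

lemma nil_add: "nil \<alpha> s (z + w) = nil \<alpha> s z + nil \<alpha> s w"
  by (simp add: nil_def distrib_left scaleC_add_right)

lemma nil_scale: "nil \<alpha> s (c *\<^sub>C z) = c *\<^sub>C nil \<alpha> s z"
  by (simp add: nil_def mult_scaleC_right scaleC_scaleC complex_vec.scale_right_diff_distrib mult.commute)

lemma nil_diff: "nil \<alpha> s (z - w) = nil \<alpha> s z - nil \<alpha> s w"
  by (simp add: nil_def right_diff_distrib complex_vec.scale_right_diff_distrib)

lemma nil_sum: "nil \<alpha> s (sum f A) = (\<Sum>x\<in>A. nil \<alpha> s (f x))"
  by (induction A rule: infinite_finite_induct) (simp_all add: nil_add)

lemma nil_E_power: "nil \<alpha> s (E ^ n * z) = E ^ n * nil \<alpha> s z"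
  unfolding nil_def mult.assoc[symmetric] cas_E_power
  by (simp add: right_diff_distrib mult_scaleC_right mult.assoc)

lemma nil_F_power: "nil \<alpha> s (F ^ n * z) = F ^ n * nil \<alpha> s z"
  unfolding nil_def mult.assoc[symmetric] cas_F_power
  by (simp add: right_diff_distrib mult_scaleC_right mult.assoc)

lemma nil_E: "nil \<alpha> s (E * z) = E * nil \<alpha> s z"
  using nil_E_power[of \<alpha> s 1] by simp

lemma nil_mult: "nil \<alpha> s (z * w) = nil \<alpha> s z * w"
  by (simp add: nil_def left_diff_distrib mult_scaleC_left mult.assoc)

lemma wt_nil: "wt \<nu> z \<Longrightarrow> wt \<nu> (nil \<alpha> s z)"
  unfolding nil_def by (intro wt_diff wt_cas wt_scale)

end

locale uq_sign = uq_relations +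
  fixes \<alpha> :: complex
  assumes sign: "\<alpha> = 1 \<or> \<alpha> = - 1"
begin

lemma sign_nz [simp]: "\<alpha> \<noteq> 0" and sign_inverse [simp]: "inverse \<alpha> = \<alpha>" and sign_sq: "\<alpha> * \<alpha> = 1"
  using sign by auto

lemma rw_nz: "rw \<alpha> s i \<noteq> 0"
  by (simp add: rw_def)

lemma rw_2p: "rw \<alpha> s i ^ (2 * p) = 1"
proof -
  have "(q powi (s - 1 - 2 * i)) ^ (2 * p) = q powi ((s - 1 - 2 * i) * int (2 * p))"
    by (simp only: power_int_mult power_int_of_nat)
  also have "\<dots> = 1" by (subst qroot_powi_eq_1_iff) auto
  finally have "(q powi (s - 1 - 2 * i)) ^ (2 * p) = 1" .
  moreover have "\<alpha> ^ (2 * p) = 1"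
    using sign by auto
  ultimately show ?thesis
    by (simp only: rw_def power_mult_distrib mult_1)
qed

lemma rw_inverse: "inverse (rw \<alpha> s i) = \<alpha> * q powi (1 + 2 * i - s)"
proof -
  have "- (s - 1 - 2 * i) = 1 + 2 * i - s" by simp
  then show ?thesis
    by (metis inverse_mult_distrib power_int_minus rw_def sign_inverse)
qed

lemma zeta_ee:
  "zeta \<alpha> s - ee \<alpha> s i = \<alpha> * (q powi (s - 2 * i) + q powi (2 * i - s)) / D\<^sup>2"
proof -
  have "ee \<alpha> s i = \<alpha> * (qnum p i * qnum p (s - i))"
    by (simp add: ee_def)
  then show ?thesis
    by (simp add: qnum_mult zeta_def diff_divide_distrib[symmetric] right_diff_distrib[symmetric]
        add_divide_distrib[symmetric])
qed

text \<open>On a weight vector the terms of the Casimir element in K and Ki are scalars, and by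
  \<open>zeta_ee\<close> their sum differs from the eigenvalue by a structure constant. The form
  \<open>cas_EF\<close> gives the constant at i + 1, and \<open>cas_FE\<close>, used in
  \<open>FE_wt\<close>, the one at i.\<close>

lemma EF_wt:
  assumes "wt (rw \<alpha> s i) z"
  shows "E * (F * z) = nil \<alpha> s z + ee \<alpha> s (i + 1) *\<^sub>C z"
proof -
  have 1: "inverse q / D\<^sup>2 * rw \<alpha> s i = \<alpha> * q powi (s - 2 * (i + 1)) / D\<^sup>2"
    "q / D\<^sup>2 * inverse (rw \<alpha> s i) = \<alpha> * q powi (2 * (i + 1) - s) / D\<^sup>2"
  proof -
    have "inverse q * q powi (s - 1 - 2 * i) = q powi (-1) * q powi (s - 1 - 2 * i)"
      by (simp add: power_int_minus)
    also have "\<dots> = q powi (s - 2 * (i + 1))"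
      by (subst power_int_add[symmetric]) (simp_all add: algebra_simps)
    finally show "inverse q / D\<^sup>2 * rw \<alpha> s i = \<alpha> * q powi (s - 2 * (i + 1)) / D\<^sup>2"
      unfolding rw_def by (simp add: mult.left_commute)
    have "q * q powi (1 + 2 * i - s) = q powi 1 * q powi (1 + 2 * i - s)"
      by simp
    also have "\<dots> = q powi (2 * (i + 1) - s)"
      by (subst power_int_add[symmetric]) (simp_all add: algebra_simps)
    finally show "q / D\<^sup>2 * inverse (rw \<alpha> s i) = \<alpha> * q powi (2 * (i + 1) - s) / D\<^sup>2"
      unfolding rw_inverse by (simp add: mult.left_commute)
  qed
  have "cas * z = E * (F * z) + (inverse q / D\<^sup>2) *\<^sub>C (K * z) + (q / D\<^sup>2) *\<^sub>C (Ki * z)"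
    unfolding cas_EF by (simp add: distrib_right mult_scaleC_left mult.assoc)
  also have "\<dots> = E * (F * z) + (inverse q / D\<^sup>2 * rw \<alpha> s i) *\<^sub>C z
      + (q / D\<^sup>2 * inverse (rw \<alpha> s i)) *\<^sub>C z"
    unfolding wt_Ki[OF assms rw_nz] assms[unfolded wt_def] scaleC_scaleC ..
  also have "\<dots> = E * (F * z) + (zeta \<alpha> s - ee \<alpha> s (i + 1)) *\<^sub>C z"
    unfolding 1 zeta_ee by (simp add: distrib_left add_divide_distrib scaleC_add_left add.assoc)
  finally show ?thesis
    by (simp add: nil_def complex_vec.scale_left_diff_distrib algebra_simps)
qed

lemma FE_wt:
  assumes "wt (rw \<alpha> s i) z"
  shows "F * (E * z) = nil \<alpha> s z + ee \<alpha> s i *\<^sub>C z"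
proof -
  have 1: "q / D\<^sup>2 * rw \<alpha> s i = \<alpha> * q powi (s - 2 * i) / D\<^sup>2"
    "inverse q / D\<^sup>2 * inverse (rw \<alpha> s i) = \<alpha> * q powi (2 * i - s) / D\<^sup>2"
  proof -
    have "inverse q * q powi (1 + 2 * i - s) = q powi (-1) * q powi (1 + 2 * i - s)"
      by (simp add: power_int_minus)
    also have "\<dots> = q powi (2 * i - s)"
      by (subst power_int_add[symmetric]) (simp_all add: algebra_simps)
    finally show "inverse q / D\<^sup>2 * inverse (rw \<alpha> s i) = \<alpha> * q powi (2 * i - s) / D\<^sup>2"
      unfolding rw_inverse by (simp add: mult.left_commute)
    have "q * q powi (s - 1 - 2 * i) = q powi 1 * q powi (s - 1 - 2 * i)"
      by simp
    also have "\<dots> = q powi (s - 2 * i)"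
      by (subst power_int_add[symmetric]) (simp_all add: algebra_simps)
    finally show "q / D\<^sup>2 * rw \<alpha> s i = \<alpha> * q powi (s - 2 * i) / D\<^sup>2"
      unfolding rw_def by (simp add: mult.left_commute)
  qed
  have "cas * z = F * (E * z) + (q / D\<^sup>2) *\<^sub>C (K * z) + (inverse q / D\<^sup>2) *\<^sub>C (Ki * z)"
    unfolding cas_FE by (simp add: distrib_right mult_scaleC_left mult.assoc)
  also have "\<dots> = F * (E * z) + (q / D\<^sup>2 * rw \<alpha> s i) *\<^sub>C z
      + (inverse q / D\<^sup>2 * inverse (rw \<alpha> s i)) *\<^sub>C z"
    unfolding wt_Ki[OF assms rw_nz] assms[unfolded wt_def] scaleC_scaleC ..
  also have "\<dots> = F * (E * z) + (zeta \<alpha> s - ee \<alpha> s i) *\<^sub>C z"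
    unfolding 1 zeta_ee by (simp add: distrib_left add_divide_distrib scaleC_add_left add.assoc)
  finally show ?thesis
    by (simp add: nil_def complex_vec.scale_left_diff_distrib algebra_simps)
qed

text \<open>On a highest weight vector \<open>E\<^sup>j F\<^sup>j\<close> acts as the polynomial \<open>\<Prod>\<^sub>i\<^sub>\<le>\<^sub>j (N + e\<^sub>i)\<close> in the
  nilpotent part \<open>N\<close> of the Casimir element; \<open>EF_tail\<close> is its linear coefficient.\<close>

primrec EF_tail :: "int \<Rightarrow> nat \<Rightarrow> complex"
  where
    "EF_tail s 0 = 0"
  | "EF_tail s (Suc j) = ee \<alpha> s (int j + 1) * EF_tail s j + (\<Prod>i<j. ee \<alpha> s (int i + 1))"

lemma EF_powers:
  assumes "wt (rw \<alpha> s 0) w" "nil \<alpha> s (nil \<alpha> s w) = 0"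
  shows "E ^ j * (F ^ j * w) = (\<Prod>i<j. ee \<alpha> s (int i + 1)) *\<^sub>C w + EF_tail s j *\<^sub>C nil \<alpha> s w"
  using assms
proof (induction j arbitrary: w)
  case (Suc j)
  let ?P = "\<Prod>i<j. ee \<alpha> s (int i + 1)"
  have "E ^ Suc j * (F ^ Suc j * w) = E ^ j * (E * (F * (F ^ j * w)))"
    by (simp only: power_Suc2[of E j] power_Suc[of F j] mult.assoc)
  also have "\<dots> = E ^ j * (F ^ j * nil \<alpha> s w) + ee \<alpha> s (int j + 1) *\<^sub>C (E ^ j * (F ^ j * w))"
    using EF_wt[OF wt_F_power[OF Suc.prems(1), of j]]
    by (simp add: nil_F_power distrib_left mult_scaleC_right)
  \<comment> \<open>The induction hypothesis is applied to N w, where only the constant term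
    survives because N N w = 0.\<close>
  also have "E ^ j * (F ^ j * nil \<alpha> s w) = ?P *\<^sub>C nil \<alpha> s w"
    using Suc.IH[OF wt_nil[OF Suc.prems(1)]] Suc.prems(2) by simp
  also have "E ^ j * (F ^ j * w) = ?P *\<^sub>C w + EF_tail s j *\<^sub>C nil \<alpha> s w"
    using Suc.IH[OF Suc.prems] .
  finally show ?case
    by (simp add: scaleC_add_right scaleC_add_left scaleC_scaleC algebra_simps)
qed simp

end

section \<open>The columns of a block\<close>

definition weight_sum :: "nat \<Rightarrow> 'a::complex_algebra_1 \<Rightarrow> complex \<Rightarrow> 'a"
  where "weight_sum n x \<nu> = (\<Sum>l<n. inverse \<nu> ^ l *\<^sub>C x ^ l)"

text \<open>Multiplication by x / \<nu> shifts the summation index cyclically, because (x / \<nu>)^n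
  = 1.\<close>

lemma mult_weight_sum:
  assumes "\<nu> ^ n = 1" "x ^ n = 1" "n > 0"
  shows "x * weight_sum n x \<nu> = \<nu> *\<^sub>C weight_sum n x \<nu>" "weight_sum n x \<nu> * x = \<nu> *\<^sub>C weight_sum n x \<nu>"
proof -
  have nz: "\<nu> \<noteq> 0" using assms by (auto simp: power_0_left)
  let ?f = "\<lambda>l. inverse \<nu> ^ l *\<^sub>C x ^ l"
  have "inverse \<nu> *\<^sub>C (x * weight_sum n x \<nu>) = (\<Sum>l<n. ?f (Suc l))"
    by (simp add: weight_sum_def sum_distrib_left complex_vec.scale_sum_right mult_scaleC_right
        scaleC_scaleC)
  also have "\<dots> = (\<Sum>l<n. ?f l) + ?f n - ?f 0"
    using sum.lessThan_Suc_shift[of ?f n] by (simp add: algebra_simps)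
  also have "\<dots> = weight_sum n x \<nu>"
    using assms by (simp add: weight_sum_def power_inverse)
  finally have "\<nu> *\<^sub>C weight_sum n x \<nu> = \<nu> *\<^sub>C inverse \<nu> *\<^sub>C (x * weight_sum n x \<nu>)" by simp
  then show 1: "x * weight_sum n x \<nu> = \<nu> *\<^sub>C weight_sum n x \<nu>"
    using nz by simp
  have "weight_sum n x \<nu> * x = x * weight_sum n x \<nu>"
    by (simp add: weight_sum_def sum_distrib_left sum_distrib_right mult_scaleC_left
        mult_scaleC_right power_commutes)
  with 1 show "weight_sum n x \<nu> * x = \<nu> *\<^sub>C weight_sum n x \<nu>" by simp
qed

lemma weight_sum_mult:
  assumes "x * w = \<nu> *\<^sub>C w" "\<nu> \<noteq> 0"
  shows "weight_sum n x \<nu> * w = of_nat n *\<^sub>C w"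
proof -
  have pow: "x ^ l * w = \<nu> ^ l *\<^sub>C w" for l
    by (induction l)
      (simp_all add: mult.assoc mult_scaleC_right assms(1) scaleC_scaleC mult.commute)
  show ?thesis
  proof (induction n)
    case (Suc n)
    then show ?case
      using assms(2) by (simp add: weight_sum_def distrib_right mult_scaleC_left pow scaleC_scaleC
          scaleC_add_left flip: power_mult_distrib)
  qed (simp add: weight_sum_def)
qed

locale uq_chain = uq + uq_sign
begin

text \<open>The parameter t counts from 1 and positions in a chain from 0: v(s,t) selects position t
  - 1. This is the source of the shifts \<open>t - 1\<close> in the products below.\<close>

lemma vv_weight_sum: "vv p K \<alpha> s t = weight_sum (2 * p) K (rw \<alpha> (int s) (int t - 1))"
  by (simp add: vv_def weight_sum_def rw_inverse algebra_simps)

lemma wt_vv: "wt (rw \<alpha> (int s) (int t - 1)) (vv p K \<alpha> s t)"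
  unfolding wt_def vv_weight_sum by (rule mult_weight_sum) (simp_all add: rw_2p K_2p)

lemma vv_K: "vv p K \<alpha> s t * K = rw \<alpha> (int s) (int t - 1) *\<^sub>C vv p K \<alpha> s t"
  unfolding wt_def vv_weight_sum by (rule mult_weight_sum) (simp_all add: rw_2p K_2p)

lemma vv_mult:
  "wt (rw \<alpha> (int s) (int t - 1)) w \<Longrightarrow> vv p K \<alpha> s t * w = of_nat (2 * p) *\<^sub>C w"
  unfolding wt_def vv_weight_sum by (rule weight_sum_mult) (simp_all add: rw_nz)

definition a0 :: "nat \<Rightarrow> nat \<Rightarrow> 'a"
  where "a0 s t = E ^ (p - 1) * (F ^ (p - t) * vv p K \<alpha> s t)"

lemma elt_a_eq: "elt_a p E F K \<alpha> n s t = F ^ n * a0 s t"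
  by (simp add: elt_a_def a0_def mult.assoc)

lemma a0_nz:
  assumes "1 \<le> t"
  shows "a0 s t \<noteq> 0"
  using socle_nz[OF rw_2p, of "p - t" "int s" "int t - 1"] assms p_pos
  by (simp add: a0_def vv_weight_sum weight_sum_def mult.assoc)

lemma E_a0: "E * a0 s t = 0"
  using E_p p_pos power_Suc[of E "p - 1"] by (simp add: a0_def flip: mult.assoc)

lemma a0_K: "a0 s t * K = rw \<alpha> (int s) (int t - 1) *\<^sub>C a0 s t"
  by (simp add: a0_def mult.assoc vv_K mult_scaleC_right)

text \<open>Starting in position t - 1, F^(p-t) leads down to p - 1 and E^(p-1) back up to
  0.\<close>

lemma wt_a0:
  assumes "t \<le> p"
  shows "wt (rw \<alpha> (int s) 0) (a0 s t)"
proof -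
  have "wt (rw \<alpha> (int s) (int t - 1 + int (p - t) - int (p - 1))) (a0 s t)"
    unfolding a0_def by (intro wt_E_power wt_F_power wt_vv)
  then show ?thesis
    using assms p_pos by (simp add: of_nat_diff)
qed

text \<open>F E a_0 = 0, and the structure constant in position 0 vanishes, so N is all that is left
  of \<open>FE_wt\<close>.\<close>

lemma nil_a0:
  assumes "t \<le> p"
  shows "nil \<alpha> (int s) (a0 s t) = 0"
  using FE_wt[OF wt_a0[OF assms, of s]] by (simp add: E_a0)

lemma E_power_F_power_a0:
  assumes "t \<le> p" "m \<le> n"
  shows "E ^ m * (F ^ n * a0 s t) = (\<Prod>i\<in>{n - m + 1..n}. ee \<alpha> (int s) (int i)) *\<^sub>C (F ^ (n - m) * a0 s t)"
  using assms(2)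
proof (induction m)
  case (Suc m)
  let ?P = "\<Prod>i\<in>{n - m + 1..n}. ee \<alpha> (int s) (int i)"
  have n: "n - m = Suc (n - Suc m)" using Suc.prems by simp
  have "E ^ Suc m * (F ^ n * a0 s t) = ?P *\<^sub>C (E * (F * (F ^ (n - Suc m) * a0 s t)))"
    using Suc by (simp add: mult.assoc mult_scaleC_right n)
  also have "\<dots> = (?P * ee \<alpha> (int s) (int (n - m))) *\<^sub>C (F ^ (n - Suc m) * a0 s t)"
    using EF_wt[OF wt_F_power[OF wt_a0[OF assms(1), of s], of "n - Suc m"]]
    by (simp add: nil_F_power nil_a0[OF assms(1)] scaleC_scaleC n add.commute)
  also have "?P * ee \<alpha> (int s) (int (n - m)) = (\<Prod>i\<in>insert (n - m) {n - m + 1..n}. ee \<alpha> (int s) (int i))"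
    by (subst prod.insert) (auto simp: mult.commute)
  also have "insert (n - m) {n - m + 1..n} = {n - Suc m + 1..n}"
    using Suc.prems by auto
  finally show ?case .
qed simp

end

locale uq_column = uq_chain +
  fixes s :: nat
  assumes s1: "1 \<le> s" and sp: "s < p"
begin

lemma dual: "uq_column p E F K Ki (- \<alpha>) (p - s)"
  by unfold_locales (use sign s1 sp in auto)

text \<open>The sign change is absorbed by q^p = -1. Position 0 of one chain thus follows the last
  of the p - s positions of the other; \<open>zeta_dual\<close> puts both chains into one
  block.\<close>

lemma rw_dual: "rw (- \<alpha>) (int (p - s)) (int (p - s) + i) = rw \<alpha> (int s) i"
proof -
  have "q powi (int p) * q powi (int (p - s) - 1 - 2 * (int (p - s) + i)) = q powi (int s - 1 - 2 * i)"
    using sp by (subst power_int_add[symmetric]) (simp_all add: of_nat_diff algebra_simps)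
  then show ?thesis
    by (simp add: rw_def qroot_powi_p del: power_int_of_nat) (metis minus_mult_right)
qed

lemma zeta_dual: "zeta (- \<alpha>) (int (p - s)) = zeta \<alpha> (int s)"
proof -
  have "q powi (int (p - s)) = q powi int p * q powi (- int s)"
    "q powi (- int (p - s)) = q powi (- int p) * q powi (int s)"
    using sp by (subst power_int_add[symmetric]; simp add: of_nat_diff)+
  moreover have "q powi (- int p) = - 1"
    using qroot_powi_p[of p] by (simp add: power_int_minus)
  ultimately show ?thesis
    using qroot_powi_p[of p] unfolding zeta_def
    by (intro arg_cong[where f = "\<lambda>x. x / D\<^sup>2"]) (simp add: algebra_simps del: power_int_of_nat)
qed

lemma nil_dual: "nil (- \<alpha>) (int (p - s)) z = nil \<alpha> (int s) z"
  by (simp add: nil_def zeta_dual)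

lemma ee_shift: "ee \<alpha> (int s) (int s + i) = ee (- \<alpha>) (int (p - s)) i"
  using qnum_diff_p[of p "int s + i"] qnum_minus[of p "int p - (int s + i)"] qnum_minus[of p i] sp
  by (simp add: ee_def of_nat_diff algebra_simps)

lemma ee_qint: "i \<le> s \<Longrightarrow> ee \<alpha> (int s) (int i) = \<alpha> * qint p i * qint p (s - i)"
  by (simp add: ee_def qint_eq_qnum of_nat_diff)

abbreviation "A0 \<equiv> a0 s"

text \<open>At m = 0, outside the range of the sum b_0, the same formula gives a_0; this is the end
  term of the telescoping sum in \<open>nil_b0\<close>.\<close>

definition W :: "nat \<Rightarrow> nat \<Rightarrow> 'a"
  where "W m t = E ^ (p - m - 1) * (F ^ (p - t - m) * vv p K \<alpha> s t)"

definition b0 :: "nat \<Rightarrow> 'a"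
  where "b0 t = (\<Sum>m\<in>{1..p - s}. mu p \<alpha> m s *\<^sub>C W m t)"

lemma elt_b_eq: "elt_b p E F K \<alpha> n s t = F ^ n * b0 t"
  by (simp add: elt_b_def b0_def W_def mult.assoc)

lemma elt_y_eq: "elt_y p E F K \<alpha> k s t = F ^ (s + k) * b0 t"
  by (simp add: elt_y_def elt_b_eq)

lemma mu_1: "mu p \<alpha> (Suc 0) s = 1"
  using sp by (simp add: mu_def)

lemma mu_Suc:
  assumes "1 \<le> m" "m \<le> p - s"
  shows "mu p \<alpha> (Suc m) s = mu p \<alpha> m s * ee \<alpha> (int s) (int (p - m))"
proof -
  have "{p - s - (Suc m - 1)..p - s - 1} = insert (p - s - m) {p - s - (m - 1)..p - s - 1}"
    using assms by auto
  moreover have "p - s - m \<notin> {p - s - (m - 1)..p - s - 1}"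
    using assms by auto
  ultimately have "mu p \<alpha> (Suc m) s = (- \<alpha> * qint p (p - s - m) * qint p m) * mu p \<alpha> m s"
    using assms by (simp add: mu_def)
  moreover have "ee \<alpha> (int s) (int (p - m)) = - \<alpha> * qint p (p - s - m) * qint p m"
    using assms sp qnum_p_diff[of p "int m"] qnum_minus[of p "int p - int s - int m"]
    by (simp add: ee_def qint_eq_qnum of_nat_diff algebra_simps)
  ultimately show ?thesis by simp
qed

context
  fixes t :: nat
  assumes t1: "1 \<le> t" and ts: "t \<le> s"
begin

lemma W_0: "W 0 t = A0 t"
  by (simp add: W_def a0_def)

lemma wt_W:
  assumes "m \<le> p - s"
  shows "wt (rw \<alpha> (int s) 0) (W m t)"
proof -
  have "wt (rw \<alpha> (int s) (int t - 1 + int (p - t - m) - int (p - m - 1))) (W m t)"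
    unfolding W_def by (intro wt_E_power wt_F_power wt_vv)
  then show ?thesis
    using assms ts sp s1 by (simp add: of_nat_diff)
qed

text \<open>W_(m-1) differs from W_m by one inserted product E F, acting on a vector in position p -
  m - 1; \<open>EF_wt\<close> evaluates it as N + e_(p-m).\<close>

lemma nil_W:
  assumes "1 \<le> m" "m \<le> p - s"
  shows "nil \<alpha> (int s) (W m t) = W (m - 1) t - ee \<alpha> (int s) (int (p - m)) *\<^sub>C W m t"
proof -
  let ?z = "F ^ (p - t - m) * vv p K \<alpha> s t"
  have i: "int t - 1 + int (p - t - m) + 1 = int (p - m)"
    and e: "p - (m - 1) - 1 = Suc (p - m - 1)" and f: "p - t - (m - 1) = Suc (p - t - m)"
    using assms ts sp s1 by (simp_all add: of_nat_diff)
  have "E * (F * ?z) = nil \<alpha> (int s) ?z + ee \<alpha> (int s) (int (p - m)) *\<^sub>C ?z"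
    using EF_wt[OF wt_F_power[OF wt_vv[of s t]], of "p - t - m"] unfolding i .
  then have "E ^ (p - m - 1) * (E * (F * ?z)) = nil \<alpha> (int s) (W m t) + ee \<alpha> (int s) (int (p - m)) *\<^sub>C W m t"
    by (simp add: W_def nil_E_power distrib_left mult_scaleC_right)
  moreover have "W (m - 1) t = E ^ (p - m - 1) * (E * (F * ?z))"
    unfolding W_def e f power_Suc2[of E] power_Suc[of F] by (simp only: mult.assoc)
  ultimately show ?thesis by simp
qed

lemma wt_b0: "wt (rw \<alpha> (int s) 0) (b0 t)"
  unfolding b0_def by (intro wt_sum wt_scale wt_W) simp

lemma b0_K: "b0 t * K = rw \<alpha> (int s) (int t - 1) *\<^sub>C b0 t"
  by (simp add: b0_def W_def sum_distrib_right mult.assoc vv_K mult_scaleC_right mult_scaleC_left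
      complex_vec.scale_sum_right scaleC_scaleC mult.commute)

text \<open>By \<open>nil_W\<close> and \<open>mu_Suc\<close>, N (mu_m W_m) = mu_m W_(m-1) -
  mu_(m+1) W_m, so the sum telescopes to W_0; the other end drops out because mu_(p-s+1) contains
  the factor e_s = 0.\<close>

lemma nil_b0: "nil \<alpha> (int s) (b0 t) = A0 t"
proof -
  have tele: "(\<Sum>m\<in>{1..n}. nil \<alpha> (int s) (mu p \<alpha> m s *\<^sub>C W m t)) = A0 t - mu p \<alpha> (Suc n) s *\<^sub>C W n t"
    if "n \<le> p - s" for n
    using that
  proof (induction n)
    case 0
    then show ?case by (simp add: W_0 mu_1)
  next
    case (Suc n)
    then show ?case
      using nil_W[of "Suc n"] mu_Suc[of "Suc n"]
      by (simp add: nil_scale complex_vec.scale_right_diff_distrib scaleC_scaleC)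
  qed
  have "mu p \<alpha> (Suc (p - s)) s = 0"
    using mu_Suc[of "p - s"] sp by simp
  then show ?thesis
    using tele[of "p - s"] by (simp add: b0_def nil_sum)
qed

lemma FE_b0: "F * (E * b0 t) = A0 t"
  using FE_wt[OF wt_b0] by (simp add: nil_b0)

text \<open>For m <= p - s the total power of E in front of each summand is p + (p - s - m).\<close>

lemma E_power_b0: "E ^ (p - s) * (E * b0 t) = 0"
proof -
  have "E ^ (p - s) * (E * W m t) = 0" if "m \<in> {1..p - s}" for m
  proof -
    have "E ^ (p - s) * (E * W m t) = E ^ (p - s + 1 + (p - m - 1)) * (F ^ (p - t - m) * vv p K \<alpha> s t)"
      unfolding W_def by (simp only: power_add power_one_right mult.assoc)
    also have "p - s + 1 + (p - m - 1) = p + (p - s - m)"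
      using that sp s1 by auto
    finally show ?thesis by (simp add: power_add E_p)
  qed
  then show ?thesis
    by (simp add: b0_def sum_distrib_left mult_scaleC_right)
qed

text \<open>The scalar is chosen so that F x_k = x_(k+1). As F sends the last of them, E b_0, to
  a_0, the elements x_0, ..., x_(p-s-1), a_0, ..., a_(s-1) form a single chain of length p under
  F.\<close>

definition X :: "nat \<Rightarrow> 'a"
  where "X k = (1 / (\<Prod>i\<in>{k + 1..p - s - 1}. - \<alpha> * qint p i * qint p (p - s - i))) *\<^sub>C
    (E ^ (p - s - k - 1) * (E * b0 t))"

lemma elt_x_eq: "elt_x p E F K \<alpha> k s t = X k"
proof -
  have "E ^ (p - m) * F ^ (p - t - m) * vv p K \<alpha> s t = E * W m t" if "m \<in> {1..p - s}" for m
  proof -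
    have "p - m = Suc (p - m - 1)" using that s1 by auto
    then show ?thesis unfolding W_def by (metis mult.assoc power_Suc)
  qed
  then show ?thesis
    by (simp add: elt_x_def X_def b0_def sum_distrib_left mult_scaleC_right)
qed

lemma X_top: "X (p - s - 1) = E * b0 t"
  by (simp add: X_def)

lemma nil_X: "nil \<alpha> (int s) (X k) = 0"
  by (simp add: X_def nil_scale nil_E_power nil_E nil_b0 E_a0)

lemma E_X_0: "E * X 0 = 0"
proof -
  have "p - s = Suc (p - s - 1)"
    using sp by simp
  then have "E * (E ^ (p - s - 1) * (E * b0 t)) = E ^ (p - s) * (E * b0 t)"
    by (metis mult.assoc power_Suc)
  then show ?thesis
    by (simp add: X_def mult_scaleC_right E_power_b0)
qed

lemma wt_X:
  assumes "k < p - s"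
  shows "wt (rw \<alpha> (int s) (int (s + k))) (X k)"
proof -
  \<comment> \<open>The powers of E lead from position 0 up to s + k - p, which has the weight of
    position s + k because q^2 has order p.\<close>
  have "rw \<alpha> (int s) (0 - 1 - int (p - s - k - 1)) = rw \<alpha> (int s) (int (s + k))"
  proof -
    have "q powi (int s - 1 - 2 * (0 - 1 - int (p - s - k - 1))) = q powi (int s - 1 - 2 * int (s + k))"
      by (rule qroot_powi_cong) (use assms sp in \<open>auto simp: of_nat_diff\<close>)
    then show ?thesis by (simp add: rw_def)
  qed
  then show ?thesis
    unfolding X_def using wt_scale[OF wt_E_power[OF wt_E[OF wt_b0]]] by metis
qed

text \<open>x_k is E x_(k+1) divided by the structure constant in position s + k + 1. Since N
  x_(k+1) = 0, applying F restores exactly this constant.\<close>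

lemma F_X:
  assumes "Suc k < p - s"
  shows "F * X k = X (Suc k)"
proof -
  let ?f = "\<lambda>i. - \<alpha> * qint p i * qint p (p - s - i)"
  have "{k + 1..p - s - 1} = insert (Suc k) {Suc k + 1..p - s - 1}"
    using assms by auto
  then have P: "(\<Prod>i\<in>{k + 1..p - s - 1}. ?f i) = ?f (Suc k) * (\<Prod>i\<in>{Suc k + 1..p - s - 1}. ?f i)"
    by simp
  have f: "?f (Suc k) \<noteq> 0"
    using assms sp s1 qnum_nz[OF p2] by (simp add: qint_eq_qnum)
  have "p - s - k - 1 = Suc (p - s - Suc k - 1)"
    using assms by simp
  then have X: "X k = (1 / ?f (Suc k)) *\<^sub>C (E * X (Suc k))"
    unfolding X_def P by (simp add: mult_scaleC_right scaleC_scaleC mult.assoc)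
  interpret d: uq_column p E F K Ki "- \<alpha>" "p - s" by (rule dual)
  have "ee \<alpha> (int s) (int (s + Suc k)) = ee (- \<alpha>) (int (p - s)) (int (Suc k))"
    using ee_shift[of "int (Suc k)"] by (simp only: of_nat_add)
  also have "\<dots> = ?f (Suc k)"
    using d.ee_qint[of "Suc k"] assms by simp
  finally have "ee \<alpha> (int s) (int (s + Suc k)) = ?f (Suc k)" .
  then have "F * (E * X (Suc k)) = ?f (Suc k) *\<^sub>C X (Suc k)"
    using FE_wt[OF wt_X[OF assms]] by (simp add: nil_X)
  with f show ?thesis
    by (simp add: X mult_scaleC_right scaleC_scaleC)
qed

lemma F_power_X_0: "k < p - s \<Longrightarrow> F ^ k * X 0 = X k"
  by (induction k) (simp_all add: mult.assoc F_X)

lemma F_power_X_0_top: "F ^ (p - s) * X 0 = A0 t"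
proof -
  have "p - s = Suc (p - s - 1)"
    using sp by simp
  then have "F ^ (p - s) * X 0 = F * (F ^ (p - s - 1) * X 0)"
    by (metis mult.assoc power_Suc)
  then show ?thesis
    using sp by (simp add: F_power_X_0 X_top[simplified] FE_b0)
qed

text \<open>a_0 is already F^(p-s) x_0, so F^s a_0 involves F^p.\<close>

lemma F_power_A0: "F ^ s * A0 t = 0"
proof -
  have "F ^ s * A0 t = F ^ (s + (p - s)) * X 0"
    by (simp add: power_add mult.assoc F_power_X_0_top)
  then show ?thesis
    using sp by (simp add: F_p)
qed

lemma nil_Y: "nil \<alpha> (int s) (F ^ s * b0 t) = 0"
  by (simp add: nil_F_power nil_b0 F_power_A0)

text \<open>In position s - 1 the constant e_s of E F vanishes and only N remains, which turns b_0
  into a_0.\<close>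

lemma E_Y_0: "E * (F ^ s * b0 t) = F ^ (s - 1) * A0 t"
proof -
  have "E * (F ^ s * b0 t) = E * (F * (F ^ (s - 1) * b0 t))"
    using s1 power_Suc[of F "s - 1"] by (simp add: mult.assoc)
  then show ?thesis
    using EF_wt[OF wt_F_power[OF wt_b0], of "s - 1"] s1
    by (simp add: nil_F_power nil_b0 of_nat_diff)
qed

lemma wt_Y: "wt (rw \<alpha> (int s) (int s)) (F ^ s * b0 t)"
  using wt_F_power[OF wt_b0, of s] by simp

end

end

section \<open>Multiplication table\<close>

context uq_column
begin

text \<open>Rows of a column are numbered by \<open>i < p\<close> along the weights: \<open>b\<close> and \<open>a\<close> occupy the rows
  \<open>i < s\<close>, and \<open>x\<close> and \<open>y\<close> the remaining ones. The flag \<open>e\<close> selects the second element of each pair.\<close>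

definition col :: "nat \<Rightarrow> nat \<Rightarrow> bool \<Rightarrow> 'a"
  where "col t i e =
    (if i < s then if e then elt_a p E F K \<alpha> i s t else elt_b p E F K \<alpha> i s t
     else if e then elt_y p E F K \<alpha> (i - s) s t else elt_x p E F K \<alpha> (i - s) s t)"

text \<open>The left factors g that produce the rows of a column from b_0. For the rows a_i this
  uses a_0 = F E b_0, which removes the dependence on t.\<close>

definition gen :: "nat \<Rightarrow> bool \<Rightarrow> 'a"
  where "gen i e =
    (if i < s then if e then F ^ (i + 1) * E else F ^ i
     else if e then F ^ i
     else (1 / (\<Prod>j\<in>{i - s + 1..p - s - 1}. - \<alpha> * qint p j * qint p (p - s - j))) *\<^sub>C E ^ (p - i))"

text \<open>Only the summand m = p - s of b_0 is visible here: for smaller m the scalar part of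
  E^(p-m-1) F^(p-m-1) contains the factor e_s = 0. The linear coefficients in \<open>tail\<close>
  need not vanish for these m, so there the whole sum is kept.\<close>

definition gam :: complex
  where "gam = of_nat (2 * p) * mu p \<alpha> (p - s) s * (\<Prod>i<s - 1. ee \<alpha> (int s) (int i + 1))"

definition tail :: complex
  where "tail = of_nat (2 * p) * (\<Sum>m\<in>{1..p - s}. mu p \<alpha> m s * EF_tail (int s) (p - m - 1))"

lemma gen_b0:
  assumes "1 \<le> t" "t \<le> s" "i < p"
  shows "gen i e * b0 t = col t i e"
proof -
  have "E ^ (p - s - (i - s) - 1) * (E * b0 t) = E ^ (p - i) * b0 t" if "\<not> i < s"
  proof -
    have "p - i = Suc (p - s - (i - s) - 1)" using that assms by simp
    then show ?thesis by (metis mult.assoc power_Suc2)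
  qed
  moreover have "F ^ Suc i * (E * b0 t) = F ^ i * A0 t"
    by (simp only: power_Suc2 mult.assoc FE_b0[OF assms(1,2)])
  ultimately show ?thesis
    using assms by (auto simp: gen_def col_def elt_a_eq elt_b_eq elt_y_eq elt_x_eq X_def mult_scaleC_left mult.assoc
        simp del: power_Suc)
qed

lemma E_power_eq_0: "E * z = 0 \<Longrightarrow> n > 0 \<Longrightarrow> E ^ n * z = 0"
  by (cases n) (simp_all add: power_Suc2 mult.assoc del: power_Suc)

lemma F_power_eq_0: "F ^ m * z = 0 \<Longrightarrow> m \<le> n \<Longrightarrow> F ^ n * z = 0"
  by (metis le_add_diff_inverse2 mult.assoc mult_zero_right power_add)

lemma gen_a0:
  assumes "1 \<le> t" "t \<le> s" "i < p"
  shows "gen i e * A0 t = (if i < s \<and> \<not> e then col t i True else 0)"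
  using assms E_a0[of s t] F_power_A0[OF assms(1,2)]
  by (auto simp: gen_def col_def elt_a_eq mult_scaleC_left mult.assoc E_power_eq_0
      intro: F_power_eq_0)

context
  fixes u :: nat
  assumes u1: "1 \<le> u" and us: "u \<le> p - s"
begin

interpretation d: uq_column p E F K Ki "- \<alpha>" "p - s"
  by (rule dual)

text \<open>x_0 of the dual column is killed by E and starts a chain of length p under F, so only
  those left factors survive that are powers of F; they walk through the x and then through the a of
  that column.\<close>

lemma gen_dual_X:
  assumes "i < p"
  shows "gen i e * d.X u 0 =
    (if i < s then if e then 0 else d.col u (p - s + i) False
     else if e then d.col u (i - s) True else 0)"
proof -
  have E: "E * d.X u 0 = 0"
    by (rule d.E_X_0[OF u1 us])
  have "F ^ i * d.X u 0 = d.col u (p - s + i) False" if "i < s"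
  proof -
    have "\<not> p - s + i < p - s" "p - s + i - (p - s) = i" by simp_all
    then show ?thesis
      using that d.F_power_X_0[OF u1 us, of i] sp
      by (simp only: d.col_def d.elt_x_eq[OF u1 us] if_False)
  qed
  moreover have "F ^ i * d.X u 0 = d.col u (i - s) True" if "\<not> i < s"
  proof -
    have "F ^ i * d.X u 0 = F ^ (i - s) * (F ^ (p - (p - s)) * d.X u 0)"
      using that sp by (simp flip: mult.assoc power_add)
    then show ?thesis
      using that assms d.F_power_X_0_top[OF u1 us] sp
      by (simp add: d.col_def d.elt_a_eq diff_less_mono)
  qed
  ultimately show ?thesis
    using assms E by (auto simp: gen_def mult_scaleC_left mult.assoc E_power_eq_0)
qed

text \<open>E y_0 = F^(p-s-1) a_0 in the dual column. Further powers of F kill it, while powers of E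
  climb the a-chain and collect precisely the product by which x was normalised. Powers of F at y_0
  end at F^p = 0.\<close>

lemma gen_dual_Y:
  assumes "i < p"
  shows "gen i e * (F ^ (p - s) * d.b0 u) =
    (if i < s then if e then 0 else d.col u (p - s + i) True
     else if e then 0 else d.col u (i - s) True)"
proof -
  let ?Y = "F ^ (p - s) * d.b0 u"
  let ?f = "\<lambda>j. - \<alpha> * qint p j * qint p (p - s - j)"
  have E: "E * ?Y = F ^ (p - s - 1) * d.A0 u"
    by (rule d.E_Y_0[OF u1 us])
  have "F ^ i * ?Y = d.col u (p - s + i) True"
    by (simp add: d.col_def d.elt_y_eq power_add[symmetric] mult.assoc[symmetric] add.commute)
  moreover have "F ^ Suc i * (E * ?Y) = 0"
  proof -
    have "F ^ Suc i * (E * ?Y) = F ^ i * (F ^ (p - s) * d.A0 u)"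
    proof -
      have "Suc i + (p - s - 1) = i + (p - s)" using sp by simp
      then show ?thesis unfolding E by (metis mult.assoc power_add)
    qed
    then show ?thesis by (simp add: d.F_power_A0[OF u1 us])
  qed
  moreover have "F ^ i * ?Y = 0" if "\<not> i < s"
  proof -
    have "F ^ i * ?Y = F ^ (i + (p - s)) * d.b0 u" by (simp add: power_add mult.assoc)
    also have "\<dots> = 0" by (rule F_power_eq_0[of p]) (use that sp in \<open>auto simp: F_p\<close>)
    finally show ?thesis .
  qed
  moreover have "(1 / (\<Prod>j\<in>{i - s + 1..p - s - 1}. ?f j)) *\<^sub>C (E ^ (p - i) * ?Y) = d.col u (i - s) True"
    if "\<not> i < s"
  proof -
    have "p - i = Suc (p - i - 1)" using assms by simp
    then have "E ^ (p - i) * ?Y = E ^ (p - i - 1) * (F ^ (p - s - 1) * d.A0 u)"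
      by (metis E mult.assoc power_Suc2)
    also have "\<dots> = (\<Prod>j\<in>{p - s - 1 - (p - i - 1) + 1..p - s - 1}. ee (- \<alpha>) (int (p - s)) (int j)) *\<^sub>C
        (F ^ (p - s - 1 - (p - i - 1)) * d.A0 u)"
      by (rule d.E_power_F_power_a0) (use us that in auto)
    also have "p - s - 1 - (p - i - 1) = i - s"
      using that assms by simp
    also have "(\<Prod>j\<in>{i - s + 1..p - s - 1}. ee (- \<alpha>) (int (p - s)) (int j))
        = (\<Prod>j\<in>{i - s + 1..p - s - 1}. ?f j)"
      by (intro prod.cong refl) (subst d.ee_qint; auto)
    finally have "E ^ (p - i) * ?Y = (\<Prod>j\<in>{i - s + 1..p - s - 1}. ?f j) *\<^sub>C (F ^ (i - s) * d.A0 u)" .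
    moreover have "(\<Prod>j\<in>{i - s + 1..p - s - 1}. ?f j) \<noteq> 0"
      using sp s1 qnum_nz[OF p2] by (auto simp: qint_eq_qnum)
    ultimately show ?thesis
      using that assms by (simp only: d.col_def d.elt_a_eq scaleC_scaleC) (simp add: diff_less_mono)
  qed
  ultimately show ?thesis
    by (auto simp: gen_def mult_scaleC_left mult.assoc simp del: power_Suc)
qed

end

text \<open>The factor v multiplies a vector in position t - 1 by 2p, and F^(p-t-m) joins F^(t-1) to
  F^(p-m-1). Thus t disappears, and each summand becomes a multiple of E^j F^j w with j = p - m - 1,
  to which \<open>EF_powers\<close> applies.\<close>

lemma b0_mult:
  assumes t: "1 \<le> t" "t \<le> s" and w: "wt (rw \<alpha> (int s) 0) w" "nil \<alpha> (int s) (nil \<alpha> (int s) w) = 0"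
  shows "b0 t * (F ^ (t - 1) * w) = gam *\<^sub>C w + tail *\<^sub>C nil \<alpha> (int s) w"
proof -
  let ?P = "\<lambda>j. \<Prod>i<j. ee \<alpha> (int s) (int i + 1)"
  let ?N = "nil \<alpha> (int s) w"
  have vv: "vv p K \<alpha> s t * (F ^ (t - 1) * w) = of_nat (2 * p) *\<^sub>C (F ^ (t - 1) * w)"
    by (rule vv_mult) (use wt_F_power[OF w(1), of "t - 1"] t in \<open>simp add: of_nat_diff\<close>)
  have W: "W m t * (F ^ (t - 1) * w) =
      of_nat (2 * p) *\<^sub>C (?P (p - m - 1) *\<^sub>C w + EF_tail (int s) (p - m - 1) *\<^sub>C ?N)"
    if "m \<in> {1..p - s}" for m
  proof -
    have "p - t - m + (t - 1) = p - m - 1" using that t by auto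
    then have "W m t * (F ^ (t - 1) * w) = of_nat (2 * p) *\<^sub>C (E ^ (p - m - 1) * (F ^ (p - m - 1) * w))"
      unfolding W_def mult.assoc vv mult_scaleC_right by (metis mult.assoc power_add)
    then show ?thesis unfolding EF_powers[OF w] .
  qed
  have P0: "?P (p - m - 1) = 0" if "m \<in> {1..p - s} - {p - s}" for m
    by (rule prod_zero[of _ _]) (use that s1 in \<open>auto intro!: bexI[of _ "s - 1"] simp: of_nat_diff\<close>)
  have "b0 t * (F ^ (t - 1) * w) = (\<Sum>m\<in>{1..p - s}. mu p \<alpha> m s *\<^sub>C
      of_nat (2 * p) *\<^sub>C (?P (p - m - 1) *\<^sub>C w + EF_tail (int s) (p - m - 1) *\<^sub>C ?N))"
    unfolding b0_def sum_distrib_right mult_scaleC_left by (intro sum.cong refl) (simp only: W)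
  also have "\<dots> = (of_nat (2 * p) * (\<Sum>m\<in>{1..p - s}. mu p \<alpha> m s * ?P (p - m - 1))) *\<^sub>C w + tail *\<^sub>C ?N"
    unfolding tail_def
    by (simp add: scaleC_add_right scaleC_scaleC sum.distrib complex_vec.scale_sum_left sum_distrib_left
        mult_ac)
  also have "(\<Sum>m\<in>{1..p - s}. mu p \<alpha> m s * ?P (p - m - 1)) = mu p \<alpha> (p - s) s * ?P (s - 1)"
  proof -
    have "(\<Sum>m\<in>{1..p - s}. mu p \<alpha> m s * ?P (p - m - 1)) = (\<Sum>m\<in>{p - s}. mu p \<alpha> m s * ?P (p - m - 1))"
      by (rule sum.mono_neutral_right) (use sp P0 in auto)
    then show ?thesis using sp by simp
  qed
  finally show ?thesis
    by (simp add: gam_def mult.assoc)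
qed

lemma col_mult:
  assumes "1 \<le> t" "t \<le> s" "i < p" "wt (rw \<alpha> (int s) 0) w" "nil \<alpha> (int s) (nil \<alpha> (int s) w) = 0"
  shows "col t i e * (F ^ (t - 1) * w) = gam *\<^sub>C (gen i e * w) + tail *\<^sub>C (gen i e * nil \<alpha> (int s) w)"
  unfolding gen_b0[OF assms(1-3), symmetric] mult.assoc b0_mult[OF assms(1,2,4,5)]
  by (simp add: distrib_left mult_scaleC_right)

lemma col_col:
  assumes "1 \<le> t" "t \<le> s" "1 \<le> u" "u \<le> s" "i < p"
  shows "col t i e * col u (t - 1) f =
    (if f then if i < s \<and> \<not> e then gam *\<^sub>C col u i True else 0
     else gam *\<^sub>C col u i e + (if i < s \<and> \<not> e then tail *\<^sub>C col u i True else 0))"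
proof -
  have up: "u \<le> p" using assms sp by simp
  have "col u (t - 1) f = F ^ (t - 1) * (if f then A0 u else b0 u)"
    using assms by (simp add: col_def elt_a_eq elt_b_eq less_eq_Suc_le)
  then show ?thesis
    using col_mult[OF assms(1,2,5), of "if f then A0 u else b0 u" e]
      wt_a0[OF up] wt_b0[OF assms(3,4)] nil_a0[OF up] nil_b0[OF assms(3,4)]
      gen_b0[OF assms(3,4,5)] gen_a0[OF assms(3,4,5)]
    by auto
qed

text \<open>Row p - s + (t - 1) of the dual column has position t - 1 in the chain of this column,
  and it is F^(t-1) applied to x_0 or y_0. These lie in position 0 and are annihilated by N, so
  \<open>col_mult\<close> applies without its second term.\<close>

lemma col_dual:
  fixes u :: nat
  defines "dcol \<equiv> uq_column.col p E F K (- \<alpha>) (p - s) u"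
  assumes "1 \<le> t" "t \<le> s" "1 \<le> u" "u \<le> p - s" "i < p"
  shows "col t i e * dcol (p - s + (t - 1)) f =
    (if i < s then if e then 0 else gam *\<^sub>C dcol (p - s + i) f
     else if e = f then 0 else gam *\<^sub>C dcol (i - s) True)"
proof -
  interpret d: uq_column p E F K Ki "- \<alpha>" "p - s"
    by (rule dual)
  note u = assms(4,5)
  have k: "t - 1 < p - (p - s)" using assms sp by simp
  let ?w = "if f then F ^ (p - s) * d.b0 u else d.X u 0"
  have "d.col u (p - s + (t - 1)) f = F ^ (t - 1) * ?w"
    using k d.F_power_X_0[OF u k]
    by (auto simp: d.col_def d.elt_y_eq d.elt_x_eq[OF u] add.commute simp flip: mult.assoc power_add)
  moreover have "wt (rw \<alpha> (int s) 0) ?w"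
    using d.wt_X[OF u, of 0] d.wt_Y[OF u] rw_dual[of 0] sp s1 by auto
  moreover have "nil \<alpha> (int s) ?w = 0"
    using d.nil_X[OF u, of 0] d.nil_Y[OF u] by (auto simp: nil_dual)
  ultimately show ?thesis
    using col_mult[OF assms(2,3,6), of ?w e] gen_dual_X[OF u assms(6)] gen_dual_Y[OF u assms(6)]
    by (auto simp: dcol_def)
qed

lemma gam_eq: "gam = 2 * of_nat p * (\<Prod>m\<in>{1..p - s - 1}. - \<alpha> * qint p m * qint p (p - s - m))
    * (\<Prod>i\<in>{1..s - 1}. \<alpha> * qint p i * qint p (s - i))"
proof -
  have "mu p \<alpha> (p - s) s = (\<Prod>m\<in>{1..p - s - 1}. - \<alpha> * qint p m * qint p (p - s - m))"
    using sp by (simp add: mu_def)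
  moreover have "(\<Prod>i<s - 1. ee \<alpha> (int s) (int i + 1)) = (\<Prod>i\<in>{1..s - 1}. \<alpha> * qint p i * qint p (s - i))"
    by (rule prod.reindex_bij_witness[of _ "\<lambda>i. i - 1" Suc])
      (auto simp: ee_qint[symmetric] add.commute)
  ultimately show ?thesis
    by (simp add: gam_def)
qed

lemma gam_nz: "gam \<noteq> 0"
  using sp s1 qnum_nz[OF p2] by (auto simp: gam_eq qint_eq_qnum)

lemma col_K:
  assumes "1 \<le> t" "t \<le> s" "i < p"
  shows "col t i e * K = rw \<alpha> (int s) (int t - 1) *\<^sub>C col t i e"
  unfolding gen_b0[OF assms, symmetric] mult.assoc b0_K[OF assms(1,2)] by (rule mult_scaleC_right)

lemma wt_col:
  assumes "1 \<le> t" "t \<le> s" "i < p"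
  shows "wt (rw \<alpha> (int s) (int i)) (col t i e)"
  using wt_F_power[OF wt_a0[of t s], of i] wt_F_power[OF wt_b0[OF assms(1,2)], of i]
    wt_X[OF assms(1,2), of "i - s"] assms sp
  by (auto simp: col_def elt_a_eq elt_b_eq elt_y_eq elt_x_eq)

lemma nil_nil_col:
  assumes "1 \<le> t" "t \<le> s"
  shows "nil \<alpha> (int s) (nil \<alpha> (int s) (col t i e)) = 0"
  using assms sp nil_a0[of t s]
  by (auto simp: col_def elt_a_eq elt_b_eq elt_y_eq elt_x_eq nil_F_power nil_b0 nil_X)

end

context uq_column
begin

text \<open>\<kappa> stands for the quotient of \<delta>_s by \<gamma>_s and is left arbitrary: the
  form of the multiplication table is the same for every value, provided that both signs use the
  same one.\<close>

definition ncol :: "complex \<Rightarrow> nat \<Rightarrow> nat \<Rightarrow> bool \<Rightarrow> 'a"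
  where "ncol \<kappa> t i e =
    (1 / gam) *\<^sub>C (col t i e - (if i < s \<and> \<not> e then \<kappa> *\<^sub>C col t i True else 0))"

lemma ncol_ncol:
  assumes "1 \<le> t" "t \<le> s" "1 \<le> u" "u \<le> s" "i < p"
  shows "ncol \<kappa> t i e * ncol \<kappa> u (t - 1) f =
    (if f then if i < s \<and> \<not> e then ncol \<kappa> u i True else 0
     else ncol \<kappa> u i e + (if i < s \<and> \<not> e then (tail / gam - \<kappa>) *\<^sub>C ncol \<kappa> u i True else 0))"
proof -
  have t: "t - 1 < s" using assms by simp
  note cc = col_col[OF assms]
  \<comment> \<open>The product of two corrected b contains a three times: from \<open>tail\<close>
    and from the two mixed products. One of the two \<kappa> is the correction that the resulting B
    carries itself, and the rest is the excess.\<close>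
  have coef: "(tail / gam - \<kappa>) * (1 / gam) - \<kappa> / gam = (tail - \<kappa> * gam - \<kappa> * gam) / gam\<^sup>2"
    using gam_nz by (simp add: field_simps power2_eq_square)
  have g: "1 / gam\<^sup>2 * gam = 1 / gam" "gam / gam\<^sup>2 = 1 / gam"
    using gam_nz by (simp_all add: power2_eq_square)
  have prod: "ncol \<kappa> t i e * ncol \<kappa> u (t - 1) f = (1 / gam\<^sup>2) *\<^sub>C
    ((col t i e - (if i < s \<and> \<not> e then \<kappa> *\<^sub>C col t i True else 0)) *
     (col u (t - 1) f - (if \<not> f then \<kappa> *\<^sub>C col u (t - 1) True else 0)))"
    using t by (simp add: ncol_def mult_scaleC_left mult_scaleC_right scaleC_scaleC power2_eq_square)
  show ?thesis
  proof (cases "i < s \<and> \<not> e")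
    case True
    show ?thesis
    proof (cases f)
      case True
      then show ?thesis
        using \<open>i < s \<and> \<not> e\<close> unfolding prod
        by (simp add: left_diff_distrib mult_scaleC_left cc ncol_def scaleC_scaleC g del: One_nat_def)
    next
      case False
      have "ncol \<kappa> t i e * ncol \<kappa> u (t - 1) f = (1 / gam\<^sup>2) *\<^sub>C
        (gam *\<^sub>C col u i False + (tail *\<^sub>C col u i True - (\<kappa> * gam) *\<^sub>C col u i True
          - (\<kappa> * gam) *\<^sub>C col u i True))"
        using True False unfolding prod
        by (simp add: left_diff_distrib right_diff_distrib mult_scaleC_left mult_scaleC_right cc
            scaleC_scaleC complex_vec.scale_left_diff_distrib del: One_nat_def)
      also have "\<dots> = (1 / gam) *\<^sub>C col u i False
          + ((tail / gam - \<kappa>) * (1 / gam) - \<kappa> / gam) *\<^sub>C col u i True"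
        unfolding coef complex_vec.scale_left_diff_distrib[symmetric]
        by (simp only: scaleC_add_right scaleC_scaleC g) (simp add: mult.commute)
      also have "\<dots> = ncol \<kappa> u i False + (tail / gam - \<kappa>) *\<^sub>C ncol \<kappa> u i True"
        using True by (simp add: ncol_def complex_vec.scale_left_diff_distrib scaleC_scaleC
            complex_vec.scale_right_diff_distrib)
      finally show ?thesis using True False by simp
    qed
  next
    case False
    then have "\<not> (i < s \<and> \<not> e)" "\<And>u. ncol \<kappa> u i e = (1 / gam) *\<^sub>C col u i e"
      by (auto simp: ncol_def)
    then show ?thesis
      unfolding prod using False
      by (auto simp: right_diff_distrib mult_scaleC_right cc scaleC_scaleC g simp del: One_nat_def)
  qed
qed

text \<open>The correction by \<kappa> leaves no trace: an element a times an x or y of the dual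
  column is 0, and the rows of the dual column that occur carry no correction.\<close>

lemma ncol_dual:
  fixes u :: nat and \<kappa> :: complex
  defines "dcol \<equiv> uq_column.ncol p E F K (- \<alpha>) (p - s) \<kappa> u"
  assumes "1 \<le> t" "t \<le> s" "1 \<le> u" "u \<le> p - s" "i < p"
  shows "ncol \<kappa> t i e * dcol (p - s + (t - 1)) f =
    (if i < s then if e then 0 else dcol (p - s + i) f
     else if e = f then 0 else dcol (i - s) True)"
proof -
  interpret d: uq_column p E F K Ki "- \<alpha>" "p - s"
    by (rule dual)
  have gam: "d.gam = gam"
    using sp by (simp add: gam_eq d.gam_eq)
  have "1 / gam\<^sup>2 * gam = 1 / gam"
    using gam_nz by (simp add: power2_eq_square)
  moreover have "1 / (gam * gam) * gam = 1 / gam"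
    using gam_nz by simp
  moreover note cd = col_dual[OF assms(2-6)]
  ultimately show ?thesis
    unfolding dcol_def
    by (auto simp: ncol_def d.ncol_def gam mult_scaleC_left mult_scaleC_right scaleC_scaleC
        left_diff_distrib cd)
qed

lemma ncol_K:
  assumes "1 \<le> t" "t \<le> s" "i < p"
  shows "ncol \<kappa> t i e * K = rw \<alpha> (int s) (int t - 1) *\<^sub>C ncol \<kappa> t i e"
  by (auto simp: ncol_def mult_scaleC_left left_diff_distrib col_K[OF assms] scaleC_scaleC
      complex_vec.scale_right_diff_distrib mult.commute mult.left_commute)

lemma wt_ncol:
  assumes "1 \<le> t" "t \<le> s" "i < p"
  shows "wt (rw \<alpha> (int s) (int i)) (ncol \<kappa> t i e)"
  using wt_col[OF assms] unfolding ncol_def by (auto intro!: wt_scale wt_diff wt_0)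

lemma nil_nil_ncol:
  assumes "1 \<le> t" "t \<le> s"
  shows "nil \<alpha> (int s) (nil \<alpha> (int s) (ncol \<kappa> t i e)) = 0"
  by (simp add: ncol_def nil_scale nil_diff nil_nil_col[OF assms])

lemma ncol_nz:
  assumes "1 \<le> t" "t \<le> s"
  shows "ncol \<kappa> t 0 True \<noteq> 0"
  using a0_nz[OF assms(1), of s] s1 gam_nz by (simp add: ncol_def col_def elt_a_eq)

end

section \<open>Matrix units in the blocks Q_p and Q_0\<close>

context uq_chain
begin

lemma simple_A_eq:
  "simple_A p E F K \<alpha> i t =
    (1 / (2 * of_nat p * (\<Prod>i\<in>{1..p - 1}. \<alpha> * qint p i * qint p (p - i)))) *\<^sub>C (F ^ i * a0 p t)"
  by (simp add: simple_A_def elt_a_eq)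

text \<open>For s = p the constants e_1, ..., e_(p-1) are all nonzero, so E^(p-1) F^(p-1) acts on
  the highest weight vector a_0 by an invertible scalar. The normalising factor is this scalar times
  the 2p contributed by v.\<close>

lemma simple_A_mult:
  assumes "1 \<le> t" "t \<le> p" "1 \<le> u" "u \<le> p"
  shows "simple_A p E F K \<alpha> i t * simple_A p E F K \<alpha> (t - 1) u = simple_A p E F K \<alpha> i u"
proof -
  let ?c = "2 * of_nat p * (\<Prod>i\<in>{1..p - 1}. \<alpha> * qint p i * qint p (p - i))"
  have c: "?c \<noteq> 0"
    using qnum_nz[OF p2] by (auto simp: qint_eq_qnum)
  have P: "(\<Prod>i<p - 1. ee \<alpha> (int p) (int i + 1)) = (\<Prod>i\<in>{1..p - 1}. \<alpha> * qint p i * qint p (p - i))"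
    by (rule prod.reindex_bij_witness[of _ "\<lambda>i. i - 1" Suc])
      (auto simp: ee_def qint_eq_qnum of_nat_diff add.commute)
  have "a0 p t * (F ^ (t - 1) * a0 p u) =
      of_nat (2 * p) *\<^sub>C (E ^ (p - 1) * (F ^ (p - t) * (F ^ (t - 1) * a0 p u)))"
  proof -
    have "vv p K \<alpha> p t * (F ^ (t - 1) * a0 p u) = of_nat (2 * p) *\<^sub>C (F ^ (t - 1) * a0 p u)"
      by (rule vv_mult) (use wt_F_power[OF wt_a0[OF assms(4), of p], of "t - 1"] assms in
          \<open>simp add: of_nat_diff\<close>)
    then show ?thesis
      by (simp only: a0_def[of p t] mult.assoc mult_scaleC_right)
  qed
  also have "F ^ (p - t) * (F ^ (t - 1) * a0 p u) = F ^ (p - 1) * a0 p u"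
    using assms by (simp flip: mult.assoc power_add)
  also have "E ^ (p - 1) * (F ^ (p - 1) * a0 p u) = (\<Prod>i<p - 1. ee \<alpha> (int p) (int i + 1)) *\<^sub>C a0 p u"
    using EF_powers[OF wt_a0[OF assms(4)], of p "p - 1"] nil_a0[OF assms(4), of p] by simp
  finally have "a0 p t * (F ^ (t - 1) * a0 p u) = ?c *\<^sub>C a0 p u"
    unfolding P by (simp add: scaleC_scaleC)
  then have "(F ^ i * a0 p t) * (F ^ (t - 1) * a0 p u) = ?c *\<^sub>C (F ^ i * a0 p u)"
    by (simp only: mult.assoc mult_scaleC_right)
  then show ?thesis
    unfolding simple_A_eq mult_scaleC_left mult_scaleC_right scaleC_scaleC using c by simp
qed

lemma simple_A_K: "simple_A p E F K \<alpha> i t * K = rw \<alpha> (int p) (int t - 1) *\<^sub>C simple_A p E F K \<alpha> i t"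
  by (simp add: simple_A_eq mult_scaleC_left mult.assoc a0_K mult_scaleC_right scaleC_scaleC mult.commute)

lemma wt_simple_A:
  assumes "t \<le> p"
  shows "wt (rw \<alpha> (int p) (int i)) (simple_A p E F K \<alpha> i t)"
  using wt_F_power[OF wt_a0[OF assms, of p], of i] by (simp add: simple_A_eq wt_scale)

lemma nil_simple_A:
  assumes "t \<le> p"
  shows "nil \<alpha> (int p) (simple_A p E F K \<alpha> i t) = 0"
  by (simp add: simple_A_eq nil_scale nil_F_power nil_a0[OF assms])

lemma simple_A_nz:
  assumes "1 \<le> t"
  shows "simple_A p E F K \<alpha> 0 t \<noteq> 0"
  using a0_nz[OF assms, of p] qnum_nz[OF p2] by (auto simp: simple_A_eq qint_eq_qnum)

end

section \<open>Uniform description of the block bases\<close>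

context uq
begin

lemma plus_column: "1 \<le> s \<Longrightarrow> s < p \<Longrightarrow> uq_column p E F K Ki 1 s"
  and minus_column: "1 \<le> s \<Longrightarrow> s < p \<Longrightarrow> uq_column p E F K Ki (- 1) (p - s)"
  and plus_chain: "uq_chain p E F K Ki 1" and minus_chain: "uq_chain p E F K Ki (- 1)"
  by unfold_locales auto

text \<open>In \<open>Z s i j e\<close> rows and columns are numbered by \<open>i, j < p\<close> along the weights
  \<open>q\<^bsup>s-1-2i\<^esup>\<close>: indices below \<open>s\<close> belong to the sign \<open>+\<close>, the others to the sign \<open>-\<close>.\<close>

definition Z :: "nat \<Rightarrow> nat \<Rightarrow> nat \<Rightarrow> bool \<Rightarrow> 'a"
  where "Z s i j e =
    (if s = p then simple_A p E F K 1 i (j + 1)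
     else if s = 0 then simple_A p E F K (- 1) i (j + 1)
     else if j < s then
       if i < s then if e then Aplus p E F K s i (j + 1) else Bplus p E F K s i (j + 1)
       else if e then Yplus p E F K s (i - s) (j + 1) else Xplus p E F K s (i - s) (j + 1)
     else
       if i < s then if e then Yminus p E F K s i (j - s + 1) else Xminus p E F K s i (j - s + 1)
       else if e then Aminus p E F K s (i - s) (j - s + 1) else Bminus p E F K s (i - s) (j - s + 1))"

text \<open>The coefficient of A left over in B B. All that symmetric functions will require of it
  is that it depends on i only through the sign.\<close>

definition rho :: "nat \<Rightarrow> nat \<Rightarrow> complex"
  where "rho s i =
    (if i < s then uq_column.tail p 1 s / uq_column.gam p 1 s
     else uq_column.tail p (- 1) (p - s) / uq_column.gam p (- 1) (p - s)) - delta_s p s / gamma_s p s"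

context
  fixes s :: nat
  assumes s1: "1 \<le> s" and sp: "s < p"
begin

interpretation P: uq_column p E F K Ki 1 s by (rule plus_column[OF s1 sp])
interpretation M: uq_column p E F K Ki "- 1" "p - s" by (rule minus_column[OF s1 sp])

text \<open>Position i of the chain of sign + is row i - s, taken modulo p, of a column of sign
  -.\<close>

definition flip :: "nat \<Rightarrow> nat"
  where "flip i = (if i < s then p - s + i else i - s)"

lemma flip_less: "i < p \<Longrightarrow> flip i < p"
  using s1 sp by (auto simp: flip_def)

text \<open>Passing from (1, s) to (-1, p - s) merely exchanges the two products in
  \<open>gam_eq\<close>, so one normaliser serves both signs.\<close>

lemma gamma_P: "P.gam = gamma_s p s" and gamma_M: "M.gam = gamma_s p s"
  using sp by (simp_all add: P.gam_eq M.gam_eq gamma_s_def mult.commute mult.left_commute mult.assoc)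

lemma Z_plus:
  assumes "j < s"
  shows "Z s i j e = P.ncol (delta_s p s / gamma_s p s) (j + 1) i e"
  using assms s1 sp
  by (auto simp: Z_def P.ncol_def P.col_def gamma_P Aplus_def Bplus_def Xplus_def Yplus_def)

lemma Z_minus:
  assumes "\<not> j < s" "i < p"
  shows "Z s i j e = M.ncol (delta_s p s / gamma_s p s) (j - s + 1) (flip i) e"
  using assms s1 sp
  by (auto simp: Z_def diff_less_mono M.ncol_def M.col_def gamma_M flip_def Aminus_def Bminus_def Xminus_def Yminus_def)

text \<open>Indices on the same side of s belong to B and A, indices on different sides to X and Y;
  thus \<open>e = f\<close> in the last case is X X or Y Y. The sides of j and k decide which of
  \<open>ncol_ncol\<close> and \<open>ncol_dual\<close> applies, and for which sign.\<close>

lemma Z_mult: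
  assumes i: "i < p" and j: "j < p" and k: "k < p"
  shows "Z s i j e * Z s j k f =
    (if (i < s) = (j < s) then
       if (j < s) = (k < s) then
         if f then if e then 0 else Z s i k True
         else Z s i k e + (if e then 0 else rho s i *\<^sub>C Z s i k True)
       else if e then 0 else Z s i k f
     else
       if (j < s) = (k < s) then if f then 0 else Z s i k e
       else if e = f then 0 else Z s i k True)"
proof (cases "j < s")
  case True
  show ?thesis
  proof (cases "k < s")
    case k: True
    show ?thesis
      using P.ncol_ncol[of "j + 1" "k + 1" i "delta_s p s / gamma_s p s" e f] True k i
      by (auto simp: Z_plus rho_def)
  next
    case k': False
    show ?thesis
      using P.ncol_dual[of "j + 1" "k - s + 1" i "delta_s p s / gamma_s p s" e f] True k k' i
      by (auto simp: Z_plus Z_minus flip_def i)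
  qed
next
  case False
  have s: "p - (p - s) = s" using sp by simp
  have i': "flip i < p - s \<longleftrightarrow> \<not> i < s"
    using i by (auto simp: flip_def)
  have f: "s + flip i = i" if "\<not> i < s"
    using that by (simp add: flip_def)
  have f': "flip i + s - p = i" if "i < s"
    using that sp by (simp add: flip_def)
  have j': "flip j = j - s + 1 - 1" "s + (j - s + 1 - 1) = j"
    using False by (simp_all add: flip_def)
  have jp: "j - s + 1 \<le> p - s"
    using False j by simp
  show ?thesis
  proof (cases "k < s")
    case k': True
    show ?thesis
      using M.ncol_dual[of "j - s + 1" "k + 1" "flip i" "delta_s p s / gamma_s p s" e f,
          unfolded s minus_minus] False jp k' flip_less[OF i]
      by (auto simp: Z_plus Z_minus i i' f f' j'(2)[simplified])
  next
    case k': False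
    then have kp: "k - s + 1 \<le> p - s"
      using k by simp
    show ?thesis
      using M.ncol_ncol[of "j - s + 1" "k - s + 1" "flip i" "delta_s p s / gamma_s p s" e f]
        False jp kp k' flip_less[OF i]
      by (auto simp: Z_minus i j rho_def i' j'(1)[symmetric, simplified])
  qed
qed

end

end

section \<open>Independence of the block bases\<close>

context vector_space
begin

lemma independent_family:
  assumes "finite I" and ind: "\<And>c. (\<Sum>x\<in>I. scale (c x) (f x)) = 0 \<Longrightarrow> \<forall>x\<in>I. c x = 0"
  shows "inj_on f I" "independent (f ` I)"
proof -
  show inj: "inj_on f I"
  proof (rule inj_onI, rule ccontr)
    fix x y assume xy: "x \<in> I" "y \<in> I" "f x = f y" "x \<noteq> y"
    define c :: "'c \<Rightarrow> 'a" where "c z = (if z = x then 1 else if z = y then - 1 else 0)" for z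
    have "(\<Sum>z\<in>I. scale (c z) (f z)) = (\<Sum>z\<in>{x, y}. scale (c z) (f z))"
      by (rule sum.mono_neutral_right) (use assms(1) xy in \<open>auto simp: c_def\<close>)
    also have "\<dots> = 0" using xy by (simp add: c_def)
    finally show False using ind[of c] xy by (auto simp: c_def)
  qed
  show "independent (f ` I)"
  proof (rule independent_if_scalars_zero)
    fix u x assume u: "(\<Sum>x\<in>f ` I. scale (u x) x) = 0" and x: "x \<in> f ` I"
    have "(\<Sum>x\<in>I. scale (u (f x)) (f x)) = 0"
      using u by (simp add: sum.reindex[OF inj])
    then show "u x = 0" using ind[of "u \<circ> f"] x by auto
  qed (use assms(1) in simp)
qed

context
  fixes T :: "'b \<Rightarrow> 'b"
begin

definition eig :: "'a \<Rightarrow> 'b \<Rightarrow> 'b"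
  where "eig a y = T y - scale a y"

context
  assumes T_add: "\<And>x y. T (x + y) = T x + T y" and T_scale: "\<And>c x. T (scale c x) = scale c (T x)"
begin

lemma T_diff: "T (x - y) = T x - T y"
  using T_add[of "x - y" y] by (metis add_diff_cancel_right' diff_add_cancel)

lemma eig_0: "eig a 0 = 0"
  using T_diff[of 0 0] by (simp add: eig_def)

lemma eig_add: "eig a (x + y) = eig a x + eig a y"
  by (simp add: eig_def T_add scale_right_distrib)

lemma eig_scale: "eig a (scale c x) = scale c (eig a x)"
  by (simp add: eig_def T_scale scale_right_diff_distrib scale_left_commute)

lemma eig_commute: "eig a (eig b x) = eig b (eig a x)"
  by (simp add: eig_def T_diff T_scale scale_right_diff_distrib scale_left_commute)

lemma eig_funpow_0: "(eig a ^^ n) 0 = 0"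
  by (induction n) (simp_all add: eig_0)

lemma eig_funpow_add: "(eig a ^^ n) (x + y) = (eig a ^^ n) x + (eig a ^^ n) y"
  by (induction n) (simp_all add: eig_add)

lemma eig_funpow_scale: "(eig a ^^ n) (scale c x) = scale c ((eig a ^^ n) x)"
  by (induction n) (simp_all add: eig_scale)

lemma eig_funpow_sum: "(eig a ^^ n) (sum g A) = (\<Sum>x\<in>A. (eig a ^^ n) (g x))"
  by (induction A rule: infinite_finite_induct) (simp_all add: eig_funpow_0 eig_funpow_add)

lemma eig_funpow_commute: "(eig a ^^ n) ((eig b ^^ m) x) = (eig b ^^ m) ((eig a ^^ n) x)"
proof -
  have *: "eig b ((eig a ^^ n) x) = (eig a ^^ n) (eig b x)" for x
    by (induction n) (simp, metis comp_apply eig_commute funpow.simps(2))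
  show ?thesis
    by (induction m) (simp_all flip: *)
qed

text \<open>y = (T - a)^n x is an eigenvector for a if one more factor kills x, and T - b multiplies
  it by a - b, which is nonzero. Hence y = 0 and the exponent drops by one.\<close>

lemma eig_disjoint:
  assumes "(eig a ^^ n) x = 0" "(eig b ^^ m) x = 0" "a \<noteq> b"
  shows "x = 0"
  using assms(1)
proof (induction n)
  case (Suc n)
  let ?y = "(eig a ^^ n) x"
  have "(eig b ^^ m) ?y = 0"
    by (subst eig_funpow_commute) (simp add: assms(2) eig_funpow_0)
  moreover have "eig a ?y = 0"
    using Suc.prems by simp
  then have "eig b ?y = scale (a - b) ?y"
    unfolding eig_def[of a ?y] eig_def[of b ?y] by (simp add: scale_left_diff_distrib)
  then have "(eig b ^^ k) ?y = scale ((a - b) ^ k) ?y" for k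
    by (induction k) (simp_all add: eig_scale mult.commute)
  ultimately show ?case
    using assms(3) Suc.IH by simp
qed simp

text \<open>A power of T - l(a) kills the summand of a and keeps the others in their generalized
  eigenspaces, so by induction it kills them too. They then lie in generalized eigenspaces for two
  different eigenvalues.\<close>

lemma eig_independent:
  assumes "finite J" "inj_on l J" "\<And>j. j \<in> J \<Longrightarrow> \<exists>n. (eig (l j) ^^ n) (g j) = 0"
    and "(\<Sum>j\<in>J. g j) = 0"
  shows "\<forall>j\<in>J. g j = 0"
  using assms
proof (induction J arbitrary: g)
  case (insert a J)
  obtain n where n: "(eig (l a) ^^ n) (g a) = 0"
    using insert.prems(2) by blast
  let ?h = "\<lambda>j. (eig (l a) ^^ n) (g j)"
  have "(\<Sum>j\<in>J. ?h j) = (eig (l a) ^^ n) (\<Sum>j\<in>insert a J. g j)"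
    using insert.hyps n by (simp add: eig_funpow_sum eig_funpow_add)
  then have sum0: "(\<Sum>j\<in>J. ?h j) = 0"
    using insert.prems(3) by (simp add: eig_funpow_0)
  have "\<forall>j\<in>J. ?h j = 0"
  proof (rule insert.IH[OF _ _ sum0])
    show "inj_on l J" using insert.prems(1) by simp
    fix j assume "j \<in> J"
    then obtain m where "(eig (l j) ^^ m) (g j) = 0" using insert.prems(2) by blast
    then have "(eig (l j) ^^ m) (?h j) = 0"
      by (subst eig_funpow_commute) (simp add: eig_funpow_0)
    then show "\<exists>n. (eig (l j) ^^ n) (?h j) = 0" ..
  qed
  then have "\<forall>j\<in>J. g j = 0"
  proof (intro ballI)
    fix j assume *: "\<forall>j\<in>J. ?h j = 0" "j \<in> J"
    obtain m where "(eig (l j) ^^ m) (g j) = 0" using insert.prems(2) * by blast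
    moreover have "l a \<noteq> l j"
      using * insert.prems(1) insert.hyps by (auto simp: inj_on_def)
    ultimately show "g j = 0" using * eig_disjoint by blast
  qed
  then show ?case using insert.prems(3) insert.hyps by simp
qed simp

lemma eig_generalized_diff:
  assumes "(eig a ^^ n) x = 0" "(eig a ^^ m) y = 0"
  shows "\<exists>k. (eig a ^^ k) (x - y) = 0"
proof
  have "(eig a ^^ (m + n)) x = 0"
    using assms(1) by (simp add: funpow_add eig_funpow_0)
  moreover have "(eig a ^^ (n + m)) y = 0"
    using assms(2) by (simp add: funpow_add eig_funpow_0)
  ultimately show "(eig a ^^ (m + n)) (x - y) = 0"
    using eig_funpow_add[where x = x and y = "scale (- 1) y"] eig_funpow_scale[where c = "- 1" and x = y]
    by (simp add: add.commute)
qed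

end

end

end

section \<open>Weights and Casimir eigenvalues of the basis elements\<close>

context uq
begin

definition zw :: "nat \<Rightarrow> nat \<Rightarrow> complex"
  where "zw s i = q powi (int s - 1 - 2 * int i)"

definition flags :: "nat \<Rightarrow> bool set"
  where "flags s = (if 1 \<le> s \<and> s < p then UNIV else {False})"

lemma zw_nz: "zw s i \<noteq> 0"
  by (simp add: zw_def)

lemma zw_inj: "inj_on (zw s) {..<p}"
proof (rule inj_onI)
  fix i j assume ij: "i \<in> {..<p}" "j \<in> {..<p}" "zw s i = zw s j"
  have "zw s i = zw s j * q powi (2 * (int j - int i))"
    by (simp add: zw_def algebra_simps flip: power_int_add)
  then have "q powi (2 * (int j - int i)) = 1"
    using ij zw_nz by simp
  then have "int p dvd int j - int i"
    by (simp only: qroot_powi_eq_1_iff[OF p_pos] dvd_mult_cancel_left) simp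
  then show "i = j"
    using ij zdvd_not_zless[of "int j - int i" "int p"] zdvd_not_zless[of "int i - int j" "int p"]
      dvd_diff_commute[of "int p" "int i" "int j"] by (cases i j rule: linorder_cases) auto
qed

text \<open>The parameters (-1, p) of Q_0 give the same weights as the formal parameters (1, 0), and
  by \<open>nil_minus_p\<close> the same eigenvalue. So the formulas in s cover the block s = 0 as
  well.\<close>

lemma rw_minus_p: "rw (- 1) (int p) i = rw 1 0 i"
proof -
  have "q powi (int p - 1 - 2 * i) = q powi (int p) * q powi (0 - 1 - 2 * i)"
    by (subst power_int_add[symmetric]) (simp_all add: algebra_simps)
  then show ?thesis
    by (simp add: rw_def qroot_powi_p del: power_int_of_nat)
qed

lemma nil_minus_p: "nil (- 1) (int p) z = nil 1 0 z"
  by (simp add: nil_def zeta_def power_int_minus qroot_powi_p del: power_int_of_nat)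

lemma Z_weights:
  assumes "s \<le> p" "i < p" "j < p"
  shows "wt (zw s i) (Z s i j e)" "Z s i j e * K = zw s j *\<^sub>C Z s i j e"
    "nil 1 (int s) (nil 1 (int s) (Z s i j e)) = 0"
proof -
  consider "s = p" | "s = 0" | "1 \<le> s" "s < p"
    using assms p_pos by linarith
  then have "wt (zw s i) (Z s i j e) \<and> Z s i j e * K = zw s j *\<^sub>C Z s i j e \<and>
    nil 1 (int s) (nil 1 (int s) (Z s i j e)) = 0"
  proof cases
    case 1
    interpret uq_chain p E F K Ki 1 by (rule plus_chain)
    have "zw p i = rw 1 (int p) (int i)" "zw p j = rw 1 (int p) (int (j + 1) - 1)"
      by (simp_all add: zw_def rw_def)
    then show ?thesis
      using 1 wt_simple_A[of "j + 1" i] simple_A_K[of i "j + 1"] nil_simple_A[of "j + 1" i] assms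
      by (simp add: Z_def)
  next
    case 2
    interpret uq_chain p E F K Ki "- 1" by (rule minus_chain)
    have "zw 0 i = rw (- 1) (int p) (int i)" "zw 0 j = rw (- 1) (int p) (int (j + 1) - 1)"
      unfolding rw_minus_p by (simp_all add: zw_def rw_def)
    then show ?thesis
      using 2 wt_simple_A[of "j + 1" i] simple_A_K[of i "j + 1"] nil_simple_A[of "j + 1" i] assms
      by (simp add: Z_def nil_minus_p)
  next
    case 3
    interpret P: uq_column p E F K Ki 1 s by (rule plus_column[OF 3])
    interpret M: uq_column p E F K Ki "- 1" "p - s" by (rule minus_column[OF 3])
    show ?thesis
    proof (cases "j < s")
      case True
      have w: "zw s i = rw 1 (int s) (int i)" "zw s j = rw 1 (int s) (int (j + 1) - 1)"
        by (simp_all add: zw_def rw_def)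
      have t: "1 \<le> j + 1" "j + 1 \<le> s"
        using True by simp_all
      show ?thesis
        unfolding Z_plus[OF 3 True] w
        using P.wt_ncol[OF t assms(2)] P.ncol_K[OF t assms(2)] P.nil_nil_ncol[OF t] by simp
    next
      case False
      \<comment> \<open>Rows k - s and p - s + k of the chain of sign - differ by p and have equal
        weights; the latter is position k of the chain of sign +.\<close>
      have period: "rw (- 1) (int (p - s)) (k - int s) = zw s (nat k)" if "k \<ge> 0" for k
      proof -
        have "rw (- 1) (int (p - s)) (k - int s) = rw (- 1) (int (p - s)) (int (p - s) + k)"
          unfolding rw_def
          by (intro arg_cong[where f = "(*) (- 1)"] qroot_powi_cong) (use 3 in \<open>auto simp: of_nat_diff\<close>)
        also have "\<dots> = rw 1 (int s) k" by (rule P.rw_dual)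
        finally show ?thesis using that by (simp add: zw_def rw_def)
      qed
      have f: "zw s i = rw (- 1) (int (p - s)) (int (flip s i))"
      proof (cases "i < s")
        case True
        have "zw s i = rw 1 (int s) (int i)"
          by (simp add: zw_def rw_def)
        also have "\<dots> = rw (- 1) (int (p - s)) (int (p - s) + int i)"
          by (rule P.rw_dual[symmetric])
        finally show ?thesis
          by (simp only: flip_def[OF 3] True if_True of_nat_add)
      next
        case False
        then show ?thesis
          using period[of "int i"] by (simp add: flip_def[OF 3] of_nat_diff)
      qed
      have "zw s j = rw (- 1) (int (p - s)) (int (j - s + 1) - 1)"
        using period[of "int j"] False by (simp add: of_nat_diff)
      moreover have "1 \<le> j - s + 1" "j - s + 1 \<le> p - s"
        using False assms by simp_all
      note t = this flip_less[OF 3 assms(2)]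
      ultimately show ?thesis
        unfolding Z_minus[OF 3 False assms(2)] P.nil_dual[symmetric] f
        using M.wt_ncol[OF t] M.ncol_K[OF t] M.nil_nil_ncol[OF t(1,2)] by simp
    qed
  qed
  then show "wt (zw s i) (Z s i j e)" "Z s i j e * K = zw s j *\<^sub>C Z s i j e"
    "nil 1 (int s) (nil 1 (int s) (Z s i j e)) = 0" by auto
qed

lemma Z_mult_simple:
  assumes "s = 0 \<or> s = p" "i < p" "j < p" "k < p"
  shows "Z s i j e * Z s j k f = Z s i k g"
proof -
  have "simple_A p E F K \<alpha> i (j + 1) * simple_A p E F K \<alpha> j (k + 1) = simple_A p E F K \<alpha> i (k + 1)"
    if "uq_chain p E F K Ki \<alpha>" for \<alpha>
    using uq_chain.simple_A_mult[OF that, of "j + 1" "k + 1" i] assms by simp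
  then show ?thesis
    using assms(1) plus_chain minus_chain p_pos unfolding Z_def by auto
qed

text \<open>A K inserted between the factors can be absorbed on either side, with different
  scalars.\<close>

lemma Z_mult_0:
  assumes "s \<le> p" "i < p" "j < p" "j' < p" "k < p" "j \<noteq> j'"
  shows "Z s i j e * Z s j' k f = 0"
proof -
  have "zw s j *\<^sub>C (Z s i j e * Z s j' k f) = Z s i j e * K * Z s j' k f"
    using Z_weights(2)[of s i j e] assms by (simp add: mult_scaleC_left)
  also have "\<dots> = zw s j' *\<^sub>C (Z s i j e * Z s j' k f)"
    using Z_weights(1)[of s j' k f] assms by (simp add: wt_def mult.assoc mult_scaleC_right)
  finally have "zw s j = zw s j' \<or> Z s i j e * Z s j' k f = 0"
    by simp
  then show ?thesis
    using inj_onD[OF zw_inj, of s j j'] assms by auto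
qed

lemma zeta_1: "zeta 1 (int s) = casimir_eigenvalue p s"
  by (simp add: zeta_def casimir_eigenvalue_def)

lemma casimir_eigenvalue_inj: "inj_on (casimir_eigenvalue p) {..p}"
proof (rule inj_onI)
  fix s t assume st: "s \<in> {..p}" "t \<in> {..p}" "casimir_eigenvalue p s = casimir_eigenvalue p t"
  have eq: "q powi int s + q powi (- int s) = q powi int t + q powi (- int t)"
    using st D_nz by (simp add: casimir_eigenvalue_def)
  \<comment> \<open>The difference of two values q^a + q^(-a) factors, so they agree only if q^(a-b)
    = 1 or q^(a+b) = 1.\<close>
  have "(q powi (a - b) - 1) * (q powi (a + b) - 1) * q powi (- a) =
      q powi a + q powi (- a) - (q powi b + q powi (- b))" for a b
    by (simp add: left_diff_distrib right_diff_distrib flip: power_int_add)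
  from this[of "int s" "int t"] have "q powi (int s - int t) = 1 \<or> q powi (int s + int t) = 1"
    unfolding eq by simp
  then have dvd: "2 * int p dvd int s - int t \<or> 2 * int p dvd int s + int t"
    by (simp only: qroot_powi_eq_1_iff[OF p_pos])
  show "s = t"
  proof (rule ccontr)
    assume ne: "s \<noteq> t"
    with st have "\<not> 2 * int p dvd int s + int t"
      by (intro zdvd_not_zless) auto
    moreover have "\<not> 2 * int p dvd int s - int t"
    proof (cases "s < t")
      case True
      then have "\<not> 2 * int p dvd int t - int s"
        using st p_pos by (intro zdvd_not_zless) auto
      then show ?thesis by (simp add: dvd_diff_commute)
    next
      case False
      then show ?thesis
        using st p_pos ne by (intro zdvd_not_zless) auto
    qed
    ultimately show False using dvd by blast
  qed
qed

end

section \<open>Nonvanishing and linear independence\<close>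

context uq
begin

text \<open>Multiplying A_ii from the left by a suitable B moves it to row 0, or to row s for the
  sign -. There it is a multiple of a_0.\<close>

lemma Z_diag_nz:
  assumes s: "1 \<le> s" "s < p" and i: "i < p"
  shows "Z s i i True \<noteq> 0"
proof (cases "i < s")
  case True
  have "Z s 0 i True \<noteq> 0"
    unfolding Z_plus[OF s True]
    by (rule uq_column.ncol_nz[OF plus_column[OF s]]) (use True in auto)
  moreover have "Z s 0 i False * Z s i i True = Z s 0 i True"
    using Z_mult[OF s, of 0 i i False True] True i s by simp
  ultimately show ?thesis by auto
next
  case False
  have "Z s s i True = uq_column.ncol p E F K (- 1) (p - s) (delta_s p s / gamma_s p s) (i - s + 1) 0 True"
    using Z_minus[OF s False s(2)] by (simp add: flip_def[OF s])
  then have "Z s s i True \<noteq> 0"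
    using uq_column.ncol_nz[OF minus_column[OF s], of "i - s + 1"] False i by simp
  moreover have "Z s s i False * Z s i i True = Z s s i True"
    using Z_mult[OF s, of s i i False True] False i s by simp
  ultimately show ?thesis by auto
qed

lemma Z_simple_nz:
  assumes s: "s = 0 \<or> s = p" and i: "i < p" "j < p"
  shows "Z s i j e \<noteq> 0"
proof -
  have "Z s 0 j e \<noteq> 0"
    using s uq_chain.simple_A_nz[OF plus_chain, of "j + 1"] uq_chain.simple_A_nz[OF minus_chain, of "j + 1"]
    by (auto simp: Z_def)
  moreover have "Z s 0 i e * Z s i j e = Z s 0 j e"
    by (rule Z_mult_simple) (use s i in auto)
  ultimately show ?thesis by auto
qed

text \<open>Right multiplication by the element at (j, i) with flag True sends the first member of
  the pair to A_ii and the second to 0. Once the first coefficient is gone, flag False sends the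
  second member to A_ii. This works for B, A and for X, Y alike.\<close>

lemma Z_pair_independent:
  assumes "s \<le> p" "i < p" "j < p" and 0: "(\<Sum>e\<in>flags s. c e *\<^sub>C Z s i j e) = 0"
  shows "\<forall>e\<in>flags s. c e = 0"
proof (cases "1 \<le> s \<and> s < p")
  case True
  then have s: "1 \<le> s" "s < p" by auto
  have nz: "Z s i i True \<noteq> 0"
    by (rule Z_diag_nz[OF s assms(2)])
  have sum: "c False *\<^sub>C Z s i j False + c True *\<^sub>C Z s i j True = 0"
    using 0 True by (simp add: flags_def UNIV_bool)
  have prod: "c False *\<^sub>C (Z s i j False * Z s j i f) + c True *\<^sub>C (Z s i j True * Z s j i f) = 0" for f
    using arg_cong[OF sum, of "\<lambda>x. x * Z s j i f"] by (simp add: distrib_right mult_scaleC_left)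
  have "c False = 0"
    using prod[of True] nz by (cases "i < s"; cases "j < s"; simp add: Z_mult[OF s] assms)
  moreover from this have "c True = 0"
    using prod[of False] prod[of True] nz
    by (cases "i < s"; cases "j < s"; simp add: Z_mult[OF s] assms)
  ultimately show ?thesis
    by (metis (full_types))
next
  case False
  then have "s = 0 \<or> s = p" using assms by auto
  moreover have "flags s = {False}"
    using False by (auto simp: flags_def)
  ultimately show ?thesis
    using 0 Z_simple_nz[of s i j False] assms by simp
qed

abbreviation "positions s \<equiv> {..<p} \<times> {..<p} \<times> flags s"

definition index :: "(nat \<times> nat \<times> nat \<times> bool) set"
  where "index = (SIGMA s:{..p}. positions s)"

definition Zf :: "nat \<times> nat \<times> nat \<times> bool \<Rightarrow> 'a"
  where "Zf = (\<lambda>(s, i, j, e). Z s i j e)"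

lemma finite_flags [simp]: "finite (flags s)"
  by (simp add: flags_def)

lemma finite_index: "finite index"
  by (simp add: index_def)

lemma mem_index [simp]: "(s, i, j, e) \<in> index \<longleftrightarrow> s \<le> p \<and> i < p \<and> j < p \<and> e \<in> flags s"
  by (auto simp: index_def)

lemma False_flags [simp]: "False \<in> flags s"
  by (simp add: flags_def)

lemma True_flags: "True \<in> flags s \<longleftrightarrow> 1 \<le> s \<and> s < p"
  by (simp add: flags_def)

lemma sum_index: "sum f index = (\<Sum>s\<le>p. \<Sum>i<p. \<Sum>j<p. \<Sum>e\<in>flags s. f (s, i, j, e))"
  by (simp add: index_def sum.cartesian_product sum.Sigma case_prod_unfold)

lemma Zf_family_independent:
  assumes 0: "(\<Sum>x\<in>index. c x *\<^sub>C Zf x) = 0"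
  shows "\<forall>x\<in>index. c x = 0"
proof -
  let ?t = "\<lambda>s i j. \<Sum>e\<in>flags s. c (s, i, j, e) *\<^sub>C Z s i j e"
  have block: "(\<Sum>i<p. \<Sum>j<p. ?t s i j) = 0" if "s \<le> p" for s
  proof -
    have "\<forall>s\<in>{..p}. (\<Sum>i<p. \<Sum>j<p. ?t s i j) = 0"
    proof (rule complex_vec.eig_independent[where T = "\<lambda>x. cas * x", OF _ _ _ casimir_eigenvalue_inj])
      show "(\<Sum>s\<le>p. \<Sum>i<p. \<Sum>j<p. ?t s i j) = 0"
        using 0 by (simp add: sum_index Zf_def)
      fix s assume s: "s \<in> {..p}"
      have "nil 1 (int s) (nil 1 (int s) (\<Sum>i<p. \<Sum>j<p. ?t s i j)) = 0"
        using s by (simp add: nil_sum nil_scale Z_weights)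
      then have "(complex_vec.eig (\<lambda>x. cas * x) (casimir_eigenvalue p s) ^^ 2) (\<Sum>i<p. \<Sum>j<p. ?t s i j) = 0"
        by (simp add: numeral_2_eq_2 nil_def complex_vec.eig_def zeta_1 distrib_left mult_scaleC_right)
      then show "\<exists>n. (complex_vec.eig (\<lambda>x. cas * x) (casimir_eigenvalue p s) ^^ n) (\<Sum>i<p. \<Sum>j<p. ?t s i j) = 0" ..
    qed (auto simp: distrib_left mult_scaleC_right)
    with that show ?thesis by auto
  qed
  have row: "(\<Sum>j<p. ?t s i j) = 0" if "s \<le> p" "i < p" for s i
  proof -
    have "\<forall>i\<in>{..<p}. (\<Sum>j<p. ?t s i j) = 0"
    proof (rule complex_vec.eig_independent[where T = "\<lambda>x. K * x", OF _ _ _ zw_inj])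
      show "(\<Sum>i<p. \<Sum>j<p. ?t s i j) = 0"
        by (rule block[OF that(1)])
      fix i assume "i \<in> {..<p}"
      then have "wt (zw s i) (\<Sum>j<p. ?t s i j)"
        using that by (intro wt_sum wt_scale Z_weights(1)) auto
      then have "(complex_vec.eig (\<lambda>x. K * x) (zw s i) ^^ 1) (\<Sum>j<p. ?t s i j) = 0"
        by (simp add: wt_def complex_vec.eig_def)
      then show "\<exists>n. (complex_vec.eig (\<lambda>x. K * x) (zw s i) ^^ n) (\<Sum>j<p. ?t s i j) = 0" ..
    qed (auto simp: distrib_left mult_scaleC_right)
    with that show ?thesis by auto
  qed
  have entry: "?t s i j = 0" if "s \<le> p" "i < p" "j < p" for s i j
  proof -
    have "\<forall>j\<in>{..<p}. ?t s i j = 0"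
    proof (rule complex_vec.eig_independent[where T = "\<lambda>x. x * K", OF _ _ _ zw_inj])
      show "(\<Sum>j<p. ?t s i j) = 0"
        by (rule row[OF that(1,2)])
      fix j assume "j \<in> {..<p}"
      then have "?t s i j * K = zw s j *\<^sub>C ?t s i j"
        using that by (simp add: sum_distrib_right complex_vec.scale_sum_right mult_scaleC_left
            Z_weights scaleC_scaleC mult.commute)
      then have "(complex_vec.eig (\<lambda>x. x * K) (zw s j) ^^ 1) (?t s i j) = 0"
        by (simp add: complex_vec.eig_def)
      then show "\<exists>n. (complex_vec.eig (\<lambda>x. x * K) (zw s j) ^^ n) (?t s i j) = 0" ..
    qed (auto simp: distrib_right mult_scaleC_left)
    with that show ?thesis by auto
  qed
  show ?thesis
  proof
    fix x assume "x \<in> index"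
    moreover obtain s i j e where "x = (s, i, j, e)" by (cases x) auto
    ultimately show "c x = 0"
      using Z_pair_independent[OF _ _ _ entry] by auto
  qed
qed

lemma inj_Zf: "inj_on Zf index" and independent_Zf: "complex_vec.independent (Zf ` index)"
  using complex_vec.independent_family[OF finite_index, of Zf] Zf_family_independent by blast+

text \<open>p - 1 blocks with two flags and two blocks with one flag give 2p layers of p^2
  positions.\<close>

lemma card_index: "card index = 2 * p ^ 3"
proof -
  have "{..p} = insert 0 (insert p {1..<p})"
    using p_pos by auto
  then have "(\<Sum>s\<le>p. card (flags s)) = 2 * p"
    using p2 by (simp add: flags_def sum.If_cases)
  moreover have "card index = p * p * (\<Sum>s\<le>p. card (flags s))"
    by (simp add: index_def card_cartesian_product sum_distrib_left mult.assoc)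
  ultimately show ?thesis
    by (simp add: power3_eq_cube)
qed

section \<open>Spanning by the monomials F^j E^i K^l\<close>

definition monomials :: "'a set"
  where "monomials = (\<lambda>(j, i, l). F ^ j * (E ^ i * K ^ l)) ` ({..<p} \<times> {..<p} \<times> {..<2 * p})"

lemma monomial_in_span: "F ^ j * (E ^ i * K ^ l) \<in> complex_vec.span monomials"
proof (cases "j < p \<and> i < p")
  case True
  have "K ^ l = K ^ (l mod (2 * p))"
  proof -
    have "K ^ l = (K ^ (2 * p)) ^ (l div (2 * p)) * K ^ (l mod (2 * p))"
      by (simp flip: power_mult power_add)
    then show ?thesis by (simp add: K_2p)
  qed
  then have "F ^ j * (E ^ i * K ^ l) \<in> monomials"
    using True p_pos unfolding monomials_def by (intro image_eqI[of _ _ "(j, i, l mod (2 * p))"]) auto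
  then show ?thesis by (rule complex_vec.span_base)
next
  case False
  have "E ^ i = 0" if "p \<le> i" using that E_p by (metis le_add_diff_inverse mult_zero_left power_add)
  moreover have "F ^ j = 0" if "p \<le> j" using that F_p by (metis le_add_diff_inverse mult_zero_left power_add)
  ultimately show ?thesis
    using False by (auto simp: complex_vec.span_zero)
qed

lemma K_E_power: "\<exists>c. K * E ^ n = c *\<^sub>C (E ^ n * K)"
proof (induction n)
  case 0
  show ?case by (rule exI[of _ 1]) simp
next
  case (Suc n)
  then obtain c where c: "K * E ^ n = c *\<^sub>C (E ^ n * K)" ..
  have "K * E ^ Suc n = q powi 2 *\<^sub>C (E * (K * E ^ n))"
    by (simp only: power_Suc mult.assoc[symmetric] KE mult_scaleC_left)
  then show ?case by (auto simp: c mult_scaleC_right scaleC_scaleC mult.assoc)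
qed

lemma Ki_eq: "Ki = K ^ (2 * p - 1)"
proof -
  have "2 * p = Suc (2 * p - 1)" using p_pos by simp
  then have "K * K ^ (2 * p - 1) = 1" using K_2p by (metis power_Suc)
  then have "Ki * (K * K ^ (2 * p - 1)) = Ki" by simp
  then show ?thesis by (simp add: KiK flip: mult.assoc)
qed

lemma K_power_E_power: "\<exists>c. K ^ m * E ^ n = c *\<^sub>C (E ^ n * K ^ m)"
proof (induction m)
  case 0
  show ?case by (rule exI[of _ 1]) simp
next
  case (Suc m)
  then obtain c where c: "K ^ m * E ^ n = c *\<^sub>C (E ^ n * K ^ m)" ..
  obtain d where d: "K * E ^ n = d *\<^sub>C (E ^ n * K)" using K_E_power by blast
  have "K ^ Suc m * E ^ n = c *\<^sub>C (K * E ^ n * K ^ m)"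
    by (simp add: c mult.assoc mult_scaleC_right)
  also have "\<dots> = (c * d) *\<^sub>C (E ^ n * K ^ Suc m)"
    by (simp add: d mult_scaleC_left scaleC_scaleC mult.assoc)
  finally show ?case ..
qed

lemma K_F_power: "\<exists>c. K * F ^ n = c *\<^sub>C (F ^ n * K)"
proof (induction n)
  case 0
  show ?case by (rule exI[of _ 1]) simp
next
  case (Suc n)
  then obtain c where c: "K * F ^ n = c *\<^sub>C (F ^ n * K)" ..
  have "K * F ^ Suc n = q powi - 2 *\<^sub>C (F * (K * F ^ n))"
    by (simp only: power_Suc mult.assoc[symmetric] KF mult_scaleC_left)
  then show ?case by (auto simp: c mult_scaleC_right scaleC_scaleC mult.assoc)
qed

lemma monomial_K_in_span: "F ^ j * (K ^ m * (E ^ i * K ^ l)) \<in> complex_vec.span monomials"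
proof -
  obtain c where c: "K ^ m * E ^ i = c *\<^sub>C (E ^ i * K ^ m)" using K_power_E_power by blast
  have "F ^ j * (K ^ m * (E ^ i * K ^ l)) = F ^ j * ((K ^ m * E ^ i) * K ^ l)"
    by (simp only: mult.assoc)
  also have "\<dots> = c *\<^sub>C (F ^ j * (E ^ i * K ^ (m + l)))"
    by (simp add: c mult_scaleC_left mult_scaleC_right mult.assoc power_add)
  finally show ?thesis
    using complex_vec.span_scale[OF monomial_in_span] by metis
qed

lemma span_monomials: "complex_vec.span monomials = UNIV"
proof (rule generated)
  let ?S = "complex_vec.span monomials"
  show "1 \<in> ?S"
    using monomial_in_span[of 0 0 0] by simp
  show "complex_vec.subspace ?S"
    by (rule complex_vec.subspace_span)
  have closed: "g * x \<in> ?S" if g: "\<And>j i l. g * (F ^ j * (E ^ i * K ^ l)) \<in> ?S" and x: "x \<in> ?S" for g x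
    using x
  proof (induction rule: complex_vec.span_induct_alt)
    case base
    show ?case by (simp add: complex_vec.span_zero)
  next
    case (step c x y)
    have "g * x \<in> ?S" using step(1) g by (auto simp: monomials_def)
    then show ?case
      using step(2) by (simp add: distrib_left mult_scaleC_right complex_vec.span_add complex_vec.span_scale)
  qed
  fix x assume x: "x \<in> ?S"
  have "E * x \<in> ?S"
  proof (rule closed[OF _ x])
    fix j i l
    show "E * (F ^ j * (E ^ i * K ^ l)) \<in> ?S"
    proof (cases j)
      case 0
      then show ?thesis
        using monomial_in_span[of 0 "Suc i" l] by (simp add: mult.assoc)
    next
      case (Suc n)
      let ?m = "E ^ i * K ^ l"
      let ?c = "qnum p (int n + 1) / D"
      have "E * (F ^ j * ?m) = F ^ j * (E ^ Suc i * K ^ l) + ?c *\<^sub>C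
          (q powi (- int n) *\<^sub>C (F ^ n * (K * ?m)) - q powi int n *\<^sub>C (F ^ n * (Ki * ?m)))"
        using arg_cong[OF EF_power[of n], of "\<lambda>y. y * ?m"]
        by (simp add: Suc mult.assoc distrib_right left_diff_distrib right_diff_distrib
            mult_scaleC_left mult_scaleC_right)
      moreover have "F ^ n * (K * ?m) \<in> ?S"
        using monomial_K_in_span[of n 1 i l] by simp
      moreover have "F ^ n * (Ki * ?m) \<in> ?S"
        unfolding Ki_eq by (rule monomial_K_in_span)
      ultimately show ?thesis
        by (simp only:) (intro complex_vec.span_add complex_vec.span_diff complex_vec.span_scale monomial_in_span)
    qed
  qed
  moreover have "F * x \<in> ?S"
  proof (rule closed[OF _ x])
    fix j i l
    show "F * (F ^ j * (E ^ i * K ^ l)) \<in> ?S"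
      using monomial_in_span[of "Suc j" i l] by (simp add: mult.assoc)
  qed
  moreover have K: "K * x \<in> ?S" if "x \<in> ?S" for x
  proof (rule closed[OF _ that])
    fix j i l
    obtain c where c: "K * F ^ j = c *\<^sub>C (F ^ j * K)" using K_F_power by blast
    have "K * (F ^ j * (E ^ i * K ^ l)) = c *\<^sub>C (F ^ j * (K ^ 1 * (E ^ i * K ^ l)))"
      by (simp add: c mult_scaleC_left flip: mult.assoc)
    then show "K * (F ^ j * (E ^ i * K ^ l)) \<in> ?S"
      using complex_vec.span_scale[OF monomial_K_in_span] by metis
  qed
  moreover have "Ki * x \<in> ?S"
  proof -
    have "K ^ m * x \<in> ?S" for m
      by (induction m) (simp_all add: x K mult.assoc)
    then show ?thesis unfolding Ki_eq .
  qed
  ultimately show "E * x \<in> ?S \<and> F * x \<in> ?S \<and> K * x \<in> ?S \<and> Ki * x \<in> ?S"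
    using x by blast
qed

lemma span_Zf: "complex_vec.span (Zf ` index) = UNIV"
proof (rule ccontr)
  assume "complex_vec.span (Zf ` index) \<noteq> UNIV"
  then obtain x where x: "x \<notin> complex_vec.span (Zf ` index)" by auto
  then have "complex_vec.independent (insert x (Zf ` index))"
    by (rule complex_vec.independent_insertI[OF _ independent_Zf])
  moreover have "finite monomials"
    by (simp add: monomials_def)
  ultimately have "card (insert x (Zf ` index)) \<le> card monomials"
    using complex_vec.independent_span_bound span_monomials by blast
  also have "\<dots> \<le> 2 * p ^ 3"
    unfolding monomials_def
    by (rule order_trans[OF card_image_le]) (simp_all add: card_cartesian_product power3_eq_cube)
  also have "card (insert x (Zf ` index)) = Suc (2 * p ^ 3)"
    using x complex_vec.span_base[of x "Zf ` index"] finite_index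
    by (simp add: card_insert_if card_image[OF inj_Zf] card_index) blast
  finally show False by simp
qed

end

section \<open>Coordinates with respect to the block bases\<close>

context uq
begin

definition cf :: "nat \<Rightarrow> nat \<Rightarrow> nat \<Rightarrow> bool \<Rightarrow> 'a \<Rightarrow> complex"
  where "cf s i j e x = complex_vec.representation (Zf ` index) x (Z s i j e)"

lemma linear_cf: "Vector_Spaces.linear (*\<^sub>C) (*) (cf s i j e)"
  unfolding cf_def by (rule complex_vec.linear_representation[OF independent_Zf span_Zf])

lemma cf_Z:
  assumes "(s, i, j, e) \<in> index" "(s', i', j', e') \<in> index"
  shows "cf s i j e (Z s' i' j' e') = (if (s, i, j, e) = (s', i', j', e') then 1 else 0)"
proof -
  have mem: "Zf (s', i', j', e') \<in> Zf ` index"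
    using assms by blast
  have "cf s i j e (Z s' i' j' e') = (if Zf (s, i, j, e) = Zf (s', i', j', e') then 1 else 0)"
    using complex_vec.representation_basis[OF independent_Zf mem] by (simp add: cf_def Zf_def)
  then show ?thesis
    using inj_on_eq_iff[OF inj_Zf assms] by simp
qed

lemma block_basis_eq:
  assumes "s \<le> p"
  shows "block_basis p E F K s = (\<lambda>x. Zf (s, x)) ` positions s"
proof -
  consider "s = p" | "s = 0" | "1 \<le> s" "s < p"
    using assms p_pos by linarith
  then show ?thesis
  proof cases
    case 1
    have "{simple_A p E F K 1 n t |n t. n \<in> {0..p - 1} \<and> t \<in> {1..p}} = (\<lambda>x. Zf (p, x)) ` positions p"
    proof (intro set_eqI iffI)
      fix x assume "x \<in> {simple_A p E F K 1 n t |n t. n \<in> {0..p - 1} \<and> t \<in> {1..p}}"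
      then obtain n t where "x = simple_A p E F K 1 n t" "n \<in> {0..p - 1}" "t \<in> {1..p}" by blast
      then show "x \<in> (\<lambda>x. Zf (p, x)) ` positions p"
        using p_pos by (intro image_eqI[of _ _ "(n, t - 1, False)"]) (auto simp: Zf_def Z_def)
    next
      fix x assume "x \<in> (\<lambda>x. Zf (p, x)) ` positions p"
      then obtain i j e where "x = Z p i j e" "i < p" "j < p" by (auto simp: Zf_def)
      then have "x = simple_A p E F K 1 i (j + 1) \<and> i \<in> {0..p - 1} \<and> j + 1 \<in> {1..p}"
        by (auto simp: Z_def)
      then show "x \<in> {simple_A p E F K 1 n t |n t. n \<in> {0..p - 1} \<and> t \<in> {1..p}}" by blast
    qed
    then show ?thesis using 1 by (simp add: block_basis_def)
  next
    case 2
    have "{simple_A p E F K (- 1) n t |n t. n \<in> {0..p - 1} \<and> t \<in> {1..p}} = (\<lambda>x. Zf (0, x)) ` positions 0"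
    proof (intro set_eqI iffI)
      fix x assume "x \<in> {simple_A p E F K (- 1) n t |n t. n \<in> {0..p - 1} \<and> t \<in> {1..p}}"
      then obtain n t where "x = simple_A p E F K (- 1) n t" "n \<in> {0..p - 1}" "t \<in> {1..p}" by blast
      then show "x \<in> (\<lambda>x. Zf (0, x)) ` positions 0"
        using p_pos by (intro image_eqI[of _ _ "(n, t - 1, False)"]) (auto simp: Zf_def Z_def)
    next
      fix x assume "x \<in> (\<lambda>x. Zf (0, x)) ` positions 0"
      then obtain i j e where "x = Z 0 i j e" "i < p" "j < p" by (auto simp: Zf_def)
      then have "x = simple_A p E F K (- 1) i (j + 1) \<and> i \<in> {0..p - 1} \<and> j + 1 \<in> {1..p}"
        by (auto simp: Z_def)
      then show "x \<in> {simple_A p E F K (- 1) n t |n t. n \<in> {0..p - 1} \<and> t \<in> {1..p}}" by blast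
    qed
    then show ?thesis using 2 p_pos by (simp add: block_basis_def)
  next
    case 3
    have fl: "flags s = UNIV" and nz: "s \<noteq> p" "s \<noteq> 0" using 3 by (simp_all add: flags_def)
    \<comment> \<open>Each family in the definition fills a rectangle of positions with corner (r,
      c) for one flag. The intervals below are written with \<open>0 + s\<close> to keep the shape
      that this fact can be resolved with.\<close>
    have part: "{f n t |n t. n \<in> {0..N - 1} \<and> t \<in> {1..M}} =
        (\<lambda>x. Zf (s, x)) ` ({r..<r + N} \<times> {c..<c + M} \<times> {e})"
      if "N > 0" "\<And>n t. n < N \<Longrightarrow> t < M \<Longrightarrow> f n (t + 1) = Z s (r + n) (c + t) e" for f r c N M e
    proof (intro set_eqI iffI)
      fix x assume "x \<in> {f n t |n t. n \<in> {0..N - 1} \<and> t \<in> {1..M}}"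
      then obtain n t where nt: "x = f n t" "n \<in> {0..N - 1}" "t \<in> {1..M}" by blast
      then have "x = Z s (r + n) (c + (t - 1)) e"
      proof -
        have "n < N" "t - 1 < M" "t - 1 + 1 = t" using nt that(1) by auto
        then show ?thesis using that(2)[of n "t - 1"] nt(1) by metis
      qed
      then show "x \<in> (\<lambda>x. Zf (s, x)) ` ({r..<r + N} \<times> {c..<c + M} \<times> {e})"
        using nt that(1) by (intro image_eqI[of _ _ "(r + n, c + (t - 1), e)"]) (auto simp: Zf_def)
    next
      fix x assume "x \<in> (\<lambda>x. Zf (s, x)) ` ({r..<r + N} \<times> {c..<c + M} \<times> {e})"
      then obtain i j where ij: "x = Z s i j e" "r \<le> i" "i < r + N" "c \<le> j" "j < c + M"
        by (auto simp: Zf_def)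
      then have "x = f (i - r) (j - c + 1) \<and> i - r \<in> {0..N - 1} \<and> j - c + 1 \<in> {1..M}"
        using that(2)[of "i - r" "j - c"] by auto
      then show "x \<in> {f n t |n t. n \<in> {0..N - 1} \<and> t \<in> {1..M}}" by blast
    qed
    have parts:
      "{Bplus p E F K s n t |n t. n \<in> {0..s - 1} \<and> t \<in> {1..s}} =
        (\<lambda>x. Zf (s, x)) ` ({0..<0 + s} \<times> {0..<0 + s} \<times> {False})"
      "{Xplus p E F K s n t |n t. n \<in> {0..p - s - 1} \<and> t \<in> {1..s}} =
        (\<lambda>x. Zf (s, x)) ` ({s..<s + (p - s)} \<times> {0..<0 + s} \<times> {False})"
      "{Yplus p E F K s n t |n t. n \<in> {0..p - s - 1} \<and> t \<in> {1..s}} =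
        (\<lambda>x. Zf (s, x)) ` ({s..<s + (p - s)} \<times> {0..<0 + s} \<times> {True})"
      "{Aplus p E F K s n t |n t. n \<in> {0..s - 1} \<and> t \<in> {1..s}} =
        (\<lambda>x. Zf (s, x)) ` ({0..<0 + s} \<times> {0..<0 + s} \<times> {True})"
      "{Bminus p E F K s n t |n t. n \<in> {0..p - s - 1} \<and> t \<in> {1..p - s}} =
        (\<lambda>x. Zf (s, x)) ` ({s..<s + (p - s)} \<times> {s..<s + (p - s)} \<times> {False})"
      "{Xminus p E F K s n t |n t. n \<in> {0..s - 1} \<and> t \<in> {1..p - s}} =
        (\<lambda>x. Zf (s, x)) ` ({0..<0 + s} \<times> {s..<s + (p - s)} \<times> {False})"
      "{Yminus p E F K s n t |n t. n \<in> {0..s - 1} \<and> t \<in> {1..p - s}} =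
        (\<lambda>x. Zf (s, x)) ` ({0..<0 + s} \<times> {s..<s + (p - s)} \<times> {True})"
      "{Aminus p E F K s n t |n t. n \<in> {0..p - s - 1} \<and> t \<in> {1..p - s}} =
        (\<lambda>x. Zf (s, x)) ` ({s..<s + (p - s)} \<times> {s..<s + (p - s)} \<times> {True})"
      by (rule part; use 3 in \<open>simp add: Z_def\<close>)+
    have "block_basis p E F K s = (\<lambda>x. Zf (s, x)) ` (
        {0..<0 + s} \<times> {0..<0 + s} \<times> {False} \<union>
        {s..<s + (p - s)} \<times> {0..<0 + s} \<times> {False} \<union>
        {s..<s + (p - s)} \<times> {0..<0 + s} \<times> {True} \<union>
        {0..<0 + s} \<times> {0..<0 + s} \<times> {True} \<union>
        {s..<s + (p - s)} \<times> {s..<s + (p - s)} \<times> {False} \<union>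
        {0..<0 + s} \<times> {s..<s + (p - s)} \<times> {False} \<union>
        {0..<0 + s} \<times> {s..<s + (p - s)} \<times> {True} \<union>
        {s..<s + (p - s)} \<times> {s..<s + (p - s)} \<times> {True})"
      unfolding block_basis_def image_Un parts[symmetric] using nz by (simp only: if_False)
    also have "({0..<0 + s} \<times> {0..<0 + s} \<times> {False} \<union>
        {s..<s + (p - s)} \<times> {0..<0 + s} \<times> {False} \<union>
        {s..<s + (p - s)} \<times> {0..<0 + s} \<times> {True} \<union>
        {0..<0 + s} \<times> {0..<0 + s} \<times> {True} \<union>
        {s..<s + (p - s)} \<times> {s..<s + (p - s)} \<times> {False} \<union>
        {0..<0 + s} \<times> {s..<s + (p - s)} \<times> {False} \<union>
        {0..<0 + s} \<times> {s..<s + (p - s)} \<times> {True} \<union>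
        {s..<s + (p - s)} \<times> {s..<s + (p - s)} \<times> {True})
        = positions s" (is "?U = _")
    proof (rule set_eqI)
      fix x :: "nat \<times> nat \<times> bool"
      obtain i j e where x: "x = (i, j, e)"
        by (cases x)
      show "x \<in> ?U \<longleftrightarrow> x \<in> positions s"
        unfolding x fl using 3 by (cases "i < s"; cases "j < s"; cases e; simp)
    qed
    finally show ?thesis .
  qed
qed

section \<open>Block components and block coefficients\<close>

lemma block_eq: "block p E F K Ki s =
    {x. \<exists>n. (complex_vec.eig (\<lambda>x. cas * x) (casimir_eigenvalue p s) ^^ n) x = 0}"
  by (simp add: block_def complex_vec.eig_def[abs_def])

lemma nil_nil_block: "nil 1 (int s) (nil 1 (int s) x) = 0 \<Longrightarrow> x \<in> block p E F K Ki s"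
  unfolding block_eq mem_Collect_eq
  by (rule exI[of _ 2]) (simp add: numeral_2_eq_2 nil_def complex_vec.eig_def zeta_1)

text \<open>Uniqueness of the components, on which the definite description in
  \<open>block_component\<close> depends.\<close>

lemma block_direct:
  assumes "\<And>j. j \<le> p \<Longrightarrow> g j \<in> block p E F K Ki j" "\<And>j. j \<le> p \<Longrightarrow> h j \<in> block p E F K Ki j"
    and "(\<Sum>j\<le>p. g j) = (\<Sum>j\<le>p. h j)" "s \<le> p"
  shows "g s = h s"
proof -
  have "\<forall>j\<in>{..p}. g j - h j = 0"
  proof (rule complex_vec.eig_independent[where T = "\<lambda>x. cas * x", OF _ _ _ casimir_eigenvalue_inj])
    fix j assume "j \<in> {..p}"
    then show "\<exists>n. (complex_vec.eig (\<lambda>x. cas * x) (casimir_eigenvalue p j) ^^ n) (g j - h j) = 0"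
      using assms(1,2)[of j] unfolding block_eq
      by (auto simp: distrib_left mult_scaleC_right intro: complex_vec.eig_generalized_diff)
  qed (use assms(3) in \<open>auto simp: distrib_left mult_scaleC_right sum_subtractf\<close>)
  then show ?thesis using assms(4) by simp
qed

lemma block_component_eq:
  assumes g: "\<And>j. j \<le> p \<Longrightarrow> g j \<in> block p E F K Ki j" and x: "x = (\<Sum>j\<le>p. g j)" and s: "s \<le> p"
  shows "block_component p E F K Ki s x = g s"
  unfolding block_component_def
proof (rule the_equality)
  show "\<exists>h. (\<forall>j\<le>p. h j \<in> block p E F K Ki j) \<and> x = (\<Sum>j\<le>p. h j) \<and> g s = h s"
    using g x by blast
  fix y assume "\<exists>h. (\<forall>j\<le>p. h j \<in> block p E F K Ki j) \<and> x = (\<Sum>j\<le>p. h j) \<and> y = h s"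
  then show "y = g s"
    using block_direct[of _ g s] g x s by auto
qed

text \<open>Grouping the expansion in the full basis by blocks yields the block components.
  Coefficients within a block agree with those in the full basis, because the block basis is a
  subset of it, and the other blocks do not contain this basis element since \<open>Zf\<close> is
  injective.\<close>

lemma block_coeff_Z:
  assumes "(s, i, j, e) \<in> index"
  shows "block_coeff p E F K Ki s (Z s i j e) x = cf s i j e x"
proof -
  let ?B = "Zf ` index"
  let ?b = "Z s i j e"
  define g where "g s = (\<Sum>y\<in>positions s. complex_vec.representation ?B x (Zf (s, y)) *\<^sub>C Zf (s, y))" for s
  have span: "g s \<in> complex_vec.span (block_basis p E F K s)" if "s \<le> p" for s
    unfolding g_def block_basis_eq[OF that]
    by (intro complex_vec.span_sum complex_vec.span_scale complex_vec.span_base) blast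
  have block: "g s \<in> block p E F K Ki s" if "s \<le> p" for s
    using that by (intro nil_nil_block) (auto simp: g_def nil_sum nil_scale Zf_def Z_weights intro!: sum.neutral)
  have "x = (\<Sum>y\<in>?B. complex_vec.representation ?B x y *\<^sub>C y)"
    using complex_vec.sum_representation_eq[OF independent_Zf, of x ?B] finite_index by (simp add: span_Zf)
  also have "\<dots> = (\<Sum>y\<in>index. complex_vec.representation ?B x (Zf y) *\<^sub>C Zf y)"
    by (simp add: sum.reindex[OF inj_Zf])
  also have "\<dots> = (\<Sum>s\<le>p. g s)"
    by (simp add: g_def index_def sum.Sigma case_prod_unfold)
  finally have x: "x = (\<Sum>s\<le>p. g s)" .
  have sub: "block_basis p E F K s' \<subseteq> ?B" if "s' \<le> p" for s'
    using that unfolding block_basis_eq[OF that] by (auto simp: index_def)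
  have s: "s \<le> p" using assms by simp
  have rep: "complex_vec.representation ?B (g s') = complex_vec.representation (block_basis p E F K s') (g s')"
    if "s' \<le> p" for s'
    by (rule complex_vec.representation_extend[OF independent_Zf span[OF that] sub[OF that]])
  have zero: "complex_vec.representation ?B (g s') ?b = 0" if "s' \<le> p" "s' \<noteq> s" for s'
  proof (rule ccontr)
    assume "complex_vec.representation ?B (g s') ?b \<noteq> 0"
    then have "?b \<in> block_basis p E F K s'"
      unfolding rep[OF that(1)] by (rule complex_vec.representation_ne_zero)
    then have "Zf (s, i, j, e) \<in> (\<lambda>x. Zf (s', x)) ` positions s'"
      unfolding block_basis_eq[OF that(1)] by (simp add: Zf_def)
    then obtain y where "y \<in> positions s'" "Zf (s, i, j, e) = Zf (s', y)"
      by blast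
    moreover from this have "(s', y) \<in> index"
      using that by (auto simp: index_def)
    ultimately show False
      using inj_onD[OF inj_Zf _ assms] that by blast
  qed
  have "cf s i j e x = (\<Sum>s'\<le>p. complex_vec.representation ?B (g s') ?b)"
    unfolding cf_def by (subst x, subst complex_vec.representation_sum[OF independent_Zf])
      (simp_all add: span_Zf)
  also have "\<dots> = complex_vec.representation ?B (g s) ?b"
    using s zero by (subst sum.remove[of _ s]) (auto intro!: sum.neutral)
  also have "\<dots> = block_coeff p E F K Ki s ?b x"
  proof -
    have "block_component p E F K Ki s x = g s"
      using block x s by (rule block_component_eq)
    then show ?thesis by (simp add: block_coeff_def rep[OF s])
  qed
  finally show ?thesis ..
qed

section \<open>Partial traces\<close>

definition tr :: "nat \<Rightarrow> nat set \<Rightarrow> bool \<Rightarrow> 'a \<Rightarrow> complex"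
  where "tr s A e x = (\<Sum>i\<in>A. cf s i i e x)"

lemma tr_Z:
  assumes "s \<le> p" "A \<subseteq> {..<p}" "e \<in> flags s" "(s', i, j, e') \<in> index"
  shows "tr s A e (Z s' i j e') = (if s = s' \<and> e = e' \<and> i = j \<and> i \<in> A then 1 else 0)"
proof -
  have fin: "finite A" using assms(2) finite_subset by blast
  have "tr s A e (Z s' i j e') = (\<Sum>k\<in>A. if k = i \<and> (s = s' \<and> e = e' \<and> i = j) then 1 else 0)"
    unfolding tr_def using assms by (intro sum.cong) (auto simp: cf_Z)
  also have "\<dots> = (\<Sum>k\<in>A. if k = i then (if s = s' \<and> e = e' \<and> i = j then 1 else 0) else 0)"
    by (intro sum.cong) auto
  also have "\<dots> = (if s = s' \<and> e = e' \<and> i = j \<and> i \<in> A then 1 else 0)"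
    using fin by (simp add: sum.delta)
  finally show ?thesis .
qed

lemma linear_functionalI:
  assumes "\<And>x y. \<phi> (x + y) = \<phi> x + \<phi> y" "\<And>c x. \<phi> (c *\<^sub>C x) = c * \<phi> x"
  shows "Vector_Spaces.linear (*\<^sub>C) (*) (\<phi> :: 'a \<Rightarrow> complex)"
  by (simp add: Vector_Spaces.linear_iff vector_space_over_itself.vector_space_axioms
      complex_vec.vector_space_axioms assms)

lemma linear_functionalD:
  assumes "Vector_Spaces.linear (*\<^sub>C) (*) (\<phi> :: 'a \<Rightarrow> complex)"
  shows "\<phi> (x + y) = \<phi> x + \<phi> y" "\<phi> (c *\<^sub>C x) = c * \<phi> x" "\<phi> (sum g A) = (\<Sum>x\<in>A. \<phi> (g x))" "\<phi> 0 = 0"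
proof -
  show add: "\<phi> (x + y) = \<phi> x + \<phi> y" and "\<phi> (c *\<^sub>C x) = c * \<phi> x" for x y
    using assms by (simp_all add: Vector_Spaces.linear_iff)
  show 0: "\<phi> 0 = 0" using add[of 0 0] by simp
  show "\<phi> (sum g A) = (\<Sum>x\<in>A. \<phi> (g x))"
    by (induction A rule: infinite_finite_induct) (simp_all add: 0 add)
qed

lemma linear_tr: "Vector_Spaces.linear (*\<^sub>C) (*) (tr s A e)"
  by (rule linear_functionalI)
    (simp_all add: tr_def linear_functionalD[OF linear_cf] sum.distrib sum_distrib_left)

lemma functional_eqI:
  assumes "Vector_Spaces.linear (*\<^sub>C) (*) (\<phi> :: 'a \<Rightarrow> complex)" "Vector_Spaces.linear (*\<^sub>C) (*) \<psi>"
    and "\<And>s i j e. (s, i, j, e) \<in> index \<Longrightarrow> \<phi> (Z s i j e) = \<psi> (Z s i j e)"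
  shows "\<phi> = \<psi>"
proof
  fix x
  have "x \<in> complex_vec.span (Zf ` index)" by (simp add: span_Zf)
  then show "\<phi> x = \<psi> x"
  proof (induction rule: complex_vec.span_induct_alt)
    case base
    show ?case using assms(1,2) by (simp add: linear_functionalD)
  next
    case (step c x y)
    then show ?case
      using assms by (auto simp: linear_functionalD Zf_def)
  qed
qed

lemma T_functions:
  shows "T_zero p E F K Ki = tr 0 {..<p} False"
    and "T_top p E F K Ki = tr p {..<p} False"
    and "1 \<le> s \<Longrightarrow> s < p \<Longrightarrow> T_plus p E F K Ki s = tr s {..<s} False"
    and "1 \<le> s \<Longrightarrow> s < p \<Longrightarrow> T_minus p E F K Ki s = tr s {s..<p} False"
    and "1 \<le> s \<Longrightarrow> s < p \<Longrightarrow> G_fun p E F K Ki s = tr s {..<p} True"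
proof -
  have sum: "(\<Sum>t\<in>{1..n}. f t) = (\<Sum>i\<in>{m..<m + n}. h i)"
    if "\<And>i. i < n \<Longrightarrow> f (Suc i) = h (m + i)" for f h :: "nat \<Rightarrow> complex" and m n
    using that by (simp add: sum.atLeast1_atMost_eq sum.atLeastLessThan_shift_0[of _ m] lessThan_atLeast0)
  have lt: "{..<n} = {0..<0 + n}" for n :: nat by (simp add: lessThan_atLeast0)
  show "T_zero p E F K Ki = tr 0 {..<p} False"
    unfolding T_zero_def[abs_def] tr_def[abs_def] lt
    by (intro ext sum) (use p_pos in \<open>simp add: block_coeff_Z[symmetric] Z_def\<close>)
  show "T_top p E F K Ki = tr p {..<p} False"
    unfolding T_top_def[abs_def] tr_def[abs_def] lt
    by (intro ext sum) (use p_pos in \<open>simp add: block_coeff_Z[symmetric] Z_def\<close>)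
  assume s: "1 \<le> s" "s < p"
  then have fl: "flags s = UNIV" by (simp add: flags_def)
  show "T_plus p E F K Ki s = tr s {..<s} False"
    unfolding T_plus_def[abs_def] tr_def[abs_def] lt
    by (intro ext sum) (use s in \<open>simp add: block_coeff_Z[symmetric] Z_def\<close>)
  have ps: "{s..<p} = {s..<s + (p - s)}" using s by simp
  show "T_minus p E F K Ki s = tr s {s..<p} False"
    unfolding T_minus_def[abs_def] tr_def[abs_def] ps
    by (intro ext sum) (use s in \<open>simp add: block_coeff_Z[symmetric] Z_def\<close>)
  have split: "(\<Sum>i<p. h i) = (\<Sum>i\<in>{0..<0 + s}. h i) + (\<Sum>i\<in>{s..<s + (p - s)}. h i)" for h :: "nat \<Rightarrow> complex"
    using s by (simp add: sum.atLeastLessThan_concat lessThan_atLeast0)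
  show "G_fun p E F K Ki s = tr s {..<p} True"
    unfolding G_fun_def[abs_def] tr_def[abs_def] split
    by (intro ext arg_cong2[where f = "(+)"] sum) (use s fl in \<open>simp_all add: block_coeff_Z[symmetric] Z_def\<close>)
qed

end

section \<open>Symmetric linear functions\<close>

context uq
begin

lemma p_nz [simp]: "p \<noteq> 0"
  using p_pos by simp

lemma cas_central: "cas * x = x * cas"
proof -
  have "{x. cas * x = x * cas} = UNIV"
  proof (rule generated)
    show "complex_vec.subspace {x. cas * x = x * cas}"
      by (auto simp: complex_vec.subspace_def distrib_left distrib_right mult_scaleC_left mult_scaleC_right)
    fix x assume "x \<in> {x. cas * x = x * cas}"
    then have x: "cas * x = x * cas" by simp
    have "cas * (g * x) = g * x * cas" if "cas * g = g * cas" for g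
      using x that by (metis mult.assoc)
    then show "E * x \<in> {x. cas * x = x * cas} \<and> F * x \<in> {x. cas * x = x * cas} \<and>
      K * x \<in> {x. cas * x = x * cas} \<and> Ki * x \<in> {x. cas * x = x * cas}"
      using cas_E cas_F cas_K cas_Ki by simp
  qed simp
  then show ?thesis by auto
qed

text \<open>The Casimir element is central, so the product inherits the generalized eigenvalues of
  both factors, which differ.\<close>

lemma Z_mult_blocks:
  assumes "(s, i, j, e) \<in> index" "(s', i', j', e') \<in> index" "s \<noteq> s'"
  shows "Z s i j e * Z s' i' j' e' = 0"
proof -
  let ?x = "Z s i j e" and ?y = "Z s' i' j' e'"
  have left: "nil 1 (int s') (?x * z) = ?x * nil 1 (int s') z" for z
  proof -
    have "cas * (?x * z) = ?x * (cas * z)"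
      by (metis cas_central mult.assoc)
    then show ?thesis
      by (simp add: nil_def right_diff_distrib mult_scaleC_right)
  qed
  have "nil 1 (int s) (nil 1 (int s) (?x * ?y)) = 0"
    using assms by (simp add: nil_mult Z_weights)
  moreover have "nil 1 (int s') (nil 1 (int s') (?x * ?y)) = 0"
    using assms by (simp add: left Z_weights)
  ultimately have e: "(complex_vec.eig (\<lambda>x. cas * x) (casimir_eigenvalue p s) ^^ 2) (?x * ?y) = 0"
    "(complex_vec.eig (\<lambda>x. cas * x) (casimir_eigenvalue p s') ^^ 2) (?x * ?y) = 0"
    by (simp_all add: numeral_2_eq_2 nil_def complex_vec.eig_def zeta_1)
  have ne: "casimir_eigenvalue p s \<noteq> casimir_eigenvalue p s'"
    using inj_onD[OF casimir_eigenvalue_inj, of s s'] assms by auto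
  show ?thesis
    by (rule complex_vec.eig_disjoint[OF _ _ e ne]) (simp_all add: distrib_left mult_scaleC_right)
qed

lemma flags_cases:
  assumes "s \<le> p" "e \<in> flags s"
  obtains "s = 0 \<or> s = p" "\<not> e" | "1 \<le> s" "s < p"
  using assms by (cases "1 \<le> s \<and> s < p") (auto simp: flags_def)

text \<open>By bilinearity only products of basis elements matter, and these vanish unless the inner
  indices match. If the outer ones differ, the result is off the diagonal. Otherwise two products at
  i and j are compared: B B gives B + rho A, with equal rho for equal signs, and X Y against Y X
  compares elements A of different signs, which is why the last hypothesis ignores the sign.\<close>

lemma SLF_I:
  assumes lin: "Vector_Spaces.linear (*\<^sub>C) (*) (\<phi> :: 'a \<Rightarrow> complex)"
    and off: "\<And>s i j e. (s, i, j, e) \<in> index \<Longrightarrow> i \<noteq> j \<Longrightarrow> \<phi> (Z s i j e) = 0"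
    and diag: "\<And>s i j. s \<le> p \<Longrightarrow> i < p \<Longrightarrow> j < p \<Longrightarrow> (i < s) = (j < s) \<Longrightarrow>
      \<phi> (Z s i i False) = \<phi> (Z s j j False)"
    and diag': "\<And>s i j. 1 \<le> s \<Longrightarrow> s < p \<Longrightarrow> i < p \<Longrightarrow> j < p \<Longrightarrow> \<phi> (Z s i i True) = \<phi> (Z s j j True)"
  shows "\<phi> \<in> SLF"
proof -
  note [simp] = linear_functionalD[OF lin]
  have mult_off: "\<phi> (Z s i j e * Z s j k f) = 0"
    if "(s, i, j, e) \<in> index" "(s, j, k, f) \<in> index" "i \<noteq> k" for s i j k e f
  proof -
    have "s \<le> p" "e \<in> flags s" using that by auto
    then show ?thesis
    proof (cases rule: flags_cases)
      case 1
      then have "Z s i j e * Z s j k f = Z s i k False"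
        using that by (intro Z_mult_simple) auto
      then show ?thesis using off[of s i k False] that by simp
    next
      case 2
      have "\<phi> (Z s i k e) = 0" for e
        using off[of s i k e] that 2 by (simp add: flags_def)
      then show ?thesis
        using that by (simp add: Z_mult[OF 2])
    qed
  qed
  have mult_diag: "\<phi> (Z s i j e * Z s j i f) = \<phi> (Z s j i f * Z s i j e)"
    if "(s, i, j, e) \<in> index" "(s, j, i, f) \<in> index" for s i j e f
  proof -
    have s: "s \<le> p" "e \<in> flags s" and ij: "i < p" "j < p" using that by auto
    show ?thesis
      using s
    proof (cases rule: flags_cases)
      case 1
      then have "Z s i j e * Z s j i f = Z s i i False" "Z s j i f * Z s i j e = Z s j j False"
        using ij by (auto intro!: Z_mult_simple)
      moreover have "(i < s) = (j < s)" using 1 ij by auto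
      ultimately show ?thesis using diag[OF s(1) ij] by simp
    next
      case 2
      have rho: "rho s i = rho s j" if "(i < s) = (j < s)"
        using that by (simp add: rho_def)
      show ?thesis
        using rho diag[OF s(1) ij] diag'[OF 2 ij] ij
        by (cases "i < s"; cases "j < s"; cases e; cases f; simp add: Z_mult[OF 2])
    qed
  qed
  have comm: "\<phi> (Zf x * Zf y) = \<phi> (Zf y * Zf x)" if "x \<in> index" "y \<in> index" for x y
  proof -
    obtain s i j e where x: "x = (s, i, j, e)" by (cases x)
    obtain s' i' j' e' where y: "y = (s', i', j', e')" by (cases y)
    note xy = that[unfolded x y]
    show ?thesis
    proof (cases "s = s'")
      case False
      then show ?thesis
        using xy by (simp add: x y Zf_def Z_mult_blocks del: mem_index)
    next
      case s: True
      have zero: "Z s i j e * Z s i' j' e' = 0" if "j \<noteq> i'"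
        using xy that s by (intro Z_mult_0) auto
      have zero': "Z s i' j' e' * Z s i j e = 0" if "j' \<noteq> i"
        using xy that s by (intro Z_mult_0) auto
      show ?thesis
        using zero zero' mult_off[of s i j e j' e'] mult_off[of s i' i e' j e] mult_diag[of s i j e e'] xy s
        by (cases "j = i'"; cases "j' = i") (auto simp: x y Zf_def simp del: mem_index)
    qed
  qed
  have lin_left: "Vector_Spaces.linear (*\<^sub>C) (*) (\<lambda>x. \<phi> (a * x))"
    and lin_right: "Vector_Spaces.linear (*\<^sub>C) (*) (\<lambda>x. \<phi> (x * a))" for a
    by (rule linear_functionalI; simp add: distrib_left distrib_right mult_scaleC_left mult_scaleC_right)+
  have 1: "(\<lambda>x. \<phi> (x * Zf y)) = (\<lambda>x. \<phi> (Zf y * x))" if "y \<in> index" for y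
  proof (rule functional_eqI[OF lin_right lin_left])
    fix s i j e assume "(s, i, j, e) \<in> index"
    then show "\<phi> (Z s i j e * Zf y) = \<phi> (Zf y * Z s i j e)"
      using comm[of "(s, i, j, e)" y] that by (simp add: Zf_def)
  qed
  have 2: "(\<lambda>x. \<phi> (a * x)) = (\<lambda>x. \<phi> (x * a))" for a
  proof (rule functional_eqI[OF lin_left lin_right])
    fix s i j e assume "(s, i, j, e) \<in> index"
    then show "\<phi> (a * Z s i j e) = \<phi> (Z s i j e * a)"
      using fun_cong[OF 1, of "(s, i, j, e)" a] by (simp add: Zf_def)
  qed
  show ?thesis
    unfolding SLF_def using lin fun_cong[OF 2] by blast
qed

text \<open>Symmetry against K kills everything off the diagonal. Elements at (i, j) and (j, i) with
  different flags multiply to A_ii in one order and to A_jj in the other, for all signs. Two B then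
  give the statement for B, the terms in A cancelling by the previous one.\<close>

lemma SLF_D:
  assumes "\<phi> \<in> SLF"
  shows "Vector_Spaces.linear (*\<^sub>C) (*) (\<phi> :: 'a \<Rightarrow> complex)"
    and "\<And>s i j e. (s, i, j, e) \<in> index \<Longrightarrow> i \<noteq> j \<Longrightarrow> \<phi> (Z s i j e) = 0"
    and "\<And>s i j. s \<le> p \<Longrightarrow> i < p \<Longrightarrow> j < p \<Longrightarrow> (i < s) = (j < s) \<Longrightarrow>
      \<phi> (Z s i i False) = \<phi> (Z s j j False)"
    and "\<And>s i j. 1 \<le> s \<Longrightarrow> s < p \<Longrightarrow> i < p \<Longrightarrow> j < p \<Longrightarrow> \<phi> (Z s i i True) = \<phi> (Z s j j True)"
proof -
  show lin: "Vector_Spaces.linear (*\<^sub>C) (*) \<phi>"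
    using assms by (simp add: SLF_def)
  note [simp] = linear_functionalD[OF lin]
  have comm: "\<phi> (a * b) = \<phi> (b * a)" for a b
    using assms by (simp add: SLF_def)
  show "\<phi> (Z s i j e) = 0" if "(s, i, j, e) \<in> index" "i \<noteq> j" for s i j e
  proof -
    have "zw s i * \<phi> (Z s i j e) = zw s j * \<phi> (Z s i j e)"
      using comm[of K "Z s i j e"] Z_weights(1,2)[of s i j e] that by (simp add: wt_def)
    then show ?thesis
      using inj_onD[OF zw_inj, of s i j] that by auto
  qed
  show diag': "\<phi> (Z s i i True) = \<phi> (Z s j j True)" if "1 \<le> s" "s < p" "i < p" "j < p" for s i j
    using comm[of "Z s i j False" "Z s j i True"] that(3,4) by (simp add: Z_mult[OF that(1,2)] split: if_splits)
  show "\<phi> (Z s i i False) = \<phi> (Z s j j False)"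
    if "s \<le> p" "i < p" "j < p" "(i < s) = (j < s)" for s i j
  proof (cases "1 \<le> s \<and> s < p")
    case True
    then have s: "1 \<le> s" "s < p" by auto
    have "rho s i = rho s j" using that by (simp add: rho_def)
    then show ?thesis
      using comm[of "Z s i j False" "Z s j i False"] that diag'[OF s that(2,3)] by (simp add: Z_mult[OF s])
  next
    case False
    then have s: "s = 0 \<or> s = p" using that by auto
    have "Z s i j False * Z s j i False = Z s i i False" "Z s j i False * Z s i j False = Z s j j False"
      using s that by (auto intro!: Z_mult_simple)
    then show ?thesis using comm[of "Z s i j False" "Z s j i False"] by simp
  qed
qed

text \<open>The classes of diagonal elements on which symmetric functions are constant. In block 0
  no index satisfies \<open>i < s\<close>; the extra case gives its only class the number 0, as in
  block p.\<close>

definition label :: "nat \<Rightarrow> nat \<Rightarrow> bool \<Rightarrow> nat \<times> nat"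
  where "label s i e = (s, if e then 2 else if s = 0 \<or> i < s then 0 else 1)"

definition labels :: "(nat \<times> nat) set"
  where "labels = insert (0, 0) (insert (p, 0) ({1..<p} \<times> {0, 1, 2}))"

definition slf_basis :: "nat \<times> nat \<Rightarrow> 'a \<Rightarrow> complex"
  where "slf_basis = (\<lambda>(s, k). if s = 0 then T_zero p E F K Ki else if s = p then T_top p E F K Ki
    else if k = 0 then T_plus p E F K Ki s else if k = 1 then T_minus p E F K Ki s
    else G_fun p E F K Ki s)"

lemma label_in_labels: "(s, i, j, e) \<in> index \<Longrightarrow> label s i e \<in> labels"
  by (auto simp: label_def labels_def flags_def split: if_splits)

lemma labels_E:
  assumes "x \<in> labels"
  obtains s i e where "(s, i, i, e) \<in> index" "x = label s i e"
proof -
  obtain s k where x: "x = (s, k)" by (cases x)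
  have "(s = 0 \<and> k = 0) \<or> (s = p \<and> k = 0) \<or> (1 \<le> s \<and> s < p \<and> (k = 0 \<or> k = 1 \<or> k = 2))"
    using assms by (auto simp: labels_def x)
  then consider "s \<le> p" "k = 0" | "1 \<le> s" "s < p" "k = 1" | "1 \<le> s" "s < p" "k = 2"
    by auto
  then show ?thesis
  proof cases
    case 1
    then show ?thesis using that[of s 0 False] p_pos by (cases "s = 0") (auto simp: label_def x)
  next
    case 2
    then show ?thesis using that[of s s False] by (auto simp: label_def x)
  next
    case 3
    then show ?thesis using that[of s 0 True] p_pos by (auto simp: label_def x flags_def)
  qed
qed

text \<open>Each of the functions sums the diagonal coefficients over exactly one class. Hence on
  basis elements it is the indicator of that class, which yields symmetry, independence and spanning
  alike.\<close>

lemma slf_basis_tr: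
  assumes "x \<in> labels"
  obtains s A e where "slf_basis x = tr s A e" "s \<le> p" "A \<subseteq> {..<p}" "e \<in> flags s"
    "\<forall>s' i e'. (s', i, i, e') \<in> index \<longrightarrow> (x = label s' i e' \<longleftrightarrow> s = s' \<and> e = e' \<and> i \<in> A)"
proof -
  obtain s k where x: "x = (s, k)" by (cases x)
  have "(s = 0 \<and> k = 0) \<or> (s = p \<and> k = 0) \<or> (1 \<le> s \<and> s < p \<and> (k = 0 \<or> k = 1 \<or> k = 2))"
    using assms by (auto simp: labels_def x)
  then consider "s = 0" "k = 0" | "s = p" "k = 0" | "1 \<le> s" "s < p" "k = 0"
    | "1 \<le> s" "s < p" "k = 1" | "1 \<le> s" "s < p" "k = 2" by auto
  then show ?thesis
  proof cases
    case 1
    then show ?thesis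
      using p_pos by (intro that[of 0 "{..<p}" False])
        (auto simp: slf_basis_def x T_functions label_def True_flags)
  next
    case 2
    then show ?thesis
      using p_pos by (intro that[of p "{..<p}" False])
        (auto simp: slf_basis_def x T_functions label_def True_flags)
  next
    case 3
    then show ?thesis
      by (intro that[of s "{..<s}" False]) (auto simp: slf_basis_def x T_functions label_def)
  next
    case 4
    then show ?thesis
      by (intro that[of s "{s..<p}" False]) (auto simp: slf_basis_def x T_functions label_def)
  next
    case 5
    then show ?thesis
      by (intro that[of s "{..<p}" True]) (auto simp: slf_basis_def x T_functions label_def True_flags)
  qed
qed

lemma slf_basis_Z:
  assumes "x \<in> labels" "(s, i, j, e) \<in> index"
  shows "slf_basis x (Z s i j e) = (if i = j \<and> x = label s i e then 1 else 0)"
proof -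
  obtain s' A e' where *: "slf_basis x = tr s' A e'" "s' \<le> p" "A \<subseteq> {..<p}" "e' \<in> flags s'"
    "\<forall>s i e. (s, i, i, e) \<in> index \<longrightarrow> (x = label s i e \<longleftrightarrow> s' = s \<and> e' = e \<and> i \<in> A)"
    by (rule slf_basis_tr[OF assms(1)]) (rule that; assumption)
  show ?thesis
  proof (cases "i = j")
    case True
    then show ?thesis
      using tr_Z[OF *(2-4) assms(2)] *(5)[rule_format, of s i e] assms(2) by (simp only: *(1)) simp
  next
    case False
    then show ?thesis
      using tr_Z[OF *(2-4) assms(2)] by (simp only: *(1)) simp
  qed
qed

lemma linear_slf_basis:
  assumes "x \<in> labels"
  shows "Vector_Spaces.linear (*\<^sub>C) (*) (slf_basis x)"
proof -
  obtain s A e where "slf_basis x = tr s A e"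
    by (rule slf_basis_tr[OF assms]) (rule that; assumption)
  then show ?thesis by (simp add: linear_tr)
qed

lemma slf_basis_SLF:
  assumes "x \<in> labels"
  shows "slf_basis x \<in> SLF"
proof (rule SLF_I[OF linear_slf_basis[OF assms]])
  fix s i j e assume "(s, i, j, e) \<in> index" "i \<noteq> j"
  then show "slf_basis x (Z s i j e) = 0"
    using slf_basis_Z[OF assms, of s i j e] by simp
next
  fix s i j assume "s \<le> p" "i < p" "j < p" "(i < s) = (j < s)"
  then show "slf_basis x (Z s i i False) = slf_basis x (Z s j j False)"
    using slf_basis_Z[OF assms, of s i i False] slf_basis_Z[OF assms, of s j j False]
    by (simp add: label_def)
next
  fix s i j assume "1 \<le> s" "s < p" "i < p" "j < p"
  then show "slf_basis x (Z s i i True) = slf_basis x (Z s j j True)"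
    using slf_basis_Z[OF assms, of s i i True] slf_basis_Z[OF assms, of s j j True]
    by (simp add: label_def flags_def)
qed

lemma finite_labels: "finite labels"
  by (simp add: labels_def)

lemma sum_scale_fun: "(\<Sum>x\<in>A. scale_fun (c x) (f x)) z = (\<Sum>x\<in>A. c x * f x z)"
proof (induction A rule: infinite_finite_induct)
  case (insert x A)
  then show ?case by (simp add: scale_fun_def)
qed simp_all

lemma slf_basis_family_independent:
  assumes "(\<Sum>x\<in>labels. scale_fun (c x) (slf_basis x)) = 0"
  shows "\<forall>x\<in>labels. c x = 0"
proof
  fix x assume x: "x \<in> labels"
  obtain s i e where i: "(s, i, i, e) \<in> index" "x = label s i e"
    using labels_E[OF x] .
  have "0 = (\<Sum>y\<in>labels. c y * slf_basis y (Z s i i e))"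
    using fun_cong[OF assms, of "Z s i i e"] by (simp add: sum_scale_fun)
  also have "\<dots> = (\<Sum>y\<in>labels. if y = x then c y else 0)"
    by (intro sum.cong) (use i in \<open>auto simp: slf_basis_Z simp del: mem_index\<close>)
  also have "\<dots> = c x"
    using x finite_labels by simp
  finally show "c x = 0" by simp
qed

lemma inj_slf_basis: "inj_on slf_basis labels"
  and independent_slf_basis: "complex_fun.independent (slf_basis ` labels)"
  using complex_fun.independent_family[OF finite_labels, of slf_basis] slf_basis_family_independent
  by blast+

lemma span_slf_basis: "complex_fun.span (slf_basis ` labels) = SLF"
proof
  have "complex_fun.subspace (SLF :: ('a \<Rightarrow> complex) set)"
  proof (rule complex_fun.subspaceI)
    show "(0 :: 'a \<Rightarrow> complex) \<in> SLF"
      by (auto simp: SLF_def intro!: linear_functionalI)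
    fix \<phi> \<psi> :: "'a \<Rightarrow> complex" and c
    assume \<phi>: "\<phi> \<in> SLF"
    note lin = linear_functionalD[OF SLF_D(1)[OF \<phi>]]
    have "Vector_Spaces.linear (*\<^sub>C) (*) (scale_fun c \<phi>)"
      by (rule linear_functionalI) (simp_all add: scale_fun_def lin algebra_simps)
    then show "scale_fun c \<phi> \<in> SLF"
      using \<phi> by (simp add: SLF_def scale_fun_def)
    assume \<psi>: "\<psi> \<in> SLF"
    note lin' = linear_functionalD[OF SLF_D(1)[OF \<psi>]]
    have "Vector_Spaces.linear (*\<^sub>C) (*) (\<phi> + \<psi>)"
      by (rule linear_functionalI) (simp_all add: lin lin' algebra_simps)
    then show "\<phi> + \<psi> \<in> SLF"
      using \<phi> \<psi> by (simp add: SLF_def)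
  qed
  then show "complex_fun.span (slf_basis ` labels) \<subseteq> SLF"
    by (intro complex_fun.span_minimal) (auto intro: slf_basis_SLF)
  show "SLF \<subseteq> complex_fun.span (slf_basis ` labels)"
  proof
    fix \<phi> :: "'a \<Rightarrow> complex" assume \<phi>: "\<phi> \<in> SLF"
    note lin = SLF_D(1)[OF \<phi>]
    \<comment> \<open>The common value of \<phi> on a class, to be used as the coefficient of its
      indicator; that it is common is \<open>wd\<close>.\<close>
    have "\<exists>z. \<forall>s i e. (s, i, i, e) \<in> index \<longrightarrow> x = label s i e \<longrightarrow> \<phi> (Z s i i e) = z" for x
    proof -
      have wd: "\<phi> (Z s i i e) = \<phi> (Z s' i' i' e')"
        if "(s, i, i, e) \<in> index" "(s', i', i', e') \<in> index" "label s i e = label s' i' e'" for s i e s' i' e'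
      proof -
        have *: "s' = s" "e' = e" "e \<or> (i < s) = (i' < s)"
          using that(3) by (auto simp: label_def split: if_splits)
        show ?thesis
        proof (cases e)
          case True
          then show ?thesis using SLF_D(4)[OF \<phi>, of s i i'] that * by (simp add: True_flags)
        next
          case False
          then show ?thesis using SLF_D(3)[OF \<phi>, of s i i'] that * by simp
        qed
      qed
      show ?thesis
      proof (cases "\<exists>s i e. (s, i, i, e) \<in> index \<and> x = label s i e")
        case True
        then obtain s i e where x: "(s, i, i, e) \<in> index" "x = label s i e" by blast
        show ?thesis
          by (intro exI[of _ "\<phi> (Z s i i e)"] allI impI wd) (use x in auto)
      next
        case False
        then show ?thesis by blast
      qed
    qed
    then have "\<exists>c. \<forall>x s i e. (s, i, i, e) \<in> index \<longrightarrow> x = label s i e \<longrightarrow> \<phi> (Z s i i e) = c x"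
      by (intro choice allI)
    then obtain c where c: "\<And>s i e. (s, i, i, e) \<in> index \<Longrightarrow> \<phi> (Z s i i e) = c (label s i e)"
      by blast
    have eq: "\<phi> = (\<Sum>x\<in>labels. scale_fun (c x) (slf_basis x))"
    proof (rule functional_eqI[OF lin])
      show "Vector_Spaces.linear (*\<^sub>C) (*) (\<Sum>x\<in>labels. scale_fun (c x) (slf_basis x))"
        by (rule linear_functionalI)
          (simp_all add: sum_scale_fun linear_functionalD[OF linear_slf_basis] algebra_simps
            sum.distrib sum_distrib_left)
      fix s i j e assume mem: "(s, i, j, e) \<in> index"
      have "(\<Sum>x\<in>labels. scale_fun (c x) (slf_basis x)) (Z s i j e) =
          (\<Sum>x\<in>labels. if x = label s i e then (if i = j then c x else 0) else 0)"
        unfolding sum_scale_fun by (intro sum.cong) (use mem in \<open>auto simp: slf_basis_Z simp del: mem_index\<close>)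
      also have "\<dots> = (if i = j then c (label s i e) else 0)"
        using finite_labels label_in_labels[OF mem] by simp
      also have "\<dots> = \<phi> (Z s i j e)"
        using c[of s i e] SLF_D(2)[OF \<phi> mem] mem by auto
      finally show "\<phi> (Z s i j e) = (\<Sum>x\<in>labels. scale_fun (c x) (slf_basis x)) (Z s i j e)" ..
    qed
    show "\<phi> \<in> complex_fun.span (slf_basis ` labels)"
      by (subst eq) (intro complex_fun.span_sum complex_fun.span_scale complex_fun.span_base imageI)
  qed
qed

text \<open>Through the labels, distinctness of a list of functions becomes distinctness of a list
  of pairs together with injectivity of \<open>slf_basis\<close>.\<close>

lemma slf_basis_list:
  "[T_zero p E F K Ki, T_top p E F K Ki] @
    concat (map (\<lambda>s. [T_plus p E F K Ki s, T_minus p E F K Ki s, G_fun p E F K Ki s]) [1..<p]) =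
   map slf_basis ([(0, 0), (p, 0)] @ concat (map (\<lambda>s. [(s, 0), (s, 1), (s, 2)]) [1..<p]))"
proof -
  have "map (\<lambda>s. map slf_basis [(s, 0), (s, 1), (s, 2)]) [1..<p] =
      map (\<lambda>s. [T_plus p E F K Ki s, T_minus p E F K Ki s, G_fun p E F K Ki s]) [1..<p]"
    by (rule map_cong[OF refl]) (simp add: slf_basis_def)
  moreover have "slf_basis (0, 0) = T_zero p E F K Ki" "slf_basis (p, 0) = T_top p E F K Ki"
    by (simp_all add: slf_basis_def)
  ultimately show ?thesis
    by (simp only: map_append map_concat map_map comp_def list.map)
qed

lemma distinct_labels: "distinct ([(0, 0), (p, 0)] @ concat (map (\<lambda>s. [(s, 0 :: nat), (s, 1), (s, 2)]) [1..<p]))"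
  and set_labels: "set ([(0, 0), (p, 0)] @ concat (map (\<lambda>s. [(s, 0 :: nat), (s, 1), (s, 2)]) [1..<p])) = labels"
proof -
  have "distinct (concat (map (\<lambda>s. [(s, 0 :: nat), (s, 1), (s, 2)]) xs))" if "distinct xs" for xs :: "nat list"
    using that by (induction xs) auto
  then show "distinct ([(0, 0), (p, 0)] @ concat (map (\<lambda>s. [(s, 0 :: nat), (s, 1), (s, 2)]) [1..<p]))"
    using p_pos by auto
  show "set ([(0, 0), (p, 0)] @ concat (map (\<lambda>s. [(s, 0 :: nat), (s, 1), (s, 2)]) [1..<p])) = labels"
    by (auto simp: labels_def)
qed

end

section \<open>From the presentation to the structural assumptions\<close>

lemma free_eval_relators:
  assumes "p > 0" "uq_relations p E F K Ki" "E ^ p = 0" "F ^ p = 0" "K ^ (2 * p) = 1" "r \<in> uq_relators p"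
  shows "free_eval (uq_assign E F K Ki) r = 0"
proof -
  interpret uq_relations p E F K Ki by fact
  have "K * E * Ki = q powi 2 *\<^sub>C E" "K * F * Ki = q powi - 2 *\<^sub>C F"
    by (simp_all add: KE KF mult_scaleC_left mult.assoc KKi)
  then show ?thesis
    using assms(3-6) KKi KiK EF
    by (auto simp: uq_relators_def Let_def free_eval_hom mult_scaleC_left)
qed

lemma uq_if_presented:
  assumes p2: "p \<ge> 2" and pres: "is_restricted_uq_sl2 p E F K Ki"
  shows "uq p E F K Ki"
proof -
  let ?h = "uq_assign E F K Ki"
  have surj: "surj (free_eval ?h)"
    and ker: "free_eval ?h f = 0 \<longleftrightarrow> f \<in> two_sided_ideal (uq_relators p)" for f
    using pres by (auto simp: is_restricted_uq_sl2_def presented_by_def)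
  have rel: "\<forall>r\<in>uq_relators p. free_eval ?h r = 0"
    by (simp add: ker two_sided_ideal.gen)
  let ?e = "free_var gen_E" and ?f = "free_var gen_F" and ?k = "free_var gen_K" and ?k' = "free_var gen_Kinv"
  have "free_eval ?h (?k * ?k' - 1) = 0" "free_eval ?h (?k' * ?k - 1) = 0"
    "free_eval ?h (?k * ?e * ?k' - free_const (qroot p powi 2) * ?e) = 0"
    "free_eval ?h (?k * ?f * ?k' - free_const (qroot p powi (- 2)) * ?f) = 0"
    "free_eval ?h (?e * ?f - ?f * ?e - free_const (1 / (qroot p - inverse (qroot p))) * (?k - ?k')) = 0"
    "free_eval ?h (?e ^ p) = 0" "free_eval ?h (?f ^ p) = 0" "free_eval ?h (?k ^ (2 * p) - 1) = 0"
    by (rule bspec[OF rel], simp add: uq_relators_def Let_def)+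
  then have rels: "K * Ki = 1" "Ki * K = 1" "K * E * Ki = qroot p powi 2 *\<^sub>C E"
    "K * F * Ki = qroot p powi (- 2) *\<^sub>C F"
    "E * F - F * E = (1 / (qroot p - inverse (qroot p))) *\<^sub>C (K - Ki)"
    "E ^ p = 0" "F ^ p = 0" "K ^ (2 * p) = 1"
    by (simp_all add: free_eval_hom mult_scaleC_left)
  show ?thesis
  proof
    show "p \<ge> 2" by (rule p2)
    show "K * Ki = 1" "Ki * K = 1" "E ^ p = 0" "F ^ p = 0" "K ^ (2 * p) = 1"
      by (fact rels)+
    show "K * E = qroot p powi 2 *\<^sub>C E * K"
      using arg_cong[OF rels(3), of "\<lambda>x. x * K"] by (simp add: mult.assoc rels(2))
    show "K * F = qroot p powi (- 2) *\<^sub>C F * K"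
      using arg_cong[OF rels(4), of "\<lambda>x. x * K"] by (simp add: mult.assoc rels(2))
    show "E * F = F * E + (1 / (qroot p - inverse (qroot p))) *\<^sub>C (K - Ki)"
      using rels(5) by (metis add.commute diff_add_cancel)
  next
    fix \<nu> :: complex and j assume \<nu>: "\<nu> ^ (2 * p) = 1" and j: "j < p"
    \<comment> \<open>The element in question, lifted to the free algebra. It acts nontrivially in
      the Verma-type algebra, where all relators vanish, so it is not in the ideal, and the ideal is
      the kernel of the evaluation in the given algebra.\<close>
    let ?f = "free_var gen_E ^ (p - 1) * free_var gen_F ^ j *
      (\<Sum>l<2 * p. free_const (inverse \<nu> ^ l) * free_var gen_K ^ l)"
    let ?h' = "uq_assign (verma_E p) (verma_F p \<nu>) (verma_K p \<nu>) (verma_Ki p \<nu>)"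
    have "free_eval ?h' ?f \<noteq> 0"
      using verma_socle[OF p2 \<nu> j] by (simp add: free_eval_hom mult_scaleC_left)
    moreover have "free_eval ?h' r = 0" if "r \<in> uq_relators p" for r
      by (rule free_eval_relators[OF _ verma_relations verma_E_p verma_F_p verma_K_2p that])
        (use p2 \<nu> in auto)
    ultimately have "free_eval ?h ?f \<noteq> 0"
      unfolding ker using free_eval_ideal by blast
    then show "E ^ (p - 1) * F ^ j * (\<Sum>l<2 * p. inverse \<nu> ^ l *\<^sub>C K ^ l) \<noteq> 0"
      by (simp add: free_eval_hom mult_scaleC_left)
  next
    fix S assume S: "1 \<in> S" "complex_vec.subspace S"
      "\<And>x. x \<in> S \<Longrightarrow> E * x \<in> S \<and> F * x \<in> S \<and> K * x \<in> S \<and> Ki * x \<in> S"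
    have word: "prod_list (map ?h w) \<in> S" for w
    proof (induction w)
      case (Cons g w)
      then show ?case using S(3) by (cases g) auto
    qed (simp add: S)
    have "free_eval ?h f \<in> S" for f
      unfolding free_eval_def
      by (intro complex_vec.subspace_sum[OF S(2)] complex_vec.subspace_scale[OF S(2)] word)
    then have "range (free_eval ?h) \<subseteq> S"
      by blast
    then show "S = UNIV"
      using surj by auto
  qed
qed

theorem theorem5p3:
  fixes p :: nat and E F K Ki :: "'a::complex_algebra_1"
  assumes "p \<ge> 2"
    and "is_restricted_uq_sl2 p E F K Ki"
  shows "T_zero p E F K Ki \<in> SLF \<and>
    T_top p E F K Ki \<in> SLF \<and>
    (\<forall>s\<in>{1..p - 1}. T_plus p E F K Ki s \<in> SLF \<and> T_minus p E F K Ki s \<in> SLF \<and>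
       G_fun p E F K Ki s \<in> SLF) \<and>
    (let L = [T_zero p E F K Ki, T_top p E F K Ki] @
             concat (map (\<lambda>s. [T_plus p E F K Ki s, T_minus p E F K Ki s, G_fun p E F K Ki s])
                      [1..<p])
     in distinct L \<and> complex_fun.independent (set L) \<and> complex_fun.span (set L) = SLF)"
proof -
  interpret uq p E F K Ki
    by (rule uq_if_presented[OF assms])
  have "distinct (map slf_basis ([(0, 0), (p, 0)] @ concat (map (\<lambda>s. [(s, 0), (s, 1), (s, 2)]) [1..<p])))"
    unfolding distinct_map set_labels using distinct_labels inj_slf_basis by blast
  moreover have mem: "T_zero p E F K Ki \<in> SLF" "T_top p E F K Ki \<in> SLF"
    using slf_basis_SLF[of "(0, 0)"] slf_basis_SLF[of "(p, 0)"] p_pos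
    by (simp_all add: slf_basis_def labels_def)
  moreover have "T_plus p E F K Ki s \<in> SLF" "T_minus p E F K Ki s \<in> SLF" "G_fun p E F K Ki s \<in> SLF"
    if "s \<in> {1..p - 1}" for s
  proof -
    have s: "1 \<le> s" "s < p" using that p_pos by auto
    then have "slf_basis (s, 0) = T_plus p E F K Ki s" "slf_basis (s, 1) = T_minus p E F K Ki s"
      "slf_basis (s, 2) = G_fun p E F K Ki s"
      by (simp_all add: slf_basis_def)
    moreover have "(s, 0) \<in> labels" "(s, 1) \<in> labels" "(s, 2) \<in> labels"
      using s by (simp_all add: labels_def)
    ultimately show "T_plus p E F K Ki s \<in> SLF" "T_minus p E F K Ki s \<in> SLF" "G_fun p E F K Ki s \<in> SLF"
      using slf_basis_SLF[of "(s, 0)"] slf_basis_SLF[of "(s, 1)"] slf_basis_SLF[of "(s, 2)"] by simp_all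
  qed
  ultimately show ?thesis
    unfolding slf_basis_list Let_def set_map set_labels
    by (intro conjI ballI independent_slf_basis span_slf_basis)
qed

end
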